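(* Consider the following types of curves of bidegree $(2,2)$ in $\mathbb{P}^1\times\mathbb{P}^1$: (1) smooth (of genus one); (2) irreducible, rational with a node; (3) irreducible, rational with a cusp; (4) type $2(1,0)+2(0,1)$: the union of two components of bidegree $(1,0)$ and two components of bidegree $(0,1)$; (5) type $2(1,1)$: the union of two irreducible components of bidegree $(1,1)$; (6) type $(2,1)+(0,1)$: the union of irreducible components of bidegrees $(2,1)$ and $(0,1)$, in two forms: (6a) the components meet in two distinct points, (6b) the components are tangent at one point; (7) type $(1,1)+(0,1)+(1,0)$: the union of irreducible components of bidegrees $(1,1)$, $(0,1)$ and $(1,0)$, in two forms: (7a) the three pairwise intersection points are distinct, (7b) the three components share a common point. All of these types occur as the edge curve of a pair of smooth conics $C_1,C_2\subset\mathbb{P}^3$ lying in distinct planes, except (3), a curve with a cusp, and (4), a reducible curve $2(1,0)+2(0,1)$ with four components; neither (3) nor (4) is the edge curve of any such pair.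
   Context: Here $\mathbb{P}^3=\mathbb{CP}^3$. For smooth conics $C_1,C_2\subset\mathbb{P}^3$ spanning different planes, a stationary bisecant is a line $\overline{p,q}$ spanned by points $p\in C_1$, $q\in C_2$, $p\neq q$, such that the tangent lines $T_pC_1$ and $T_qC_2$ meet. The edge curve is the Zariski closure in $C_1\times C_2\cong\mathbb{P}^1\times\mathbb{P}^1$ of the set of pairs $(p,q)$, $p\neq q$, such that $\overline{p,q}$ is a stationary bisecant; it has bidegree $(2,2)$. A curve in $\mathbb{P}^1\times\mathbb{P}^1$ has bidegree $(a,b)$ if it is defined in homogeneous coordinates $([s:t],[u:v])$ by a bihomogeneous polynomial of degree $a$ in $s,t$ and degree $b$ in $u,v$; thus $\{p\}\times\mathbb{P}^1$ has bidegree $(1,0)$ and $\mathbb{P}^1\times\{q\}$ has bidegree $(0,1)$. *)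

theory Defs
  imports "HOL-Analysis.Analysis" "HOL-Computational_Algebra.Polynomial"
    "HOL-Library.Function_Algebras"
begin

section \<open>Projective space\<close>

text \<open>A point of \<open>CP\<^sup>n\<close> is a one-dimensional subspace of \<open>\<complex>\<^sup>n\<^sup>+\<^sup>1\<close>; lines and planes in
  \<open>CP\<^sup>3\<close> are subspaces of \<open>\<complex>\<^sup>4\<close> of dimension two and three.  Note that the index \<open>'n\<close>
  counts homogeneous coordinates.\<close>

type_synonym 'n point = "(complex ^ 'n) set"

definition pt :: "complex ^ 'n \<Rightarrow> 'n point" where
  "pt v = vec.span {v}"


section \<open>Forms and curves on the product of two projective lines\<close>

text \<open>Forms are represented by the functions they induce, which determine them because
  \<open>\<complex>\<close> is infinite.  The zero function is a form of every (bi)degree.  Products of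
  bihomogeneous forms are the pointwise ones of \<open>Function_Algebras\<close>.\<close>

definition binary_form :: "nat \<Rightarrow> (complex^2 \<Rightarrow> complex) \<Rightarrow> bool" where
  "binary_form d f \<longleftrightarrow>
     (\<exists>c. \<forall>x. f x = (\<Sum>i\<le>d. c i * (x $ 1) ^ i * (x $ 2) ^ (d - i)))"

definition biform :: "nat \<Rightarrow> nat \<Rightarrow> (complex^2 \<Rightarrow> complex^2 \<Rightarrow> complex) \<Rightarrow> bool" where
  "biform a b F \<longleftrightarrow>
     (\<exists>c. \<forall>x y. F x y = (\<Sum>i\<le>a. \<Sum>j\<le>b.
        c i j * (x $ 1) ^ i * (x $ 2) ^ (a - i) * (y $ 1) ^ j * (y $ 2) ^ (b - j)))"

definition zeros :: "(complex^2 \<Rightarrow> complex^2 \<Rightarrow> complex) \<Rightarrow> (2 point \<times> 2 point) set" where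
  "zeros F = {(pt x, pt y) | x y. x \<noteq> 0 \<and> y \<noteq> 0 \<and> F x y = 0}"

definition zariski_closure :: "(2 point \<times> 2 point) set \<Rightarrow> (2 point \<times> 2 point) set" where
  "zariski_closure S = \<Inter> {zeros G | G. (\<exists>a b. biform a b G) \<and> S \<subseteq> zeros G}"

text \<open>Only bihomogeneous factors need to be considered: every factor of a nonzero
  bihomogeneous polynomial is bihomogeneous.\<close>

definition irreducible_biform :: "nat \<Rightarrow> nat \<Rightarrow> (complex^2 \<Rightarrow> complex^2 \<Rightarrow> complex) \<Rightarrow> bool" where
  "irreducible_biform a b F \<longleftrightarrow>
     biform a b F \<and> (\<exists>x y. F x y \<noteq> 0) \<and> (a, b) \<noteq> (0, 0) \<and>
     (\<forall>a1 b1 a2 b2 G H. biform a1 b1 G \<and> biform a2 b2 H \<and> F = G * H \<longrightarrow>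
        (a1, b1) = (0, 0) \<or> (a2, b2) = (0, 0))"


subsection \<open>Local equations and singularities\<close>

text \<open>The points \<open>[x + \<alpha> w]\<close> form an affine chart of the projective line centred at \<open>[x]\<close>.
  The polynomial \<open>f\<close> is the equation of \<open>F = 0\<close> in the affine coordinates \<open>(\<alpha>, \<beta>)\<close> of the
  product chart centred at \<open>([x], [y])\<close>.\<close>

definition local_equation ::
  "(complex^2 \<Rightarrow> complex^2 \<Rightarrow> complex) \<Rightarrow> complex^2 \<Rightarrow> complex^2 \<Rightarrow> complex^2 \<Rightarrow> complex^2 \<Rightarrow>
     complex poly poly \<Rightarrow> bool" where
  "local_equation F x w y z f \<longleftrightarrow>
     x \<noteq> 0 \<and> w \<notin> pt x \<and> y \<noteq> 0 \<and> z \<notin> pt y \<and>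
     (\<forall>\<alpha> \<beta>. F (x + \<alpha> *s w) (y + \<beta> *s z) = poly (poly f [:\<alpha>:]) \<beta>)"

abbreviation coeff2 :: "complex poly poly \<Rightarrow> nat \<Rightarrow> nat \<Rightarrow> complex" where
  "coeff2 f i j \<equiv> coeff (coeff f i) j"

definition smooth_at :: "(complex^2 \<Rightarrow> complex^2 \<Rightarrow> complex) \<Rightarrow> 2 point \<times> 2 point \<Rightarrow> bool" where
  "smooth_at F P \<longleftrightarrow>
     (\<exists>x w y z f. P = (pt x, pt y) \<and> local_equation F x w y z f \<and>
        coeff2 f 0 0 = 0 \<and> (coeff2 f 1 0 \<noteq> 0 \<or> coeff2 f 0 1 \<noteq> 0))"

text \<open>A node is a double point with two distinct tangents.\<close>

definition node_at :: "(complex^2 \<Rightarrow> complex^2 \<Rightarrow> complex) \<Rightarrow> 2 point \<times> 2 point \<Rightarrow> bool" where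
  "node_at F P \<longleftrightarrow>
     (\<exists>x w y z f. P = (pt x, pt y) \<and> local_equation F x w y z f \<and>
        coeff2 f 0 0 = 0 \<and> coeff2 f 1 0 = 0 \<and> coeff2 f 0 1 = 0 \<and>
        (coeff2 f 1 1)\<^sup>2 \<noteq> 4 * coeff2 f 2 0 * coeff2 f 0 2)"

text \<open>A cusp is a double point whose quadratic part is the square of a nonzero linear form
  \<open>l \<alpha> + m \<beta>\<close> that does not divide the cubic part; that is, the cubic part does not vanish
  at \<open>(\<alpha>, \<beta>) = (m, - l)\<close>.\<close>

definition cusp_at :: "(complex^2 \<Rightarrow> complex^2 \<Rightarrow> complex) \<Rightarrow> 2 point \<times> 2 point \<Rightarrow> bool" where
  "cusp_at F P \<longleftrightarrow>
     (\<exists>x w y z f l m. P = (pt x, pt y) \<and> local_equation F x w y z f \<and>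
        coeff2 f 0 0 = 0 \<and> coeff2 f 1 0 = 0 \<and> coeff2 f 0 1 = 0 \<and>
        (l, m) \<noteq> (0, 0) \<and>
        coeff2 f 2 0 = l\<^sup>2 \<and> coeff2 f 1 1 = 2 * l * m \<and> coeff2 f 0 2 = m\<^sup>2 \<and>
        (\<Sum>i\<le>3. coeff2 f i (3 - i) * m ^ i * (- l) ^ (3 - i)) \<noteq> 0)"

text \<open>Two curves are tangent at a common point if both are smooth there, with the same
  tangent line.\<close>

definition tangent_at ::
  "(complex^2 \<Rightarrow> complex^2 \<Rightarrow> complex) \<Rightarrow> (complex^2 \<Rightarrow> complex^2 \<Rightarrow> complex) \<Rightarrow>
     2 point \<times> 2 point \<Rightarrow> bool" where
  "tangent_at F G P \<longleftrightarrow>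
     (\<exists>x w y z f g. P = (pt x, pt y) \<and> local_equation F x w y z f \<and> local_equation G x w y z g \<and>
        coeff2 f 0 0 = 0 \<and> (coeff2 f 1 0 \<noteq> 0 \<or> coeff2 f 0 1 \<noteq> 0) \<and>
        coeff2 g 0 0 = 0 \<and> (coeff2 g 1 0 \<noteq> 0 \<or> coeff2 g 0 1 \<noteq> 0) \<and>
        coeff2 f 1 0 * coeff2 g 0 1 = coeff2 f 0 1 * coeff2 g 1 0)"


subsection \<open>Genus and rationality\<close>

text \<open>The Hilbert function of \<open>X\<close> with respect to \<open>\<O>(1,1)\<close>, that is, of its image under the
  Segre embedding.  The arithmetic genus \<open>g\<close> of a curve is read off its Hilbert polynomial
  \<open>d m + 1 - g\<close>; for a smooth curve it is the genus.\<close>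

definition biform_dim :: "(complex^2 \<Rightarrow> complex^2 \<Rightarrow> complex) set \<Rightarrow> nat" where
  "biform_dim V = vector_space.dim (\<lambda>(c::complex) F x y. c * F x y) V"

definition hilbert_function :: "(2 point \<times> 2 point) set \<Rightarrow> nat \<Rightarrow> int" where
  "hilbert_function X m =
     int (biform_dim {G. biform m m G}) - int (biform_dim {G. biform m m G \<and> X \<subseteq> zeros G})"

definition has_arithmetic_genus :: "(2 point \<times> 2 point) set \<Rightarrow> int \<Rightarrow> bool" where
  "has_arithmetic_genus X g \<longleftrightarrow>
     (\<exists>d. \<forall>\<^sub>F m in sequentially. hilbert_function X m = d * int m + 1 - g)"

text \<open>A curve is rational if it is birational to the projective line: there are rational
  maps \<open>[z] \<mapsto> ([f z], [g z])\<close> to \<open>X\<close> and \<open>([x], [y]) \<mapsto> [r x y]\<close> back that are defined and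
  inverse to each other outside finitely many points.  (For an irreducible curve, the nonempty
  Zariski open sets are the cofinite ones.)\<close>

definition rational_curve :: "(2 point \<times> 2 point) set \<Rightarrow> bool" where
  "rational_curve X \<longleftrightarrow>
     (\<exists>d e a b (f :: complex^2 \<Rightarrow> complex^2) (g :: complex^2 \<Rightarrow> complex^2)
        (r :: complex^2 \<Rightarrow> complex^2 \<Rightarrow> complex^2).
        (\<forall>k. binary_form d (\<lambda>z. f z $ k)) \<and> (\<forall>k. binary_form e (\<lambda>z. g z $ k)) \<and>
        (\<forall>k. biform a b (\<lambda>x y. r x y $ k)) \<and>
        finite {pt z | z. z \<noteq> 0 \<and>
          \<not> (f z \<noteq> 0 \<and> g z \<noteq> 0 \<and> (pt (f z), pt (g z)) \<in> X \<and>
             r (f z) (g z) \<noteq> 0 \<and> pt (r (f z) (g z)) = pt z)} \<and>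
        finite {(pt x, pt y) | x y. x \<noteq> 0 \<and> y \<noteq> 0 \<and> (pt x, pt y) \<in> X \<and>
          \<not> (r x y \<noteq> 0 \<and> f (r x y) \<noteq> 0 \<and> g (r x y) \<noteq> 0 \<and>
             pt (f (r x y)) = pt x \<and> pt (g (r x y)) = pt y)})"


subsection \<open>Types of curves of bidegree (2,2)\<close>

text \<open>A curve of bidegree (2,2) is given by its equation \<open>F\<close>.  In every one of the following
  types \<open>F\<close> is squarefree, so the curve is the same thing as the point set \<open>zeros F\<close>.\<close>

definition type_smooth :: "(complex^2 \<Rightarrow> complex^2 \<Rightarrow> complex) \<Rightarrow> bool" where
  "type_smooth F \<longleftrightarrow>
     biform 2 2 F \<and> (\<forall>P \<in> zeros F. smooth_at F P) \<and> has_arithmetic_genus (zeros F) 1"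

definition type_node :: "(complex^2 \<Rightarrow> complex^2 \<Rightarrow> complex) \<Rightarrow> bool" where
  "type_node F \<longleftrightarrow>
     irreducible_biform 2 2 F \<and> rational_curve (zeros F) \<and> (\<exists>P \<in> zeros F. node_at F P)"

definition type_cusp :: "(complex^2 \<Rightarrow> complex^2 \<Rightarrow> complex) \<Rightarrow> bool" where
  "type_cusp F \<longleftrightarrow>
     irreducible_biform 2 2 F \<and> rational_curve (zeros F) \<and> (\<exists>P \<in> zeros F. cusp_at F P)"

definition type_10_10_01_01 :: "(complex^2 \<Rightarrow> complex^2 \<Rightarrow> complex) \<Rightarrow> bool" where
  "type_10_10_01_01 F \<longleftrightarrow>
     (\<exists>G1 G2 H1 H2. irreducible_biform 1 0 G1 \<and> irreducible_biform 1 0 G2 \<and>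
        irreducible_biform 0 1 H1 \<and> irreducible_biform 0 1 H2 \<and>
        zeros G1 \<noteq> zeros G2 \<and> zeros H1 \<noteq> zeros H2 \<and> F = G1 * G2 * H1 * H2)"

definition type_11_11 :: "(complex^2 \<Rightarrow> complex^2 \<Rightarrow> complex) \<Rightarrow> bool" where
  "type_11_11 F \<longleftrightarrow>
     (\<exists>G H. irreducible_biform 1 1 G \<and> irreducible_biform 1 1 H \<and>
        zeros G \<noteq> zeros H \<and> F = G * H)"

definition type_21_01_secant :: "(complex^2 \<Rightarrow> complex^2 \<Rightarrow> complex) \<Rightarrow> bool" where
  "type_21_01_secant F \<longleftrightarrow>
     (\<exists>G H. irreducible_biform 2 1 G \<and> irreducible_biform 0 1 H \<and> F = G * H \<and>
        card (zeros G \<inter> zeros H) = 2)"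

definition type_21_01_tangent :: "(complex^2 \<Rightarrow> complex^2 \<Rightarrow> complex) \<Rightarrow> bool" where
  "type_21_01_tangent F \<longleftrightarrow>
     (\<exists>G H P. irreducible_biform 2 1 G \<and> irreducible_biform 0 1 H \<and> F = G * H \<and>
        zeros G \<inter> zeros H = {P} \<and> tangent_at G H P)"

definition type_11_01_10_triangle :: "(complex^2 \<Rightarrow> complex^2 \<Rightarrow> complex) \<Rightarrow> bool" where
  "type_11_01_10_triangle F \<longleftrightarrow>
     (\<exists>G H K P1 P2 P3. irreducible_biform 1 1 G \<and> irreducible_biform 0 1 H \<and>
        irreducible_biform 1 0 K \<and> F = G * H * K \<and>
        zeros G \<inter> zeros H = {P1} \<and> zeros G \<inter> zeros K = {P2} \<and> zeros H \<inter> zeros K = {P3} \<and>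
        distinct [P1, P2, P3])"

definition type_11_01_10_concurrent :: "(complex^2 \<Rightarrow> complex^2 \<Rightarrow> complex) \<Rightarrow> bool" where
  "type_11_01_10_concurrent F \<longleftrightarrow>
     (\<exists>G H K. irreducible_biform 1 1 G \<and> irreducible_biform 0 1 H \<and>
        irreducible_biform 1 0 K \<and> F = G * H * K \<and>
        zeros G \<inter> zeros H \<inter> zeros K \<noteq> {})"


section \<open>Conics in projective three-space\<close>

text \<open>A conic is cut out in a plane by a quadratic form \<open>v \<mapsto> v\<^sup>T A v\<close>, given by a symmetric
  Gram matrix \<open>A\<close>.\<close>

datatype conic = Conic (plane: "(complex^4) set") (gram: "complex^4^4")

definition bil :: "complex^4^4 \<Rightarrow> complex^4 \<Rightarrow> complex^4 \<Rightarrow> complex" where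
  "bil A v w = (\<Sum>i\<in>UNIV. \<Sum>j\<in>UNIV. A $ i $ j * v $ i * w $ j)"

definition conic_points :: "conic \<Rightarrow> 4 point set" where
  "conic_points C = {pt v | v. v \<in> plane C \<and> v \<noteq> 0 \<and> bil (gram C) v v = 0}"

text \<open>Jacobian criterion: \<open>w \<mapsto> 2 bil A v w\<close> is the differential at \<open>v\<close> of the quadratic
  form.\<close>

definition smooth_conic :: "conic \<Rightarrow> bool" where
  "smooth_conic C \<longleftrightarrow>
     vec.subspace (plane C) \<and> vec.dim (plane C) = 3 \<and> transpose (gram C) = gram C \<and>
     (\<forall>v \<in> plane C. v \<noteq> 0 \<and> bil (gram C) v v = 0 \<longrightarrow> (\<exists>w \<in> plane C. bil (gram C) v w \<noteq> 0))"

definition tangent_line :: "conic \<Rightarrow> 4 point \<Rightarrow> (complex^4) set" where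
  "tangent_line C p = {w \<in> plane C. \<forall>v \<in> p. bil (gram C) v w = 0}"

text \<open>The condition under which \<open>p\<close> and \<open>q\<close> span a stationary bisecant.\<close>

definition stationary_bisecant :: "conic \<Rightarrow> conic \<Rightarrow> 4 point \<Rightarrow> 4 point \<Rightarrow> bool" where
  "stationary_bisecant C1 C2 p q \<longleftrightarrow>
     p \<in> conic_points C1 \<and> q \<in> conic_points C2 \<and> p \<noteq> q \<and>
     (\<exists>w. w \<noteq> 0 \<and> w \<in> tangent_line C1 p \<inter> tangent_line C2 q)"

text \<open>The isomorphisms \<open>CP\<^sup>1 \<cong> C\<close> are the maps \<open>[x] \<mapsto> [\<phi> x]\<close> for the following \<open>\<phi>\<close>: such an
  isomorphism pulls \<open>\<O>(1)\<close> back to \<open>\<O>(2)\<close>, and \<open>C\<close> spans its plane.  Two of them differ by an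
  automorphism of \<open>CP\<^sup>1\<close>.\<close>

definition conic_parametrization :: "conic \<Rightarrow> (complex^2 \<Rightarrow> complex^4) \<Rightarrow> bool" where
  "conic_parametrization C \<phi> \<longleftrightarrow>
     (\<exists>a b c. vec.independent {a, b, c} \<and> distinct [a, b, c] \<and>
        \<phi> = (\<lambda>x. (x $ 1)\<^sup>2 *s a + (x $ 1 * x $ 2) *s b + (x $ 2)\<^sup>2 *s c)) \<and>
     conic_points C = {pt (\<phi> x) | x. x \<noteq> 0}"

definition edge_curve ::
  "conic \<Rightarrow> conic \<Rightarrow> (complex^2 \<Rightarrow> complex^4) \<Rightarrow> (complex^2 \<Rightarrow> complex^4) \<Rightarrow>
     (2 point \<times> 2 point) set" where
  "edge_curve C1 C2 \<phi>1 \<phi>2 =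
     zariski_closure {(pt x, pt y) | x y. x \<noteq> 0 \<and> y \<noteq> 0 \<and>
       stationary_bisecant C1 C2 (pt (\<phi>1 x)) (pt (\<phi>2 y))}"

definition occurs_as_edge_curve ::
  "((complex^2 \<Rightarrow> complex^2 \<Rightarrow> complex) \<Rightarrow> bool) \<Rightarrow> bool" where
  "occurs_as_edge_curve T \<longleftrightarrow>
     (\<exists>C1 C2 \<phi>1 \<phi>2 F. smooth_conic C1 \<and> smooth_conic C2 \<and> plane C1 \<noteq> plane C2 \<and>
        conic_parametrization C1 \<phi>1 \<and> conic_parametrization C2 \<phi>2 \<and>
        biform 2 2 F \<and> T F \<and> edge_curve C1 C2 \<phi>1 \<phi>2 = zeros F)"

end

theory Submission
  imports Defs "HOL-Computational_Algebra.Fundamental_Theorem_Algebra"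
begin

text \<open>
  Let \<open>L\<close> be the line in which the planes of the two conics meet.  The tangents \<open>T\<^sub>p C\<^sub>1\<close> and
  \<open>T\<^sub>q C\<^sub>2\<close> meet if and only if they pass through a common point of \<open>L\<close>.  A point of \<open>L\<close> lies on
  the tangent at the point with parameter \<open>x\<close> if a quadratic form in \<open>x\<close> vanishes, and this form
  depends linearly and injectively on the point of \<open>L\<close>.  Hence a basis of \<open>L\<close> gives two independent
  binary quadratic forms \<open>U\<close>, \<open>V\<close> for \<open>C\<^sub>1\<close> and \<open>U'\<close>, \<open>V'\<close> for \<open>C\<^sub>2\<close>, and the two tangents meet
  if and only if \<open>U(x) V'(y) - V(x) U'(y) = 0\<close>.  In other words, edge curves have equations of bidegree
  \<open>(2,2)\<close> whose \<open>3 \<times> 3\<close> matrix of coefficients has rank two.  The pairs with \<open>p = q\<close>, which are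
  not bisecants, do not change the closure: they are finitely many, and the equation, being quadratic
  in \<open>y\<close>, has no isolated zeros (\<open>zeros_not_isolated\<close>, \<open>edge_curve_eq_zeros\<close>).

  Conversely every form of rank two arises (\<open>edge_curve_exists\<close>).  A plane with two marked points can be
  identified with the space of binary quadratic forms in such a way that the two points go to \<open>U\<close> and
  \<open>V\<close>; the squares of linear forms are the zeros of the discriminant and constitute the conic, and the
  tangent at the square of a linear form \<open>l\<close> consists of the multiples of \<open>l\<close>, that is, of the forms
  that vanish at the root of \<open>l\<close>.

  The classification thus becomes a question about matrices of rank two.  In coordinates around a cusp
  with tangent \<open>l \<alpha> + m \<beta> = 0\<close>, the matrix of the equation has only zeros above the antidiagonal and its
  determinant is \<open>- 2 l\<^sup>3 m\<^sup>3 \<noteq> 0\<close>, so it has rank three.  The product of four linear forms, two in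
  each set of variables, has rank one; indeed a curve of rank two cannot contain two lines
  \<open>{x} \<times> P\<^sup>1\<close>, because \<open>U\<close> and \<open>V\<close> would share two roots.
  For the cuspidal curve it must also be seen that the zero set determines the equation; this is done
  by restricting the edge equation to a parametrization of the curve near the cusp.

  The remaining types are realized by explicit equations of rank two, written with affine coordinates
  \<open>u\<close>, \<open>v\<close>: the smooth curve \<open>u\<^sup>2 v = v\<^sup>2 - 1\<close>, the nodal curve \<open>u\<^sup>2 - v\<^sup>2 = 1\<close>, and the reducible
  ones \<open>u\<^sup>2 = v\<^sup>2\<close>, \<open>v (u\<^sup>2 - v - 1) = 0\<close>, \<open>v (u\<^sup>2 - v) = 0\<close>, \<open>u v (u v - 1) = 0\<close> and
  \<open>u v (u - v) = 0\<close>.  In terms of the conics: they do not meet on \<open>L\<close>, share one point of \<open>L\<close>, or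
  share two; \<open>L\<close> touches one of them, at a point outside or on the other one; or \<open>L\<close> touches both, at
  different points or at the same point.  For the genus of the smooth curve one shows that a form
  vanishes on it only if it is a multiple of the equation (\<open>vanishing_imp_multiple\<close>); the Hilbert function is then
  \<open>(m + 1)\<^sup>2 - (m - 1)\<^sup>2 = 4 m\<close>.
\<close>


section \<open>Points and bihomogeneous forms\<close>

lemma mem_pt: "w \<in> pt v \<longleftrightarrow> (\<exists>k. w = k *s v)"
  unfolding pt_def vec.span_singleton by auto

lemma smult_eq_solve: "c \<noteq> 0 \<Longrightarrow> c *s w = v \<Longrightarrow> w = (1 / c) *s v"
  for c :: complex
  by (auto simp: vec_eq_iff field_simps)

lemma pt_eq_iff:
  assumes "v \<noteq> 0" "w \<noteq> 0"
  shows "pt v = pt w \<longleftrightarrow> (\<exists>k. w = k *s v)"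
proof
  assume "pt v = pt w"
  moreover have "w \<in> pt w" unfolding mem_pt by (rule exI[of _ 1]) simp
  ultimately show "\<exists>k. w = k *s v" using mem_pt by blast
next
  assume "\<exists>k. w = k *s v"
  then obtain k where k: "w = k *s v" by blast
  with assms have "k \<noteq> 0" by auto
  have "l *s w = (l * k) *s v" "l *s v = (l / k) *s w" for l
    using k smult_eq_solve[of k v w] \<open>k \<noteq> 0\<close> by (simp_all add: vector_smult_assoc)
  then show "pt v = pt w" unfolding set_eq_iff mem_pt by blast
qed

lemma pt_scale: "c \<noteq> 0 \<Longrightarrow> v \<noteq> 0 \<Longrightarrow> pt (c *s v) = pt v"
  using pt_eq_iff[of v "c *s v"] by auto

lemma vec2_eq_iff: "(x::complex^2) = y \<longleftrightarrow> x $ 1 = y $ 1 \<and> x $ 2 = y $ 2"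
  by (simp add: vec_eq_iff forall_2)

lemma vec3_eq_iff: "(x::complex^3) = y \<longleftrightarrow> x $ 1 = y $ 1 \<and> x $ 2 = y $ 2 \<and> x $ 3 = y $ 3"
  by (simp add: vec_eq_iff forall_3)

lemma vec4_eq_iff:
  "(x::complex^4) = y \<longleftrightarrow> x $ 1 = y $ 1 \<and> x $ 2 = y $ 2 \<and> x $ 3 = y $ 3 \<and> x $ 4 = y $ 4"
  by (simp add: vec_eq_iff forall_4)

lemma pt2_eq_iff:
  assumes "x \<noteq> 0" "y \<noteq> (0 :: complex^2)"
  shows "pt x = pt y \<longleftrightarrow> x $ 1 * y $ 2 = x $ 2 * y $ 1"
proof
  assume "pt x = pt y"
  then show "x $ 1 * y $ 2 = x $ 2 * y $ 1" using assms by (auto simp: pt_eq_iff)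
next
  assume e: "x $ 1 * y $ 2 = x $ 2 * y $ 1"
  show "pt x = pt y"
  proof (cases "x $ 1 = 0")
    case True
    then have "x $ 2 \<noteq> 0" using assms by (auto simp: vec2_eq_iff)
    then have "y = (y $ 2 / x $ 2) *s x" using e True by (auto simp: vec2_eq_iff)
    then show ?thesis using assms pt_eq_iff by blast
  next
    case False
    then have "y = (y $ 1 / x $ 1) *s x" using e by (auto simp: vec2_eq_iff field_simps)
    then show ?thesis using assms pt_eq_iff by blast
  qed
qed

text \<open>Cramer's rule.\<close>

lemma basis2_decompose:
  assumes "x \<noteq> 0" "w \<notin> pt (x :: complex^2)"
  obtains s t where "v = s *s x + t *s w"
proof -
  have w0: "w \<noteq> 0" using assms(2) unfolding mem_pt by (metis vec.scale_zero_left)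
  have d: "x $ 1 * w $ 2 - x $ 2 * w $ 1 \<noteq> 0" (is "?d \<noteq> 0")
  proof -
    have "pt x \<noteq> pt w" using assms(2) pt_eq_iff[OF assms(1) w0] mem_pt by blast
    then show ?thesis using pt2_eq_iff[OF assms(1) w0] by simp
  qed
  have "v = ((v $ 1 * w $ 2 - v $ 2 * w $ 1) / ?d) *s x + ((x $ 1 * v $ 2 - x $ 2 * v $ 1) / ?d) *s w"
  proof -
    have "?d * v $ i = (v $ 1 * w $ 2 - v $ 2 * w $ 1) * x $ i + (x $ 1 * v $ 2 - x $ 2 * v $ 1) * w $ i"
      for i using exhaust_2[of i] by (auto simp: algebra_simps)
    then have "?d *s v = (v $ 1 * w $ 2 - v $ 2 * w $ 1) *s x + (x $ 1 * v $ 2 - x $ 2 * v $ 1) *s w"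
      by (simp only: vec_eq_iff vector_smult_component vector_add_component) simp
    from smult_eq_solve[OF d this] show ?thesis
      by (simp only: vector_add_ldistrib vector_smult_assoc times_divide_eq_left mult_1_left)
  qed
  then show thesis by (rule that)
qed

lemma exists_other_point:
  assumes "x \<noteq> (0 :: complex^2)"
  obtains w where "w \<notin> pt x"
proof -
  have "vector [0, 1] \<notin> pt x \<or> vector [1, 0] \<notin> pt x"
    by (cases "x $ 1 = 0") (auto simp: mem_pt vec2_eq_iff)
  then show thesis using that by blast
qed

lemma add_scaled_not_zero:
  assumes "x \<noteq> 0" "w \<notin> pt x"
  shows "x + \<alpha> *s w \<noteq> 0"
proof
  assume h: "x + \<alpha> *s w = 0"
  with assms(1) have "\<alpha> \<noteq> 0" by auto
  have "\<alpha> *s w = (- 1) *s x" using h by (simp add: add_eq_0_iff)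
  from smult_eq_solve[OF \<open>\<alpha> \<noteq> 0\<close> this] have "w = (- 1 / \<alpha>) *s x"
    by (simp add: vector_smult_assoc)
  then show False using assms(2) mem_pt by blast
qed

lemma pt_add_scaled_inj:
  assumes "x \<noteq> 0" "w \<notin> pt x" "pt (x + \<alpha> *s w) = pt (x + \<beta> *s w)"
  shows "\<alpha> = \<beta>"
proof (rule ccontr)
  assume ne: "\<alpha> \<noteq> \<beta>"
  obtain k where k: "x + \<beta> *s w = k *s (x + \<alpha> *s w)"
    using assms pt_eq_iff add_scaled_not_zero by metis
  have e: "(\<beta> - k * \<alpha>) *s w = (k - 1) *s x"
  proof -
    have "(\<beta> - k * \<alpha>) * w $ i = (k - 1) * x $ i" for i
    proof -
      have "(x + \<beta> *s w) $ i = (k *s (x + \<alpha> *s w)) $ i" using k by simp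
      then show "(\<beta> - k * \<alpha>) * w $ i = (k - 1) * x $ i" by (simp add: algebra_simps)
    qed
    then show ?thesis unfolding vec_eq_iff vector_smult_component by blast
  qed
  show False
  proof (cases "\<beta> - k * \<alpha> = 0")
    case True
    then have "(k - 1) *s x = 0" using e by simp
    then have "k = 1" using assms(1) unfolding vector_mul_eq_0 by simp
    then show False using True ne by simp
  next
    case False
    have "w = ((k - 1) / (\<beta> - k * \<alpha>)) *s x"
      using smult_eq_solve[OF False e]
      by (simp only: vector_smult_assoc times_divide_eq_left mult_1_left)
    then show False using assms(2) mem_pt by blast
  qed
qed

lemma biform_scale:
  assumes "biform a b F"
  shows "F (s *s x) (t *s y) = s ^ a * t ^ b * F x y"
proof -
  obtain c where c: "\<And>x y. F x y = (\<Sum>i\<le>a. \<Sum>j\<le>b.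
        c i j * (x $ 1) ^ i * (x $ 2) ^ (a - i) * (y $ 1) ^ j * (y $ 2) ^ (b - j))"
    using assms unfolding biform_def by blast
  have *: "(s * p) ^ i * (s * q) ^ (d - i) = s ^ d * (p ^ i * q ^ (d - i))" if "i \<le> d"
    for s p q :: complex and i d
  proof -
    have "s ^ i * s ^ (d - i) = s ^ d" using that by (simp flip: power_add)
    then show ?thesis by (simp add: power_mult_distrib mult_ac)
  qed
  have "c i j * (s *s x) $ 1 ^ i * (s *s x) $ 2 ^ (a - i) * (t *s y) $ 1 ^ j * (t *s y) $ 2 ^ (b - j)
      = s ^ a * t ^ b * (c i j * x $ 1 ^ i * x $ 2 ^ (a - i) * y $ 1 ^ j * y $ 2 ^ (b - j))"
    if "i \<le> a" "j \<le> b" for i j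
    using *[OF that(1), of s "x $ 1" "x $ 2"] *[OF that(2), of t "y $ 1" "y $ 2"]
    by (simp add: mult_ac)
  then show ?thesis unfolding c sum_distrib_left by (intro sum.cong refl) auto
qed

lemma in_zeros_iff:
  assumes "biform a b F" "x \<noteq> 0" "y \<noteq> 0"
  shows "(pt x, pt y) \<in> zeros F \<longleftrightarrow> F x y = 0"
proof
  assume "(pt x, pt y) \<in> zeros F"
  then obtain x' y' where h: "x' \<noteq> 0" "y' \<noteq> 0" "pt x' = pt x" "pt y' = pt y" "F x' y' = 0"
    unfolding zeros_def by blast
  then obtain k l where "x = k *s x'" "y = l *s y'" using assms pt_eq_iff by metis
  then show "F x y = 0" using h biform_scale[OF assms(1)] by simp
next
  assume "F x y = 0"
  then show "(pt x, pt y) \<in> zeros F" unfolding zeros_def using assms by blast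
qed

lemma zeros_subset_iff:
  assumes "biform a b F"
  shows "zeros G \<subseteq> zeros F \<longleftrightarrow> (\<forall>x y. x \<noteq> 0 \<longrightarrow> y \<noteq> 0 \<longrightarrow> G x y = 0 \<longrightarrow> F x y = 0)"
proof
  show "\<forall>x y. x \<noteq> 0 \<longrightarrow> y \<noteq> 0 \<longrightarrow> G x y = 0 \<longrightarrow> F x y = 0" if "zeros G \<subseteq> zeros F"
  proof (intro allI impI)
    fix x y :: "complex^2" assume xy: "x \<noteq> 0" "y \<noteq> 0" "G x y = 0"
    then have "(pt x, pt y) \<in> zeros G" unfolding zeros_def by blast
    then show "F x y = 0" using that in_zeros_iff[OF assms xy(1,2)] by blast
  qed
  show "zeros G \<subseteq> zeros F" if "\<forall>x y. x \<noteq> 0 \<longrightarrow> y \<noteq> 0 \<longrightarrow> G x y = 0 \<longrightarrow> F x y = 0"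
    using that unfolding zeros_def by blast
qed

lemma biform_zero: "biform a b (\<lambda>x y. 0)"
  unfolding biform_def by (rule exI[of _ "\<lambda>i j. 0"]) simp

lemma biform_add: "biform a b F \<Longrightarrow> biform a b G \<Longrightarrow> biform a b (\<lambda>x y. F x y + G x y)"
  unfolding biform_def
proof (elim exE)
  fix c d
  assume "\<forall>x y. F x y = (\<Sum>i\<le>a. \<Sum>j\<le>b. c i j * x $ 1 ^ i * x $ 2 ^ (a - i) * y $ 1 ^ j * y $ 2 ^ (b - j))"
    "\<forall>x y. G x y = (\<Sum>i\<le>a. \<Sum>j\<le>b. d i j * x $ 1 ^ i * x $ 2 ^ (a - i) * y $ 1 ^ j * y $ 2 ^ (b - j))"
  then show "\<exists>c. \<forall>x y. F x y + G x y =
     (\<Sum>i\<le>a. \<Sum>j\<le>b. c i j * x $ 1 ^ i * x $ 2 ^ (a - i) * y $ 1 ^ j * y $ 2 ^ (b - j))"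
    by (intro exI[of _ "\<lambda>i j. c i j + d i j"]) (simp add: sum.distrib algebra_simps)
qed

lemma biform_cmult: "biform a b F \<Longrightarrow> biform a b (\<lambda>x y. k * F x y)"
  unfolding biform_def
proof (elim exE)
  fix c
  assume "\<forall>x y. F x y = (\<Sum>i\<le>a. \<Sum>j\<le>b. c i j * x $ 1 ^ i * x $ 2 ^ (a - i) * y $ 1 ^ j * y $ 2 ^ (b - j))"
  then show "\<exists>c. \<forall>x y. k * F x y =
     (\<Sum>i\<le>a. \<Sum>j\<le>b. c i j * x $ 1 ^ i * x $ 2 ^ (a - i) * y $ 1 ^ j * y $ 2 ^ (b - j))"
    by (intro exI[of _ "\<lambda>i j. k * c i j"]) (simp add: sum_distrib_left algebra_simps)
qed

lemma biform_diff: "biform a b F \<Longrightarrow> biform a b G \<Longrightarrow> biform a b (\<lambda>x y. F x y - G x y)"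
  using biform_add[of a b F "\<lambda>x y. (-1) * G x y"] biform_cmult[of a b G "-1"] by simp

lemma biform_sum: "(\<And>i. i \<in> I \<Longrightarrow> biform a b (F i)) \<Longrightarrow> biform a b (\<lambda>x y. \<Sum>i\<in>I. F i x y)"
  by (induction I rule: infinite_finite_induct) (auto simp: biform_zero intro: biform_add)

definition monomial :: "nat \<Rightarrow> nat \<Rightarrow> nat \<Rightarrow> nat \<Rightarrow> complex^2 \<Rightarrow> complex^2 \<Rightarrow> complex" where
  "monomial a b i j x y = (x $ 1) ^ i * (x $ 2) ^ (a - i) * (y $ 1) ^ j * (y $ 2) ^ (b - j)"

lemma biform_monomial:
  assumes "i \<le> a" "j \<le> b"
  shows "biform a b (monomial a b i j)"
  unfolding biform_def
proof (intro exI allI)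
  fix x y
  have "(\<Sum>i'\<le>a. \<Sum>j'\<le>b. (if i' = i then if j' = j then 1 else 0 else 0) *
      x $ 1 ^ i' * x $ 2 ^ (a - i') * y $ 1 ^ j' * y $ 2 ^ (b - j'))
    = (\<Sum>i'\<le>a. if i' = i then (\<Sum>j'\<le>b. if j' = j then monomial a b i j x y else 0) else 0)"
    by (intro sum.cong refl) (auto simp: monomial_def if_distrib[of "\<lambda>c. c * _"] mult.assoc cong: if_cong intro!: sum.neutral)
  also have "\<dots> = monomial a b i j x y" using assms by simp
  finally show "monomial a b i j x y = (\<Sum>i'\<le>a. \<Sum>j'\<le>b. (if i' = i then if j' = j then 1 else 0 else 0) *
      x $ 1 ^ i' * x $ 2 ^ (a - i') * y $ 1 ^ j' * y $ 2 ^ (b - j'))" by simp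
qed

lemma biform_iff_monomials:
  "biform a b F \<longleftrightarrow> (\<exists>c. \<forall>x y. F x y = (\<Sum>i\<le>a. \<Sum>j\<le>b. c i j * monomial a b i j x y))"
  unfolding biform_def monomial_def by (simp add: mult.assoc)

lemma biform_mult:
  assumes "biform a b F" "biform a' b' G"
  shows "biform (a + a') (b + b') (\<lambda>x y. F x y * G x y)"
proof -
  obtain c d where
    c: "\<And>x y. F x y = (\<Sum>i\<le>a. \<Sum>j\<le>b. c i j * monomial a b i j x y)" and
    d: "\<And>x y. G x y = (\<Sum>i\<le>a'. \<Sum>j\<le>b'. d i j * monomial a' b' i j x y)"
    using assms unfolding biform_iff_monomials by auto
  have m: "monomial a b i j x y * monomial a' b' i' j' x y = monomial (a + a') (b + b') (i + i') (j + j') x y"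
    if "i \<le> a" "j \<le> b" "i' \<le> a'" "j' \<le> b'" for i j i' j' x y
  proof -
    have "a + a' - (i + i') = (a - i) + (a' - i')" "b + b' - (j + j') = (b - j) + (b' - j')"
      using that by auto
    then show ?thesis unfolding monomial_def by (simp add: power_add)
  qed
  have e: "F x y * G x y = (\<Sum>i\<le>a. \<Sum>i'\<le>a'. \<Sum>j\<le>b. \<Sum>j'\<le>b'.
     (c i j * d i' j') * monomial (a + a') (b + b') (i + i') (j + j') x y)" for x y
    unfolding c d sum_product by (intro sum.cong refl) (simp flip: m)
  show ?thesis unfolding e
    by (intro biform_sum biform_cmult biform_monomial) auto
qed

text \<open>Along an affine line in each factor a form is a polynomial; this is the bridge between forms
  and their local equations.\<close>

lemma biform_on_lines:
  assumes "biform a b F"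
  shows "\<exists>C. \<forall>\<alpha> \<beta>. F (x + \<alpha> *s w) (y + \<beta> *s z) = (\<Sum>k\<le>a. \<Sum>l\<le>b. C k l * \<alpha> ^ k * \<beta> ^ l)"
proof -
  obtain c where c: "\<And>x y. F x y = (\<Sum>i\<le>a. \<Sum>j\<le>b.
        c i j * (x $ 1) ^ i * (x $ 2) ^ (a - i) * (y $ 1) ^ j * (y $ 2) ^ (b - j))"
    using assms unfolding biform_def by blast
  define L where "L x w d i = [:x $ 1, w $ 1:] ^ i * [:x $ 2, w $ 2:] ^ (d - i)"
    for x w :: "complex^2" and d i :: nat
  have L: "((x + \<alpha> *s w) $ 1) ^ i * ((x + \<alpha> *s w) $ 2) ^ (d - i) = (\<Sum>k\<le>d. coeff (L x w d i) k * \<alpha> ^ k)"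
    if "i \<le> d" for x w :: "complex^2" and \<alpha> d i
  proof -
    have "degree (L x w d i) \<le> degree ([:x $ 1, w $ 1:] ^ i) + degree ([:x $ 2, w $ 2:] ^ (d - i))"
      unfolding L_def by (rule degree_mult_le)
    also have "\<dots> \<le> 1 * i + 1 * (d - i)"
      by (intro add_mono order_trans[OF degree_power_le] mult_right_mono) (auto split: if_splits)
    finally have deg: "degree (L x w d i) \<le> d" using that by simp
    have "((x + \<alpha> *s w) $ 1) ^ i * ((x + \<alpha> *s w) $ 2) ^ (d - i) = poly (L x w d i) \<alpha>"
      unfolding L_def by (simp add: poly_power)
    also have "\<dots> = (\<Sum>k\<le>d. coeff (L x w d i) k * \<alpha> ^ k)"
      unfolding poly_altdef using deg
      by (intro sum.mono_neutral_left) (auto simp: coeff_eq_0)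
    finally show ?thesis .
  qed
  have "F (x + \<alpha> *s w) (y + \<beta> *s z) =
     (\<Sum>k\<le>a. \<Sum>l\<le>b. (\<Sum>i\<le>a. \<Sum>j\<le>b. c i j * coeff (L x w a i) k * coeff (L y z b j) l) * \<alpha> ^ k * \<beta> ^ l)"
    for \<alpha> \<beta>
  proof -
    have "F (x + \<alpha> *s w) (y + \<beta> *s z) = (\<Sum>i\<le>a. \<Sum>j\<le>b. c i j *
      (\<Sum>k\<le>a. coeff (L x w a i) k * \<alpha> ^ k) * (\<Sum>l\<le>b. coeff (L y z b j) l * \<beta> ^ l))"
      (is "_ = (\<Sum>i\<le>a. \<Sum>j\<le>b. ?t i j)")
    proof -
      have "c i j * (x + \<alpha> *s w) $ 1 ^ i * (x + \<alpha> *s w) $ 2 ^ (a - i)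
          * (y + \<beta> *s z) $ 1 ^ j * (y + \<beta> *s z) $ 2 ^ (b - j) = ?t i j" if "i \<le> a" "j \<le> b" for i j
        unfolding L[OF that(1), symmetric] L[OF that(2), symmetric] by (simp only: mult.assoc)
      then show ?thesis unfolding c by (intro sum.cong refl) auto
    qed
    also have "\<dots> = (\<Sum>i\<le>a. \<Sum>j\<le>b. \<Sum>k\<le>a. \<Sum>l\<le>b.
        c i j * coeff (L x w a i) k * coeff (L y z b j) l * \<alpha> ^ k * \<beta> ^ l)"
    proof -
      have "r * (\<Sum>k\<le>a. f k) * (\<Sum>l\<le>b. g l) = (\<Sum>k\<le>a. \<Sum>l\<le>b. r * f k * g l)"
        for r :: complex and f g
        by (simp only: sum_distrib_left[of r f] sum_product)
      then show ?thesis by (simp only: mult_ac)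
    qed
    also have "\<dots> = (\<Sum>i\<le>a. \<Sum>k\<le>a. \<Sum>j\<le>b. \<Sum>l\<le>b.
        c i j * coeff (L x w a i) k * coeff (L y z b j) l * \<alpha> ^ k * \<beta> ^ l)"
      by (rule sum.cong[OF refl], rule sum.swap)
    also have "\<dots> = (\<Sum>k\<le>a. \<Sum>i\<le>a. \<Sum>l\<le>b. \<Sum>j\<le>b.
        c i j * coeff (L x w a i) k * coeff (L y z b j) l * \<alpha> ^ k * \<beta> ^ l)"
      by (rule trans[OF sum.swap], rule sum.cong[OF refl], rule sum.cong[OF refl], rule sum.swap)
    also have "\<dots> = (\<Sum>k\<le>a. \<Sum>l\<le>b. \<Sum>i\<le>a. \<Sum>j\<le>b.
        c i j * coeff (L x w a i) k * coeff (L y z b j) l * \<alpha> ^ k * \<beta> ^ l)"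
      by (rule sum.cong[OF refl], rule sum.swap)
    finally show ?thesis unfolding sum_distrib_right .
  qed
  then show ?thesis by (intro exI allI)
qed

lemma biform_on_line_poly:
  assumes "biform a b F"
  shows "\<exists>p. \<forall>t. F (x + t *s w) (y + t *s z) = poly p t"
proof -
  obtain C where C: "\<And>\<alpha> \<beta>. F (x + \<alpha> *s w) (y + \<beta> *s z) = (\<Sum>k\<le>a. \<Sum>l\<le>b. C k l * \<alpha> ^ k * \<beta> ^ l)"
    using biform_on_lines[OF assms, of x w y z] by blast
  have "F (x + t *s w) (y + t *s z) = poly (\<Sum>k\<le>a. \<Sum>l\<le>b. monom (C k l) (k + l)) t" for t
    unfolding C poly_sum poly_monom power_add mult.assoc ..
  then show ?thesis by (intro exI allI)
qed

text \<open>Two nonzero forms have a common point of non-vanishing on the line that joins a point of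
  non-vanishing of the one to such a point of the other.\<close>

lemma biform_mult_eq_0:
  assumes F: "biform a b F" and G: "biform a' b' G" and FG: "\<And>x y. F x y * G x y = 0"
    and x: "F x0 y0 \<noteq> 0"
  shows "G x y = 0"
proof (rule ccontr)
  assume "G x y \<noteq> 0"
  obtain p where p: "\<And>t. F (x0 + t *s (x - x0)) (y0 + t *s (y - y0)) = poly p t"
    using biform_on_line_poly[OF F, of x0 "x - x0" y0 "y - y0"] by blast
  obtain q where q: "\<And>t. G (x0 + t *s (x - x0)) (y0 + t *s (y - y0)) = poly q t"
    using biform_on_line_poly[OF G, of x0 "x - x0" y0 "y - y0"] by blast
  have "poly (p * q) t = 0" for t using FG by (simp flip: p q)
  then have "p * q = 0" using poly_all_0_iff_0 by blast
  then have "p = 0 \<or> q = 0" by simp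
  then show False using p[of 0] q[of 1] x \<open>G x y \<noteq> 0\<close> by auto
qed

lemma poly_zero_off_finite:
  assumes "finite K" "\<And>t. t \<notin> K \<Longrightarrow> poly (p :: complex poly) t = 0"
  shows "p = 0"
proof (rule ccontr)
  assume "p \<noteq> 0"
  then have "finite {t. poly p t = 0}" by (rule poly_roots_finite)
  then have "finite (K \<union> {t. poly p t = 0})" using assms by simp
  moreover have "K \<union> {t. poly p t = 0} = UNIV" using assms by auto
  ultimately show False using infinite_UNIV_char_0 by metis
qed

lemma double_sum_coeffs_zero:
  assumes "finite K" and z: "\<And>\<alpha> \<beta>. \<beta> \<notin> K \<Longrightarrow> (\<Sum>i\<le>a. \<Sum>j\<le>b. c i j * \<alpha> ^ i * \<beta> ^ j) = (0::complex)"
    and ij: "i \<le> a" "j \<le> b"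
  shows "c i j = 0"
proof -
  have *: "(\<Sum>j\<le>b. c i j * \<beta> ^ j) = 0" if "\<beta> \<notin> K" for \<beta>
  proof -
    have "\<forall>\<alpha>. (\<Sum>i\<le>a. (\<Sum>j\<le>b. c i j * \<beta> ^ j) * \<alpha> ^ i) = 0"
    proof
      fix \<alpha> show "(\<Sum>i\<le>a. (\<Sum>j\<le>b. c i j * \<beta> ^ j) * \<alpha> ^ i) = 0"
        using z[OF that, of \<alpha>] unfolding sum_distrib_right by (simp only: mult_ac)
    qed
    then show ?thesis using ij unfolding polyfun_eq_0 by simp
  qed
  let ?p = "\<Sum>j\<le>b. monom (c i j) j"
  have "?p = 0" by (rule poly_zero_off_finite[OF assms(1)]) (simp add: poly_sum poly_monom *)
  then have "\<forall>\<beta>. (\<Sum>j\<le>b. c i j * \<beta> ^ j) = 0" 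
    using poly_0 by (simp flip: poly_monom poly_sum)
  then show ?thesis using ij unfolding polyfun_eq_0 by simp
qed

text \<open>A form is determined by its values on an affine chart, even after finitely many lines \<open>y = const\<close>
  are removed: this allows generic choices of \<open>y\<close> when a form is shown to vanish.\<close>

lemma biform_zeroI:
  assumes "biform a b F" "finite K" "\<And>u v. v \<notin> K \<Longrightarrow> F (vector [u, 1]) (vector [v, 1]) = 0"
  shows "F x y = 0"
proof -
  obtain c where c: "\<And>x y. F x y = (\<Sum>i\<le>a. \<Sum>j\<le>b.
        c i j * (x $ 1) ^ i * (x $ 2) ^ (a - i) * (y $ 1) ^ j * (y $ 2) ^ (b - j))"
    using assms unfolding biform_def by blast
  have "c i j = 0" if "i \<le> a" "j \<le> b" for i j
  proof (rule double_sum_coeffs_zero[OF assms(2) _ that])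
    show "(\<Sum>i\<le>a. \<Sum>j\<le>b. c i j * u ^ i * v ^ j) = 0" if "v \<notin> K" for u v
      using assms(3)[OF that, of u] unfolding c by simp
  qed
  then show ?thesis unfolding c by simp
qed

section \<open>Pencils of binary quadratic forms\<close>

definition quad :: "complex^3 \<Rightarrow> complex^2 \<Rightarrow> complex" where
  "quad U x = U $ 1 * (x $ 1)\<^sup>2 + U $ 2 * (x $ 1 * x $ 2) + U $ 3 * (x $ 2)\<^sup>2"

text \<open>The coefficient of \<open>s t\<close> in \<open>quad U (s x + t w)\<close>.\<close>

definition polar :: "complex^3 \<Rightarrow> complex^2 \<Rightarrow> complex^2 \<Rightarrow> complex" where
  "polar U x w = 2 * U $ 1 * (x $ 1 * w $ 1) + U $ 2 * (x $ 1 * w $ 2 + x $ 2 * w $ 1) + 2 * U $ 3 * (x $ 2 * w $ 2)"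

lemma quad_combination:
  "quad U (s *s x + t *s w) = s\<^sup>2 * quad U x + s * t * polar U x w + t\<^sup>2 * quad U w"
  by (simp add: quad_def polar_def power2_eq_square algebra_simps)

lemma quad_on_line: "quad U (x + t *s w) = quad U x + polar U x w * t + quad U w * t\<^sup>2"
  using quad_combination[of U 1 x t w] by (simp add: mult_ac)

lemma quad_linear: "quad (s *s U + t *s V) x = s * quad U x + t * quad V x"
  by (simp add: quad_def algebra_simps)

lemma quad_zero_iff: "(\<forall>x. quad U x = 0) \<longleftrightarrow> U = 0"
proof
  assume h: "\<forall>x. quad U x = 0"
  have "quad U (vector [1, 0]) = 0" "quad U (vector [0, 1]) = 0" "quad U (vector [1, 1]) = 0"
    using h by auto
  then show "U = 0" by (simp add: quad_def vec3_eq_iff)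
qed (simp add: quad_def)

lemma biform_quad_left: "biform 2 0 (\<lambda>x y. quad U x)"
  unfolding biform_def
  by (rule exI[of _ "\<lambda>i j. if i = 0 then U $ 3 else if i = 1 then U $ 2 else U $ 1"])
    (simp add: quad_def numeral_2_eq_2 atMost_Suc)

lemma biform_quad_right: "biform 0 2 (\<lambda>x y. quad U y)"
  unfolding biform_def
  by (rule exI[of _ "\<lambda>i j. if j = 0 then U $ 3 else if j = 1 then U $ 2 else U $ 1"])
    (simp add: quad_def numeral_2_eq_2 atMost_Suc)

definition independent_pair :: "complex^'n \<Rightarrow> complex^'n \<Rightarrow> bool" where
  "independent_pair u v \<longleftrightarrow> (\<forall>s t. s *s u + t *s v = 0 \<longrightarrow> s = 0 \<and> t = 0)"

definition edge_form ::
  "complex^3 \<Rightarrow> complex^3 \<Rightarrow> complex^3 \<Rightarrow> complex^3 \<Rightarrow> complex^2 \<Rightarrow> complex^2 \<Rightarrow> complex" where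
  "edge_form U V U' V' x y = quad U x * quad V' y - quad V x * quad U' y"

text \<open>For fixed \<open>x\<close> the edge equation is itself a member of the second pencil.\<close>

lemma edge_form_as_quad: "edge_form U V U' V' x y = quad (quad U x *s V' + (- quad V x) *s U') y"
  unfolding edge_form_def quad_linear by simp

lemma biform_edge_form: "biform 2 2 (edge_form U V U' V')"
proof -
  have "biform (2 + 0) (0 + 2) (\<lambda>x y. quad U x * quad V' y)" for U V'
    by (intro biform_mult biform_quad_left biform_quad_right)
  from biform_diff[OF this this, of U V' V U'] show ?thesis
    unfolding edge_form_def[abs_def] by (simp add: numeral_2_eq_2)
qed

lemma edge_form_vanishes_on_line_iff:
  assumes "independent_pair U' V'"
  shows "(\<forall>y. edge_form U V U' V' x y = 0) \<longleftrightarrow> quad U x = 0 \<and> quad V x = 0"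
proof
  assume "\<forall>y. edge_form U V U' V' x y = 0"
  then have "(- quad V x) *s U' + quad U x *s V' = 0"
    unfolding edge_form_as_quad quad_zero_iff by (simp only: add.commute)
  then show "quad U x = 0 \<and> quad V x = 0" using assms unfolding independent_pair_def by fastforce
qed (simp add: edge_form_def)

lemma quad_zeros_of_nonzero_quad:
  assumes "quad W x = 0" "quad W w = 0" "quad W (x + w) = 0" "x \<noteq> 0" "w \<notin> pt x"
  shows "W = 0"
proof -
  have "polar W x w = 0" using quad_on_line[of W x 1 w] assms by simp
  have "quad W v = 0" for v
  proof -
    obtain s t where "v = s *s x + t *s w" using basis2_decompose[OF assms(4,5)] by metis
    then show ?thesis using quad_combination assms \<open>polar W x w = 0\<close> by simp
  qed
  then show ?thesis using quad_zero_iff by blast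
qed

text \<open>Two independent quadratic forms share at most one root: a combination of them that vanishes
  at a third point would have three roots.\<close>

lemma independent_pair_common_root:
  assumes ind: "independent_pair U V" and "quad U x = 0" "quad V x = 0" "quad U w = 0" "quad V w = 0"
    and "x \<noteq> 0" "w \<noteq> 0"
  shows "pt x = pt w"
proof (rule ccontr)
  assume "pt x \<noteq> pt w"
  then have w: "w \<notin> pt x" using pt_eq_iff assms mem_pt by metis
  define s t where "s = quad V (x + w)" and "t = - quad U (x + w)"
  show False
  proof (cases "s = 0 \<and> t = 0")
    case True
    then have "U = 0" using assms w quad_zeros_of_nonzero_quad[of U x w] by (simp add: s_def t_def)
    then have "1 *s U + 0 *s V = 0" by simp
    then show False using ind unfolding independent_pair_def by (metis zero_neq_one)
  next
    case False
    have "quad (s *s U + t *s V) (x + w) = 0" unfolding quad_linear by (simp add: s_def t_def)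
    then have "s *s U + t *s V = 0" using assms w
      by (intro quad_zeros_of_nonzero_quad[of _ x w]) (simp_all add: quad_linear)
    then show False using ind False unfolding independent_pair_def by blast
  qed
qed

lemma edge_form_nonzero:
  assumes "independent_pair U V" "independent_pair U' V'"
  shows "\<exists>x y. edge_form U V U' V' x y \<noteq> 0"
proof -
  have "U \<noteq> 0"
  proof
    assume "U = 0"
    then have "1 *s U + 0 *s V = 0" by simp
    then show False using assms(1) unfolding independent_pair_def by (metis zero_neq_one)
  qed
  then obtain x where "quad U x \<noteq> 0" using quad_zero_iff by blast
  then show ?thesis using edge_form_vanishes_on_line_iff[OF assms(2)] by blast
qed


section \<open>Zeros of quadratic equations are not isolated\<close>

lemma tendsto_biform:
  assumes "biform a b F" "(f \<longlongrightarrow> x) \<F>" "(g \<longlongrightarrow> y) \<F>"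
  shows "((\<lambda>t. F (f t) (g t)) \<longlongrightarrow> F x y) \<F>"
proof -
  obtain c where c: "\<And>x y. F x y = (\<Sum>i\<le>a. \<Sum>j\<le>b.
        c i j * (x $ 1) ^ i * (x $ 2) ^ (a - i) * (y $ 1) ^ j * (y $ 2) ^ (b - j))"
    using assms unfolding biform_def by blast
  show ?thesis unfolding c by (intro tendsto_intros assms)
qed

text \<open>Ordered by size, so that the sum and the product of the roots bound the smaller one.\<close>

lemma quadratic_roots:
  assumes "A \<noteq> (0::complex)"
  obtains r r' where "A * r\<^sup>2 + B * r + C = 0" "A * r'\<^sup>2 + B * r' + C = 0"
    "r + r' = - B / A" "r * r' = C / A" "norm r \<le> norm r'"
proof -
  define s where "s = csqrt (B\<^sup>2 - 4 * A * C)"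
  have s: "s * s = B * B - 4 * A * C" unfolding s_def by (simp flip: power2_eq_square)
  define p q where "p = (- B + s) / (2 * A)" and "q = (- B - s) / (2 * A)"
  have sum: "p + q = - B / A" unfolding p_def q_def using assms by (simp add: field_simps)
  have "p * q = (B * B - s * s) / (4 * A * A)" unfolding p_def q_def using assms by (simp add: field_simps)
  also have "\<dots> = C / A" unfolding s using assms by (simp add: field_simps)
  finally have prod: "p * q = C / A" .
  have "B = - A * (p + q)" "C = A * (p * q)" using sum prod assms by (auto simp: field_simps)
  then have roots: "A * p\<^sup>2 + B * p + C = 0" "A * q\<^sup>2 + B * q + C = 0"
    by (simp_all only: power2_eq_square) (simp_all add: ring_distribs)
  show thesis
  proof (cases "norm p \<le> norm q")
    case True then show thesis using that[of p q] roots sum prod by simp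
  next
    case False then show thesis using that[of q p] roots sum prod by (simp add: mult.commute add.commute)
  qed
qed

text \<open>The square of the smaller root is at most the product of the roots; if the linear coefficient is
  nonzero, then the larger root is at least half the sum of the roots, which bounds the smaller one
  through their product, uniformly as the leading coefficient tends to zero.\<close>

lemma small_root_leading:
  assumes "A \<noteq> (0::complex)"
  shows "\<exists>r. A * r\<^sup>2 + B * r + C = 0 \<and> norm r \<le> sqrt (norm C / norm A)"
proof -
  obtain r r' where r: "A * r\<^sup>2 + B * r + C = 0" "r * r' = C / A" "norm r \<le> norm r'"
    using quadratic_roots[OF assms] by metis
  have "(norm r)\<^sup>2 \<le> norm r * norm r'" using r(3) by (simp add: power2_eq_square mult_left_mono)
  also have "\<dots> = norm C / norm A" using r(2) by (metis norm_divide norm_mult)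
  finally show ?thesis using r(1) real_le_rsqrt by blast
qed

lemma small_root_linear:
  assumes "B \<noteq> (0::complex)"
  shows "\<exists>r. A * r\<^sup>2 + B * r + C = 0 \<and> norm r \<le> 2 * norm C / norm B"
proof (cases "A = 0")
  case True
  then show ?thesis using assms
    by (intro exI[of _ "- C / B"]) (auto simp: norm_divide divide_right_mono)
next
  case False
  obtain r r' where r: "A * r\<^sup>2 + B * r + C = 0" "r + r' = - B / A" "r * r' = C / A" "norm r \<le> norm r'"
    using quadratic_roots[OF False] by metis
  have "norm (- B / A) \<le> norm r + norm r'" unfolding r(2)[symmetric] by (rule norm_triangle_ineq)
  then have b: "norm B / norm A \<le> 2 * norm r'" using r(4) by (simp add: norm_divide)
  then have b': "norm B \<le> 2 * norm r' * norm A" using False by (simp add: pos_divide_le_eq)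
  have "norm r * norm r' = norm C / norm A" using r(3) by (metis norm_divide norm_mult)
  then have c: "norm C = norm r * norm r' * norm A" using False by (simp add: field_simps)
  have "norm r * norm B \<le> norm r * (2 * norm r' * norm A)" using b' by (rule mult_left_mono) simp
  also have "\<dots> = 2 * norm C" unfolding c by simp
  finally have "norm r \<le> 2 * norm C / norm B" using assms by (simp add: pos_le_divide_eq)
  then show ?thesis using r(1) by blast
qed

lemma eventually_not_in_finite: "finite K \<Longrightarrow> eventually (\<lambda>\<alpha>. \<alpha> \<notin> K) (at (a::complex))"
proof -
  assume "finite K"
  then have "open (- (K - {a}))" by (intro open_Compl finite_imp_closed finite_Diff)
  moreover have "a \<in> - (K - {a})" by simp
  ultimately have "eventually (\<lambda>\<alpha>. \<alpha> \<in> - (K - {a}) - {a}) (at a)"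
    by (rule eventually_at_in_open)
  then show ?thesis by eventually_elim simp
qed

lemma finite_parameters:
  assumes "finite K" "x \<noteq> 0" "w \<notin> pt x"
  shows "finite {\<alpha>. pt (x + \<alpha> *s w) \<in> K}"
proof -
  have "inj_on (\<lambda>\<alpha>. pt (x + \<alpha> *s w)) UNIV" using pt_add_scaled_inj[OF assms(2,3)] by (rule injI)
  from finite_vimageI[OF assms(1) this] show ?thesis by (simp add: vimage_def)
qed

text \<open>Near a zero \<open>(x\<^sub>0, y\<^sub>0)\<close> the equation is a quadratic equation for \<open>y\<close> along an affine line through
  \<open>y\<^sub>0\<close>, with coefficients that depend continuously on \<open>x\<close>.  Either it vanishes identically for
  \<open>x = x\<^sub>0\<close>, and \<open>y\<close> can be moved alone, or for \<open>x\<close> close to \<open>x\<^sub>0\<close> it has a root close to \<open>y\<^sub>0\<close>.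
  In both cases the exceptional points are eventually avoided and \<open>G\<close> vanishes by continuity.\<close>

lemma zeros_not_isolated:
  assumes c: "continuous_on UNIV c"
    and xy: "x0 \<noteq> 0" "y0 \<noteq> 0" "quad (c x0) y0 = 0"
    and K: "finite K1" "finite K2" and G: "biform a b G"
    and van: "\<And>x y. x \<noteq> 0 \<Longrightarrow> y \<noteq> 0 \<Longrightarrow> quad (c x) y = 0 \<Longrightarrow> pt x \<notin> K1 \<or> pt y \<notin> K2 \<Longrightarrow> G x y = 0"
  shows "G x0 y0 = 0"
proof -
  obtain w z where w: "w \<notin> pt x0" and z: "z \<notin> pt y0"
    using exists_other_point xy by metis
  have lim_line: "((\<lambda>\<alpha>. x + \<alpha> *s v) \<longlongrightarrow> x) (at 0)" for x v :: "complex^2"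
  proof -
    have "((\<lambda>\<alpha>. x + \<alpha> *s v) \<longlongrightarrow> x + 0 *s v) (at 0)"
      unfolding vector_scalar_mult_def by (intro tendsto_intros)
    then show ?thesis by simp
  qed
  show ?thesis
  proof (cases "quad (c x0) z = 0 \<and> polar (c x0) y0 z = 0")
    case True
    have "eventually (\<lambda>\<alpha>. G x0 (y0 + \<alpha> *s z) = 0) (at 0)"
      using eventually_not_in_finite[OF finite_parameters[OF K(2) xy(2) z], of 0]
    proof eventually_elim
      case (elim \<alpha>)
      then show ?case using True xy z
        by (intro van) (auto simp: quad_on_line add_scaled_not_zero)
    qed
    moreover have "((\<lambda>\<alpha>. G x0 (y0 + \<alpha> *s z)) \<longlongrightarrow> G x0 y0) (at 0)"
      by (intro tendsto_biform[OF G] tendsto_const lim_line)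
    ultimately show ?thesis using tendsto_unique[OF at_neq_bot _ tendsto_eventually] by blast
  next
    case False
    define A where "A = (\<lambda>\<alpha>. quad (c (x0 + \<alpha> *s w)) z)"
    define B where "B = (\<lambda>\<alpha>. polar (c (x0 + \<alpha> *s w)) y0 z)"
    define C where "C = (\<lambda>\<alpha>. quad (c (x0 + \<alpha> *s w)) y0)"
    have lim_c: "((\<lambda>\<alpha>. c (x0 + \<alpha> *s w)) \<longlongrightarrow> c x0) (at 0)"
      using c lim_line by (rule continuous_on_tendsto_compose) auto
    have lim_A: "(A \<longlongrightarrow> quad (c x0) z) (at 0)"
      unfolding A_def quad_def by (intro tendsto_intros lim_c)
    have lim_B: "(B \<longlongrightarrow> polar (c x0) y0 z) (at 0)"
      unfolding B_def polar_def by (intro tendsto_intros lim_c)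
    have "(C \<longlongrightarrow> quad (c x0) y0) (at 0)"
      unfolding C_def quad_def by (intro tendsto_intros lim_c)
    then have lim_C: "(C \<longlongrightarrow> 0) (at 0)" using xy by simp
    \<comment> \<open>roots of \<open>A r\<^sup>2 + B r + C\<close> that are bounded by a function tending to zero\<close>
    have "\<exists>g. (g \<longlongrightarrow> 0) (at 0) \<and>
        eventually (\<lambda>\<alpha>. \<exists>r. A \<alpha> * r\<^sup>2 + B \<alpha> * r + C \<alpha> = 0 \<and> norm r \<le> g \<alpha>) (at 0)"
    proof (cases "quad (c x0) z = 0")
      case True
      with False have B0: "polar (c x0) y0 z \<noteq> 0" by simp
      have "((\<lambda>\<alpha>. 2 * norm (C \<alpha>) / norm (B \<alpha>)) \<longlongrightarrow> 2 * norm (0::complex) / norm (polar (c x0) y0 z)) (at 0)"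
        by (intro tendsto_intros lim_C lim_B) (use B0 in simp)
      moreover have "eventually (\<lambda>\<alpha>. B \<alpha> \<noteq> 0) (at 0)"
        using lim_B B0 by (rule tendsto_imp_eventually_ne)
      then have "eventually (\<lambda>\<alpha>. \<exists>r. A \<alpha> * r\<^sup>2 + B \<alpha> * r + C \<alpha> = 0 \<and>
          norm r \<le> 2 * norm (C \<alpha>) / norm (B \<alpha>)) (at 0)"
        by eventually_elim (rule small_root_linear)
      ultimately show ?thesis by (intro exI[of _ "\<lambda>\<alpha>. 2 * norm (C \<alpha>) / norm (B \<alpha>)"]) simp
    next
      case A0: False
      have "((\<lambda>\<alpha>. sqrt (norm (C \<alpha>) / norm (A \<alpha>))) \<longlongrightarrow> sqrt (norm (0::complex) / norm (quad (c x0) z))) (at 0)"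
        by (intro tendsto_intros lim_C lim_A) (use A0 in simp)
      moreover have "eventually (\<lambda>\<alpha>. A \<alpha> \<noteq> 0) (at 0)"
        using lim_A A0 by (rule tendsto_imp_eventually_ne)
      then have "eventually (\<lambda>\<alpha>. \<exists>r. A \<alpha> * r\<^sup>2 + B \<alpha> * r + C \<alpha> = 0 \<and>
          norm r \<le> sqrt (norm (C \<alpha>) / norm (A \<alpha>))) (at 0)"
        by eventually_elim (rule small_root_leading)
      ultimately show ?thesis by (intro exI[of _ "\<lambda>\<alpha>. sqrt (norm (C \<alpha>) / norm (A \<alpha>))"]) simp
    qed
    then obtain g where g: "(g \<longlongrightarrow> 0) (at 0)"
      "eventually (\<lambda>\<alpha>. \<exists>r. A \<alpha> * r\<^sup>2 + B \<alpha> * r + C \<alpha> = 0 \<and> norm r \<le> g \<alpha>) (at 0)"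
      by blast
    define r where "r \<alpha> = (SOME r. A \<alpha> * r\<^sup>2 + B \<alpha> * r + C \<alpha> = 0 \<and> norm r \<le> g \<alpha>)" for \<alpha>
    have r: "eventually (\<lambda>\<alpha>. A \<alpha> * (r \<alpha>)\<^sup>2 + B \<alpha> * r \<alpha> + C \<alpha> = 0 \<and> norm (r \<alpha>) \<le> g \<alpha>) (at 0)"
      using g(2) unfolding r_def by eventually_elim (rule someI_ex)
    then have "eventually (\<lambda>\<alpha>. norm (r \<alpha>) \<le> g \<alpha>) (at 0)" by eventually_elim simp
    then have lim_r: "(r \<longlongrightarrow> 0) (at 0)" using g(1) by (rule Lim_null_comparison)
    have lim_y: "((\<lambda>\<alpha>. y0 + r \<alpha> *s z) \<longlongrightarrow> y0) (at 0)"
    proof -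
      have "((\<lambda>\<alpha>. y0 + r \<alpha> *s z) \<longlongrightarrow> y0 + 0 *s z) (at 0)"
        unfolding vector_scalar_mult_def by (intro tendsto_intros lim_r)
      then show ?thesis by simp
    qed
    have "eventually (\<lambda>\<alpha>. G (x0 + \<alpha> *s w) (y0 + r \<alpha> *s z) = 0) (at 0)"
      using r eventually_not_in_finite[OF finite_parameters[OF K(1) xy(1) w], of 0]
    proof eventually_elim
      case (elim \<alpha>)
      have "quad (c (x0 + \<alpha> *s w)) (y0 + r \<alpha> *s z) = 0"
        using elim(1) unfolding quad_on_line A_def B_def C_def by (simp add: add_ac)
      then show ?case using elim(2) xy w z by (intro van) (auto simp: add_scaled_not_zero)
    qed
    moreover have "((\<lambda>\<alpha>. G (x0 + \<alpha> *s w) (y0 + r \<alpha> *s z)) \<longlongrightarrow> G x0 y0) (at 0)"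
      by (intro tendsto_biform[OF G] lim_line lim_y)
    ultimately show ?thesis using tendsto_unique[OF at_neq_bot _ tendsto_eventually] by blast
  qed
qed

lemma continuous_edge_coefficients:
  "continuous_on UNIV (\<lambda>x. quad U x *s V' + (- quad V x) *s U')"
  unfolding quad_def vector_scalar_mult_def by (intro continuous_intros)


section \<open>The equation of the edge curve\<close>

lemma bil_add_right: "bil A v (w + w') = bil A v w + bil A v w'"
  by (simp add: bil_def sum.distrib algebra_simps)

lemma bil_scale_right: "bil A v (k *s w) = k * bil A v w"
  by (simp add: bil_def sum_distrib_left mult_ac)

lemma bil_add_left: "bil A (v + v') w = bil A v w + bil A v' w"
  by (simp add: bil_def sum.distrib algebra_simps)

lemma bil_scale_left: "bil A (k *s v) w = k * bil A v w"
  by (simp add: bil_def sum_distrib_left mult_ac)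

lemma bil_commute:
  assumes "transpose A = A"
  shows "bil A v w = bil A w v"
proof -
  have "A $ i $ j = A $ j $ i" for i j
    using assms by (simp add: transpose_def vec_eq_iff)
  then have "bil A v w = (\<Sum>i\<in>UNIV. \<Sum>j\<in>UNIV. A $ j $ i * w $ j * v $ i)"
    unfolding bil_def by (simp add: mult_ac)
  also have "\<dots> = bil A w v" unfolding bil_def by (rule sum.swap)
  finally show ?thesis .
qed

lemma conic_parametrization_point:
  assumes "conic_parametrization C \<phi>" "vec.subspace (plane C)" "x \<noteq> 0"
  shows "\<phi> x \<in> plane C" "\<phi> x \<noteq> 0" "pt (\<phi> x) \<in> conic_points C"
proof -
  show p: "pt (\<phi> x) \<in> conic_points C" using assms unfolding conic_parametrization_def by blast
  then obtain v where v: "pt (\<phi> x) = pt v" "v \<in> plane C" "v \<noteq> 0"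
    unfolding conic_points_def by blast
  have self: "u \<in> pt u" for u :: "complex^4" unfolding mem_pt by (rule exI[of _ 1]) simp
  from self[of "\<phi> x"] obtain k where "\<phi> x = k *s v" unfolding v(1) mem_pt by blast
  then show "\<phi> x \<in> plane C" using assms(2) v(2) vec.subspace_scale by metis
  from self[of v] obtain l where "v = l *s \<phi> x" unfolding v(1)[symmetric] mem_pt by blast
  then show "\<phi> x \<noteq> 0" using v(3) by auto
qed

lemma conic_parametrization_coefficients:
  assumes "conic_parametrization C \<phi>" "smooth_conic C"
  obtains a b c where "plane C = vec.span {a, b, c}"
    "\<phi> = (\<lambda>x. (x $ 1)\<^sup>2 *s a + (x $ 1 * x $ 2) *s b + (x $ 2)\<^sup>2 *s c)"
proof -
  have P: "vec.subspace (plane C)" "vec.dim (plane C) = 3" using assms(2) unfolding smooth_conic_def by auto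
  obtain a b c where abc: "vec.independent {a, b, c}" "distinct [a, b, c]"
    "\<phi> = (\<lambda>x. (x $ 1)\<^sup>2 *s a + (x $ 1 * x $ 2) *s b + (x $ 2)\<^sup>2 *s c)"
    using assms(1) unfolding conic_parametrization_def by blast
  have in_P: "\<phi> x \<in> plane C" if "x \<noteq> 0" for x
    using conic_parametrization_point[OF assms(1) P(1) that] by blast
  have a: "a \<in> plane C" using in_P[of "vector [1, 0]"] by (simp add: abc(3) vec2_eq_iff)
  have c: "c \<in> plane C" using in_P[of "vector [0, 1]"] by (simp add: abc(3) vec2_eq_iff)
  have "a + b + c \<in> plane C" using in_P[of "vector [1, 1]"] by (simp add: abc(3) vec2_eq_iff)
  then have "(a + b + c) - a - c \<in> plane C" using a c P(1) vec.subspace_diff by blast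
  then have b: "b \<in> plane C" by simp
  have sub: "{a, b, c} \<subseteq> plane C" using a b c by simp
  have "card {a, b, c} = 3" using abc(2) by simp
  then have "plane C \<subseteq> vec.span {a, b, c}"
    using vec.card_ge_dim_independent[OF sub abc(1)] P(2) by simp
  moreover have "vec.span {a, b, c} \<subseteq> plane C" using sub P(1) by (rule vec.span_minimal)
  ultimately show thesis using that[of a b c] abc(3) by blast
qed

text \<open>The tangent at \<open>\<phi> x\<close> consists of the points \<open>w\<close> with \<open>bil (gram C) (\<phi> x) w = 0\<close>, and this is a
  quadratic form \<open>\<psi> w\<close> in \<open>x\<close>.  A point \<open>w\<close> of the plane with \<open>\<psi> w = 0\<close> would lie on all tangents,
  hence in the radical of the Gram matrix, which smoothness excludes.\<close>

lemma tangent_form: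
  assumes "conic_parametrization C \<phi>" "smooth_conic C"
  obtains \<psi> where "\<And>s t u v. \<psi> (s *s u + t *s v) = s *s \<psi> u + t *s \<psi> v"
    "\<And>w. w \<in> plane C \<Longrightarrow> \<psi> w = 0 \<Longrightarrow> w = 0"
    "\<And>x w. bil (gram C) (\<phi> x) w = quad (\<psi> w) x"
proof -
  let ?A = "gram C"
  obtain a b c where abc: "plane C = vec.span {a, b, c}"
    "\<phi> = (\<lambda>x. (x $ 1)\<^sup>2 *s a + (x $ 1 * x $ 2) *s b + (x $ 2)\<^sup>2 *s c)"
    by (rule conic_parametrization_coefficients[OF assms])
  define \<psi> :: "complex^4 \<Rightarrow> complex^3" where "\<psi> w = vector [bil ?A a w, bil ?A b w, bil ?A c w]" for w
  have 1: "\<psi> (s *s u + t *s v) = s *s \<psi> u + t *s \<psi> v" for s t u v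
    by (simp add: \<psi>_def vec3_eq_iff bil_add_right bil_scale_right)
  have 3: "bil ?A (\<phi> x) w = quad (\<psi> w) x" for x w
    by (simp add: \<psi>_def abc(2) quad_def bil_add_left bil_scale_left mult_ac)
  have 2: "w = 0" if w: "w \<in> plane C" "\<psi> w = 0" for w
  proof (rule ccontr)
    assume "w \<noteq> 0"
    have "{a, b, c} \<subseteq> {v. bil ?A v w = 0}" using w(2) by (simp add: \<psi>_def vec3_eq_iff)
    moreover have "vec.subspace {v. bil ?A v w = 0}"
      unfolding vec.subspace_def by (auto simp: bil_add_left bil_scale_left) (simp add: bil_def)
    ultimately have "plane C \<subseteq> {v. bil ?A v w = 0}" unfolding abc(1) by (rule vec.span_minimal)
    then have *: "bil ?A v w = 0" if "v \<in> plane C" for v using that by blast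
    obtain v where "v \<in> plane C" "bil ?A w v \<noteq> 0"
      using assms(2) w(1) *[OF w(1)] \<open>w \<noteq> 0\<close> unfolding smooth_conic_def by blast
    moreover have "bil ?A w v = bil ?A v w"
      using assms(2) bil_commute unfolding smooth_conic_def by blast
    ultimately show False using * by simp
  qed
  show thesis using that 1 2 3 by blast
qed

text \<open>Three points of a conic span its plane, so all but finitely many points of the conic lie outside
  a subspace that does not contain the plane.\<close>

lemma finite_conic_points_in_subspace:
  assumes "conic_parametrization C \<phi>" "smooth_conic C" "vec.subspace W" "\<not> plane C \<subseteq> W"
  shows "finite {pt x | x. x \<noteq> 0 \<and> \<phi> x \<in> W}"
proof -
  obtain a b c where abc: "plane C = vec.span {a, b, c}"
    "\<phi> = (\<lambda>x. (x $ 1)\<^sup>2 *s a + (x $ 1 * x $ 2) *s b + (x $ 2)\<^sup>2 *s c)"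
    by (rule conic_parametrization_coefficients[OF assms(1,2)])
  define f where "f t = t\<^sup>2 *s a + t *s b + c" for t :: complex
  have fin: "finite {t. f t \<in> W}"
  proof (rule ccontr)
    assume "infinite {t. f t \<in> W}"
    then obtain T where T: "T \<subseteq> {t. f t \<in> W}" "card T = 3" "finite T"
      using infinite_arbitrarily_large by blast
    then obtain p q r where pqr: "T = {p, q, r}" "p \<noteq> q" "q \<noteq> r" "p \<noteq> r"
      by (metis card_3_iff)
    then have fW: "f p \<in> W" "f q \<in> W" "f r \<in> W" using T by auto
    \<comment> \<open>divided differences of the quadratic polynomial \<open>f\<close> recover its coefficients\<close>
    have slope: "(s + t) *s a + b \<in> W" if "f s \<in> W" "f t \<in> W" "s \<noteq> t" for s t
    proof -
      have "(1 / (s - t)) *s (f s - f t) \<in> W"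
        using that assms(3) by (intro vec.subspace_scale vec.subspace_diff)
      moreover have "(s - t) *s ((s + t) *s a + b) = f s - f t"
        by (simp add: f_def vec_eq_iff power2_eq_square algebra_simps)
      then have "(s + t) *s a + b = (1 / (s - t)) *s (f s - f t)"
        using smult_eq_solve that(3) by (metis right_minus_eq)
      ultimately show ?thesis by metis
    qed
    have "((p + q) *s a + b) - ((p + r) *s a + b) \<in> W"
      using fW pqr assms(3) by (intro vec.subspace_diff slope) auto
    moreover have "((p + q) *s a + b) - ((p + r) *s a + b) = (q - r) *s a"
      by (simp add: vec_eq_iff algebra_simps)
    ultimately have "(1 / (q - r)) *s ((q - r) *s a) \<in> W"
      using assms(3) vec.subspace_scale by metis
    then have a: "a \<in> W" using pqr smult_eq_solve[of "q - r" a] by (metis right_minus_eq)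
    have "((p + q) *s a + b) - (p + q) *s a \<in> W"
      using fW pqr assms(3) a by (intro vec.subspace_diff vec.subspace_scale slope) auto
    then have b: "b \<in> W" by simp
    have "f p - p\<^sup>2 *s a - p *s b \<in> W"
      using fW a b assms(3) by (intro vec.subspace_diff vec.subspace_scale)
    then have c: "c \<in> W" by (simp add: f_def)
    have "plane C \<subseteq> W" unfolding abc(1) using a b c assms(3) by (intro vec.span_minimal) auto
    then show False using assms(4) by simp
  qed
  have "{pt x | x. x \<noteq> 0 \<and> \<phi> x \<in> W} \<subseteq> {pt (vector [1, 0])} \<union> (\<lambda>t. pt (vector [t, 1])) ` {t. f t \<in> W}"
  proof (rule subsetI, rule ccontr)
    fix P
    assume P: "P \<in> {pt x | x. x \<noteq> 0 \<and> \<phi> x \<in> W}"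
      "P \<notin> {pt (vector [1, 0])} \<union> (\<lambda>t. pt (vector [t, 1])) ` {t. f t \<in> W}"
    then obtain x where x: "x \<noteq> 0" "\<phi> x \<in> W" "pt x \<notin> (\<lambda>t. pt (vector [t, 1])) ` {t. f t \<in> W}"
      "pt x \<noteq> pt (vector [1, 0])" by blast
    have x2: "x $ 2 \<noteq> 0" using x(1,4) pt2_eq_iff[of x "vector [1, 0]"] by (auto simp: vec2_eq_iff)
    define t where "t = x $ 1 / x $ 2"
    have "(x $ 2)\<^sup>2 *s f t = \<phi> x"
      using x2 by (simp add: f_def abc(2) t_def vec_eq_iff power2_eq_square field_simps)
    then have "f t = (1 / (x $ 2)\<^sup>2) *s \<phi> x" using x2 by (intro smult_eq_solve) auto
    then have "f t \<in> W" using x(2) assms(3) vec.subspace_scale by metis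
    moreover have "pt x = pt (vector [t, 1])"
      using x2 x(1) by (subst pt2_eq_iff) (auto simp: t_def vec2_eq_iff)
    ultimately show False using x(3) by blast
  qed
  then show ?thesis using fin by (meson finite_Un finite.emptyI finite.insertI finite_imageI finite_subset)
qed

lemma smooth_conic_planes_not_subset:
  assumes "smooth_conic C1" "smooth_conic C2" "plane C1 \<noteq> plane C2"
  shows "\<not> plane C1 \<subseteq> plane C2"
  using assms vec.subspace_dim_equal[of "plane C1" "plane C2"] unfolding smooth_conic_def by auto

lemma two_linear_equations:
  "(\<exists>s t. (s, t) \<noteq> (0, 0) \<and> s * a + t * b = 0 \<and> s * c + t * d = 0) \<longleftrightarrow> a * d - b * c = (0::complex)"
proof
  assume "\<exists>s t. (s, t) \<noteq> (0, 0) \<and> s * a + t * b = 0 \<and> s * c + t * d = 0"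
  then obtain s t where st: "(s, t) \<noteq> (0, 0)" "s * a + t * b = 0" "s * c + t * d = 0" by blast
  have "s * (a * d - b * c) = d * (s * a + t * b) - b * (s * c + t * d)"
    "t * (a * d - b * c) = a * (s * c + t * d) - c * (s * a + t * b)" by (simp_all add: algebra_simps)
  then show "a * d - b * c = 0" using st by auto
next
  assume det: "a * d - b * c = 0"
  show "\<exists>s t. (s, t) \<noteq> (0, 0) \<and> s * a + t * b = 0 \<and> s * c + t * d = 0"
  proof (cases "a = 0 \<and> b = 0")
    case True
    show ?thesis
    proof (cases "c = 0 \<and> d = 0")
      case True then show ?thesis using \<open>a = 0 \<and> b = 0\<close> by (intro exI[of _ 1]) auto
    next
      case False then show ?thesis using True by (intro exI[of _ d] exI[of _ "- c"]) auto
    qed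
  next
    case False
    then show ?thesis using det by (intro exI[of _ b] exI[of _ "- a"]) (auto simp: algebra_simps)
  qed
qed

text \<open>A common point \<open>s u + t v\<close> of the two tangents is a nontrivial solution of two linear equations in
  \<open>s\<close> and \<open>t\<close>, and their determinant is the edge form.  A pair with \<open>p = q\<close> has \<open>p\<close> in the plane of
  \<open>C2\<close> and \<open>q\<close> in that of \<open>C1\<close>, which leaves finitely many parameters \<open>x\<close> and \<open>y\<close>.\<close>

lemma edge_curve_eq_zeros:
  assumes C: "smooth_conic C1" "smooth_conic C2" "plane C1 \<noteq> plane C2"
    and \<phi>: "conic_parametrization C1 \<phi>1" "conic_parametrization C2 \<phi>2"
    and L: "plane C1 \<inter> plane C2 = {s *s u + t *s v | s t. True}" and uv: "independent_pair u v"
    and U: "\<And>x. bil (gram C1) (\<phi>1 x) u = quad U x" "\<And>x. bil (gram C1) (\<phi>1 x) v = quad V x"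
    and U': "\<And>y. bil (gram C2) (\<phi>2 y) u = quad U' y" "\<And>y. bil (gram C2) (\<phi>2 y) v = quad V' y"
  shows "edge_curve C1 C2 \<phi>1 \<phi>2 = zeros (edge_form U V U' V')"
proof -
  let ?E = "edge_form U V U' V'"
  have sub: "vec.subspace (plane C1)" "vec.subspace (plane C2)" using C unfolding smooth_conic_def by auto
  have tangent: "w \<in> tangent_line C (pt p) \<longleftrightarrow> w \<in> plane C \<and> bil (gram C) p w = 0" for C p w
  proof -
    have "bil (gram C) p w = 0" if "\<forall>v\<in>pt p. bil (gram C) v w = 0"
    proof -
      have "p \<in> pt p" unfolding mem_pt by (rule exI[of _ 1]) simp
      then show ?thesis using that by blast
    qed
    then show ?thesis unfolding tangent_line_def by (auto simp: mem_pt bil_scale_left)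
  qed
  have meet: "(\<exists>w. w \<noteq> 0 \<and> w \<in> tangent_line C1 (pt (\<phi>1 x)) \<inter> tangent_line C2 (pt (\<phi>2 y)))
      \<longleftrightarrow> ?E x y = 0" for x y
  proof -
    have nz: "s *s u + t *s v \<noteq> 0 \<longleftrightarrow> (s, t) \<noteq> (0, 0)" for s t
      using uv unfolding independent_pair_def by auto
    have "(\<exists>w. w \<noteq> 0 \<and> w \<in> tangent_line C1 (pt (\<phi>1 x)) \<inter> tangent_line C2 (pt (\<phi>2 y))) \<longleftrightarrow>
      (\<exists>w \<in> plane C1 \<inter> plane C2. w \<noteq> 0 \<and> bil (gram C1) (\<phi>1 x) w = 0 \<and> bil (gram C2) (\<phi>2 y) w = 0)"
      using tangent by auto
    also have "\<dots> \<longleftrightarrow> (\<exists>s t. s *s u + t *s v \<noteq> 0 \<and> bil (gram C1) (\<phi>1 x) (s *s u + t *s v) = 0 \<and>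
        bil (gram C2) (\<phi>2 y) (s *s u + t *s v) = 0)"
      unfolding L by auto
    also have "\<dots> \<longleftrightarrow> (\<exists>s t. (s, t) \<noteq> (0, 0) \<and> s * quad U x + t * quad V x = 0 \<and> s * quad U' y + t * quad V' y = 0)"
      unfolding nz bil_add_right bil_scale_right U U' ..
    also have "\<dots> \<longleftrightarrow> ?E x y = 0" unfolding two_linear_equations edge_form_def ..
    finally show ?thesis .
  qed
  define S where "S = {(pt x, pt y) | x y. x \<noteq> 0 \<and> y \<noteq> 0 \<and> stationary_bisecant C1 C2 (pt (\<phi>1 x)) (pt (\<phi>2 y))}"
  have stat: "stationary_bisecant C1 C2 (pt (\<phi>1 x)) (pt (\<phi>2 y)) \<longleftrightarrow> pt (\<phi>1 x) \<noteq> pt (\<phi>2 y) \<and> ?E x y = 0"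
    if "x \<noteq> 0" "y \<noteq> 0" for x y
    unfolding stationary_bisecant_def meet
    using conic_parametrization_point(3)[OF \<phi>(1) sub(1) that(1)]
      conic_parametrization_point(3)[OF \<phi>(2) sub(2) that(2)] by blast
  define K1 where "K1 = {pt x | x. x \<noteq> 0 \<and> \<phi>1 x \<in> plane C2}"
  define K2 where "K2 = {pt y | y. y \<noteq> 0 \<and> \<phi>2 y \<in> plane C1}"
  have fin: "finite K1" "finite K2" unfolding K1_def K2_def
    using finite_conic_points_in_subspace[OF \<phi>(1) C(1) sub(2) smooth_conic_planes_not_subset[OF C]]
      finite_conic_points_in_subspace[OF \<phi>(2) C(2) sub(1)
        smooth_conic_planes_not_subset[OF C(2,1) C(3)[symmetric]]]
    by blast+
  have in_S: "(pt x, pt y) \<in> S" if xy: "x \<noteq> 0" "y \<noteq> 0" "?E x y = 0" "pt x \<notin> K1 \<or> pt y \<notin> K2" for x y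
  proof -
    have p: "\<phi>1 x \<in> plane C1" "\<phi>1 x \<noteq> 0" "\<phi>2 y \<in> plane C2" "\<phi>2 y \<noteq> 0"
      using conic_parametrization_point \<phi> sub xy by blast+
    have "pt (\<phi>1 x) \<noteq> pt (\<phi>2 y)"
    proof
      assume eq: "pt (\<phi>1 x) = pt (\<phi>2 y)"
      then obtain k l where "\<phi>2 y = k *s \<phi>1 x" "\<phi>1 x = l *s \<phi>2 y" using p pt_eq_iff by metis
      then have "\<phi>2 y \<in> plane C1" "\<phi>1 x \<in> plane C2" using p sub vec.subspace_scale by metis+
      then show False using xy unfolding K1_def K2_def by blast
    qed
    then show ?thesis using stat xy unfolding S_def by blast
  qed
  have "zariski_closure S = zeros ?E"
  proof
    have "S \<subseteq> zeros ?E" using stat unfolding S_def zeros_def by blast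
    then show "zariski_closure S \<subseteq> zeros ?E"
      unfolding zariski_closure_def using biform_edge_form by (intro Inter_lower) blast
    show "zeros ?E \<subseteq> zariski_closure S"
      unfolding zariski_closure_def
    proof (rule Inter_greatest)
      fix Z assume "Z \<in> {zeros G |G. (\<exists>a b. biform a b G) \<and> S \<subseteq> zeros G}"
      then obtain G a b where Z: "Z = zeros G" and G: "biform a b G" and SG: "S \<subseteq> zeros G" by blast
      show "zeros ?E \<subseteq> Z" unfolding Z zeros_subset_iff[OF G]
      proof (intro allI impI)
        fix x y :: "complex^2" assume xy: "x \<noteq> 0" "y \<noteq> 0" "?E x y = 0"
        show "G x y = 0"
        proof (rule zeros_not_isolated[OF continuous_edge_coefficients xy(1,2) _ fin G])
          show "quad (quad U x *s V' + - quad V x *s U') y = 0"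
            using xy(3) unfolding edge_form_as_quad .
          fix x' y' assume h: "x' \<noteq> 0" "y' \<noteq> 0" "quad (quad U x' *s V' + - quad V x' *s U') y' = 0"
            "pt x' \<notin> K1 \<or> pt y' \<notin> K2"
          then have "(pt x', pt y') \<in> S" by (intro in_S) (simp_all add: edge_form_as_quad)
          then show "G x' y' = 0" using SG in_zeros_iff[OF G h(1,2)] by blast
        qed
      qed
    qed
  qed
  then show ?thesis unfolding edge_curve_def S_def .
qed

lemma independent_imp_independent_pair:
  assumes "vec.independent {u, v}" "u \<noteq> v"
  shows "independent_pair u v"
proof -
  have *: "s = 0" if "vec.independent {u, v}" "u \<noteq> v" "s *s u + t *s v = 0" for s t and u v :: "complex^'n"
  proof (rule ccontr)
    assume "s \<noteq> 0"
    have "s *s u = (- t) *s v" using that(3) by (simp add: add_eq_0_iff2)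
    from smult_eq_solve[OF \<open>s \<noteq> 0\<close> this] have "u = (- t / s) *s v" by (simp add: vector_smult_assoc)
    then have "u \<in> vec.span ({u, v} - {u})" using that(2)
      by (metis Diff_insert_absorb insertI1 insert_absorb mem_pt pt_def singleton_iff)
    then show False using that(1) unfolding vec.dependent_def by blast
  qed
  show ?thesis unfolding independent_pair_def
  proof (intro allI impI)
    fix s t assume h: "s *s u + t *s v = 0"
    then have "t *s v + s *s u = 0" by (simp add: add.commute)
    then show "s = 0 \<and> t = 0" using *[OF assms h] *[of v u t s] assms by (simp add: insert_commute)
  qed
qed

text \<open>Distinct subspaces of dimension three in \<open>\<complex>\<^sup>4\<close> meet in dimension two, and a basis of the intersection
  yields the two pencils.\<close>

lemma edge_curve_equation:
  assumes C: "smooth_conic C1" "smooth_conic C2" "plane C1 \<noteq> plane C2"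
    and \<phi>: "conic_parametrization C1 \<phi>1" "conic_parametrization C2 \<phi>2"
  obtains U V U' V' where "independent_pair U V" "independent_pair U' V'"
    "edge_curve C1 C2 \<phi>1 \<phi>2 = zeros (edge_form U V U' V')"
proof -
  let ?L = "plane C1 \<inter> plane C2"
  have sub: "vec.subspace (plane C1)" "vec.subspace (plane C2)"
    and dim: "vec.dim (plane C1) = 3" "vec.dim (plane C2) = 3" using C unfolding smooth_conic_def by auto
  have subL: "vec.subspace ?L" using sub by (rule vec.subspace_inter)
  have "vec.dim {x + y |x y. x \<in> plane C1 \<and> y \<in> plane C2} + vec.dim ?L = 6"
    using vec.dim_sums_Int[OF sub] dim by simp
  moreover have "vec.dim {x + y |x y. x \<in> plane C1 \<and> y \<in> plane C2} \<le> 4"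
    using vec.dim_subset_UNIV[of "{x + y |x y. x \<in> plane C1 \<and> y \<in> plane C2}"]
    by (simp add: vec.dimension_def card_cart_basis)
  moreover have "vec.dim ?L < 3"
  proof (rule ccontr)
    assume "\<not> vec.dim ?L < 3"
    then have "?L = plane C1" using vec.subspace_dim_equal[OF subL sub(1)] dim by simp
    then show False using smooth_conic_planes_not_subset[OF C] by blast
  qed
  ultimately have dimL: "vec.dim ?L = 2" by linarith
  obtain B where B: "B \<subseteq> ?L" "vec.independent B" "?L \<subseteq> vec.span B" "card B = vec.dim ?L"
    using vec.basis_exists by blast
  then obtain u v where uv: "B = {u, v}" "u \<noteq> v" using dimL by (metis card_2_iff)
  have ind: "independent_pair u v" using independent_imp_independent_pair B(2) uv by blast
  have spanB: "vec.span {u, v} = {s *s u + t *s v | s t. True}"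
  proof -
    have "x - k *s u = l *s v \<longleftrightarrow> x = k *s u + l *s v" for x k l by (auto simp: algebra_simps)
    then show ?thesis unfolding vec.span_insert vec.span_singleton by auto
  qed
  have L: "?L = {s *s u + t *s v | s t. True}"
    using B(1,3) vec.span_minimal[OF B(1) subL] unfolding uv spanB[symmetric] by blast
  obtain \<psi>1 where 1: "\<And>s t u v. \<psi>1 (s *s u + t *s v) = s *s \<psi>1 u + t *s \<psi>1 v"
    "\<And>w. w \<in> plane C1 \<Longrightarrow> \<psi>1 w = 0 \<Longrightarrow> w = 0"
    "\<And>x w. bil (gram C1) (\<phi>1 x) w = quad (\<psi>1 w) x" using tangent_form[OF \<phi>(1) C(1)] by blast
  obtain \<psi>2 where 2: "\<And>s t u v. \<psi>2 (s *s u + t *s v) = s *s \<psi>2 u + t *s \<psi>2 v"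
    "\<And>w. w \<in> plane C2 \<Longrightarrow> \<psi>2 w = 0 \<Longrightarrow> w = 0"
    "\<And>x w. bil (gram C2) (\<phi>2 x) w = quad (\<psi>2 w) x" using tangent_form[OF \<phi>(2) C(2)] by blast
  have mem: "s *s u + t *s v \<in> plane C1" "s *s u + t *s v \<in> plane C2" for s t
    using L by blast+
  have "independent_pair (\<psi>1 u) (\<psi>1 v)" "independent_pair (\<psi>2 u) (\<psi>2 v)"
    using 1(1,2) 2(1,2) mem ind unfolding independent_pair_def by metis+
  moreover have "edge_curve C1 C2 \<phi>1 \<phi>2 = zeros (edge_form (\<psi>1 u) (\<psi>1 v) (\<psi>2 u) (\<psi>2 v))"
    by (rule edge_curve_eq_zeros[OF C \<phi> L ind 1(3) 1(3) 2(3) 2(3)])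
  ultimately show thesis by (rule that)
qed

section \<open>Every form of rank two is an edge equation\<close>

lemma independent_tripleI:
  assumes "\<And>r s t. r *s a + s *s b + t *s c = 0 \<Longrightarrow> r = 0 \<and> s = 0 \<and> t = (0::complex)"
  shows "vec.independent {a, b, c}" "distinct [a, b, c]"
proof -
  have c: "c \<noteq> 0" using assms[of 0 0 1] by auto
  have b: "b \<notin> vec.span {c}"
  proof
    assume "b \<in> vec.span {c}"
    then obtain k where "b = k *s c" unfolding vec.span_singleton by blast
    then show False using assms[of 0 1 "- k"] by simp
  qed
  have a: "a \<notin> vec.span {b, c}"
  proof
    assume "a \<in> vec.span {b, c}"
    then obtain k l where "a - k *s b = l *s c" unfolding vec.span_breakdown_eq vec.span_singleton by blast
    then have "1 *s a + (- k) *s b + (- l) *s c = 0" by simp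
    then show False using assms by (metis zero_neq_one)
  qed
  show "vec.independent {a, b, c}"
    by (intro vec.independent_insertI a b) (simp_all add: c vec.independent_empty)
  have "vec.span {c} \<subseteq> vec.span {b, c}" by (rule vec.span_mono) simp
  then show "distinct [a, b, c]"
    using a b vec.span_base[of b "{b, c}"] vec.span_base[of c "{c}"] vec.span_base[of c "{b, c}"] by auto
qed

lemma independent_pair_complete:
  fixes U V :: "complex^3"
  assumes "independent_pair U V"
  obtains W where "\<And>r s t. r *s U + s *s V + t *s W = 0 \<Longrightarrow> r = 0 \<and> s = 0 \<and> t = 0"
proof -
  have "vec.dim {U, V} \<le> card {U, V}" by (rule vec.dim_le_card') simp
  also have "\<dots> \<le> 2" by (simp add: card_insert_if)
  finally have "vec.dim (vec.span {U, V}) < 3" by (simp add: vec.dim_span)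
  moreover have "vec.dim (UNIV :: (complex^3) set) = 3"
    by (simp add: vec.dim_UNIV vec.dimension_def card_cart_basis)
  ultimately have "vec.span {U, V} \<noteq> UNIV" by force
  then obtain W where W: "W \<notin> vec.span {U, V}" by blast
  have "r = 0 \<and> s = 0 \<and> t = 0" if h: "r *s U + s *s V + t *s W = 0" for r s t
  proof -
    have "t = 0"
    proof (rule ccontr)
      assume "t \<noteq> 0"
      have "t *s W = - (r *s U + s *s V)" using h unfolding add_eq_0_iff .
      then have "t *s W = (- r) *s U + (- s) *s V" by (simp add: vec_eq_iff)
      from smult_eq_solve[OF \<open>t \<noteq> 0\<close> this]
      have "W \<in> vec.span {U, V}"
        by (metis insertI1 insertI2 vec.span_add vec.span_base vec.span_scale)
      then show False using W by simp
    qed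
    then show ?thesis using h assms unfolding independent_pair_def by simp
  qed
  then show thesis by (rule that)
qed

text \<open>The polar form of \<open>2 p\<^sub>1 p\<^sub>3 - p\<^sub>2\<^sup>2 / 2\<close>, that is, of \<open>- 1/2\<close> times the discriminant.  The factor makes
  \<open>discriminant_square_form\<close> hold without constants.\<close>

definition discriminant_form :: "complex^3 \<Rightarrow> complex^3 \<Rightarrow> complex" where
  "discriminant_form p q = p $ 1 * q $ 3 + p $ 3 * q $ 1 - p $ 2 * q $ 2 / 2"

text \<open>The square of the linear form that vanishes at \<open>[x]\<close>.\<close>

definition square_form :: "complex^2 \<Rightarrow> complex^3" where
  "square_form x = vector [(x $ 2)\<^sup>2, - 2 * (x $ 1 * x $ 2), (x $ 1)\<^sup>2]"

lemma discriminant_square_form: "discriminant_form (square_form x) q = quad q x"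
  by (simp add: discriminant_form_def square_form_def quad_def mult_ac)

lemma square_form_not_zero: "x \<noteq> 0 \<Longrightarrow> square_form x \<noteq> 0"
  by (auto simp: square_form_def vec3_eq_iff vec2_eq_iff)

lemma discriminant_zero_imp_square:
  assumes "discriminant_form p p = 0"
  obtains x where "p = square_form x"
proof -
  have d: "4 * (p $ 1 * p $ 3) = (p $ 2)\<^sup>2"
    using assms by (simp add: discriminant_form_def power2_eq_square field_simps)
  show thesis
  proof (cases "p $ 3 = 0")
    case True
    then show thesis using d
      by (intro that[of "vector [0, csqrt (p $ 1)]"]) (simp add: square_form_def vec3_eq_iff)
  next
    case False
    define s where "s = csqrt (p $ 3)"
    have s: "s\<^sup>2 = p $ 3" unfolding s_def by simp
    with False have s0: "s \<noteq> 0" by auto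
    have "(p $ 2)\<^sup>2 = p $ 1 * (4 * s\<^sup>2)" using d s by (simp add: mult_ac)
    then have "(p $ 2 / (2 * s))\<^sup>2 = p $ 1" using s0 by (simp add: power_divide power_mult_distrib)
    then show thesis using s s0
      by (intro that[of "vector [s, - p $ 2 / (2 * s)]"]) (simp add: square_form_def vec3_eq_iff power_divide)
  qed
qed

lemma discriminant_nondegenerate:
  assumes "p \<noteq> 0"
  obtains q where "discriminant_form p q \<noteq> 0"
proof -
  have "discriminant_form p (vector [0, 0, 1]) \<noteq> 0 \<or> discriminant_form p (vector [0, 1, 0]) \<noteq> 0 \<or>
    discriminant_form p (vector [1, 0, 0]) \<noteq> 0"
    using assms by (auto simp: discriminant_form_def vec3_eq_iff)
  then show thesis using that by blast
qed

text \<open>The plane spanned by the basis vectors with indices \<open>1\<close>, \<open>2\<close> and \<open>k\<close> is identified with the space of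
  binary quadratic forms by \<open>\<kappa>\<close>, which sends these vectors to \<open>U\<close>, \<open>V\<close> and a third form \<open>W\<close>.  The
  conic is the discriminant conic, parametrized by the squares of linear forms.\<close>

lemma smooth_conic_with_pencil:
  assumes UV: "independent_pair U V" and k: "k = 3 \<or> k = (4::4)"
  obtains C \<phi> where "smooth_conic C" "conic_parametrization C \<phi>"
    "plane C = {v. \<forall>i. i \<noteq> 1 \<and> i \<noteq> 2 \<and> i \<noteq> k \<longrightarrow> v $ i = 0}"
    "\<And>x. bil (gram C) (\<phi> x) (axis 1 1) = quad U x"
    "\<And>x. bil (gram C) (\<phi> x) (axis 2 1) = quad V x"
proof -
  obtain W where W: "\<And>r s t. r *s U + s *s V + t *s W = 0 \<Longrightarrow> r = 0 \<and> s = 0 \<and> t = 0"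
    using independent_pair_complete[OF UV] by blast
  define P where "P = {v :: complex^4. \<forall>i. i \<noteq> 1 \<and> i \<noteq> 2 \<and> i \<noteq> k \<longrightarrow> v $ i = 0}"
  define \<kappa> :: "complex^4 \<Rightarrow> complex^3" where "\<kappa> v = v $ 1 *s U + v $ 2 *s V + v $ k *s W" for v
  have \<kappa>_lin: "\<kappa> (v + w) = \<kappa> v + \<kappa> w" "\<kappa> (s *s v) = s *s \<kappa> v" for v w s
    by (simp_all add: \<kappa>_def vec_eq_iff algebra_simps)
  have k12: "k \<noteq> 1" "k \<noteq> 2" using k by auto
  define A :: "complex^3^3" where "A = (\<chi> m i. if i = 1 then U $ m else if i = 2 then V $ m else W $ m)"
  have A: "A *v p = p $ 1 *s U + p $ 2 *s V + p $ 3 *s W" for p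
    by (simp add: A_def matrix_vector_mult_def vec_eq_iff sum_3 mult.commute)
  have "\<exists>B. B ** A = mat 1"
    unfolding matrix_left_invertible_ker A
  proof (intro allI impI)
    fix p :: "complex^3" assume "p $ 1 *s U + p $ 2 *s V + p $ 3 *s W = 0"
    from W[OF this] show "p = 0" by (simp add: vec3_eq_iff)
  qed
  then obtain B where "B ** A = mat 1" by blast
  then have AB: "A *v (B *v p) = p" "B *v (A *v p) = p" for p
    using matrix_left_right_inverse by (metis matrix_vector_mul_assoc matrix_vector_mul_lid)+
  define g :: "complex^3 \<Rightarrow> complex^4" where
    "g p = (\<chi> i. if i = 1 then (B *v p) $ 1 else if i = 2 then (B *v p) $ 2 else if i = k then (B *v p) $ 3 else 0)" for p
  have g_lin: "g (p + q) = g p + g q" "g (s *s p) = s *s g p" for p q s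
    by (simp_all add: g_def vec_eq_iff matrix_vector_right_distrib vector_scalar_commute)
  have g_P: "g p \<in> P" for p by (simp add: g_def P_def)
  have \<kappa>_g: "\<kappa> (g p) = p" for p
  proof -
    have "\<kappa> (g p) = A *v (B *v p)" unfolding A \<kappa>_def using k12 by (simp add: g_def)
    then show ?thesis using AB by simp
  qed
  have g_\<kappa>: "g (\<kappa> v) = v" if "v \<in> P" for v
  proof -
    have "\<kappa> v = A *v vector [v $ 1, v $ 2, v $ k]" unfolding A \<kappa>_def by simp
    then have "B *v \<kappa> v = vector [v $ 1, v $ 2, v $ k]" using AB by simp
    then show ?thesis using that by (auto simp: g_def vec_eq_iff P_def)
  qed
  have P_sub: "vec.subspace P" unfolding vec.subspace_def P_def by simp
  have g_span: "g p = p $ 3 *s g (vector [0, 0, 1]) + (- p $ 2 / 2) *s g (vector [0, - 2, 0]) + p $ 1 *s g (vector [1, 0, 0])" for p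
    unfolding g_lin[symmetric] by (rule arg_cong[of _ _ g]) (simp add: vec3_eq_iff)
  define a b c where "a = g (vector [0, 0, 1])" and "b = g (vector [0, - 2, 0])" and "c = g (vector [1, 0, 0])"
  have ind: "r = 0 \<and> s = 0 \<and> t = 0" if "r *s a + s *s b + t *s c = 0" for r s t
  proof -
    have "\<kappa> (r *s a + s *s b + t *s c) = 0" unfolding that by (simp add: \<kappa>_def)
    then have "r *s vector [0, 0, 1] + s *s vector [0, - 2, 0] + t *s vector [1, 0, 0] = (0 :: complex^3)"
      by (simp only: a_def b_def c_def \<kappa>_lin \<kappa>_g)
    then show ?thesis by (simp add: vec3_eq_iff)
  qed
  have abc: "vec.independent {a, b, c}" "distinct [a, b, c]"
    using independent_tripleI[of a b c] ind by blast+
  have P_dim: "vec.dim P = 3"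
  proof (rule vec.dim_unique)
    show "{a, b, c} \<subseteq> P" using g_P by (simp add: a_def b_def c_def)
    show "P \<subseteq> vec.span {a, b, c}"
    proof
      fix v assume "v \<in> P"
      then have "v = g (\<kappa> v)" using g_\<kappa> by simp
      then have "v = \<kappa> v $ 3 *s a + (- \<kappa> v $ 2 / 2) *s b + \<kappa> v $ 1 *s c"
        using g_span unfolding a_def b_def c_def by metis
      then show "v \<in> vec.span {a, b, c}"
        by (metis insertI1 insertI2 vec.span_add vec.span_base vec.span_scale)
    qed
    show "vec.independent {a, b, c}" by (rule abc)
    show "card {a, b, c} = 3" using abc(2) by simp
  qed
  define M where "M i = (if i = 1 then U else if i = 2 then V else if i = k then W else 0)" for i :: 4
  define G :: "complex^4^4" where "G = (\<chi> i j. discriminant_form (M i) (M j))"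
  have bil_G: "bil G v w = discriminant_form (\<kappa> v) (\<kappa> w)" for v w
    using k unfolding bil_def sum_4 G_def M_def \<kappa>_def discriminant_form_def
    by (elim disjE) (simp_all add: algebra_simps)
  define C where "C = Conic P G"
  define \<phi> where "\<phi> x = g (square_form x)" for x
  have C: "plane C = P" "gram C = G" by (simp_all add: C_def)
  have \<kappa>_\<phi>: "\<kappa> (\<phi> x) = square_form x" for x by (simp add: \<phi>_def \<kappa>_g)
  have smooth: "smooth_conic C" unfolding smooth_conic_def C
  proof (intro conjI ballI impI P_sub P_dim)
    show "transpose G = G" by (simp add: transpose_def G_def vec_eq_iff discriminant_form_def mult.commute add.commute)
    fix v assume v: "v \<in> P" "v \<noteq> 0 \<and> bil G v v = 0"
    then have "\<kappa> v \<noteq> 0" using g_\<kappa>[of v] g_lin(2)[of 0 0] by auto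
    then obtain q where "discriminant_form (\<kappa> v) q \<noteq> 0" by (rule discriminant_nondegenerate)
    then show "\<exists>w\<in>P. bil G v w \<noteq> 0" using g_P by (intro bexI[of _ "g q"]) (simp_all add: bil_G \<kappa>_g)
  qed
  have param: "conic_parametrization C \<phi>" unfolding conic_parametrization_def
  proof (rule conjI, rule exI[of _ a], rule exI[of _ b], rule exI[of _ c], intro conjI abc)
    have "\<phi> x = (x $ 1)\<^sup>2 *s a + (x $ 1 * x $ 2) *s b + (x $ 2)\<^sup>2 *s c" for x
      unfolding \<phi>_def a_def b_def c_def by (subst g_span) (simp add: square_form_def)
    then show "\<phi> = (\<lambda>x. (x $ 1)\<^sup>2 *s a + (x $ 1 * x $ 2) *s b + (x $ 2)\<^sup>2 *s c)" by blast
    show "conic_points C = {pt (\<phi> x) |x. x \<noteq> 0}"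
    proof
      show "conic_points C \<subseteq> {pt (\<phi> x) |x. x \<noteq> 0}"
      proof
        fix p assume "p \<in> conic_points C"
        then obtain v where v: "p = pt v" "v \<in> P" "v \<noteq> 0" "discriminant_form (\<kappa> v) (\<kappa> v) = 0"
          unfolding conic_points_def C bil_G by blast
        obtain x where x: "\<kappa> v = square_form x" using discriminant_zero_imp_square[OF v(4)] by blast
        then have "v = \<phi> x" using g_\<kappa>[OF v(2)] by (simp add: \<phi>_def)
        moreover have "x \<noteq> 0"
        proof
          assume "x = 0"
          then have "square_form x = 0 *s 0" by (simp add: square_form_def vec3_eq_iff)
          then have "\<phi> x = g (0 *s 0)" by (simp only: \<phi>_def)
          then show False using \<open>v = \<phi> x\<close> v(3) unfolding g_lin by simp
        qed
        ultimately show "p \<in> {pt (\<phi> x) |x. x \<noteq> 0}" using v(1) by blast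
      qed
      show "{pt (\<phi> x) |x. x \<noteq> 0} \<subseteq> conic_points C"
      proof
        fix p assume "p \<in> {pt (\<phi> x) |x. x \<noteq> 0}"
        then obtain x where x: "p = pt (\<phi> x)" "x \<noteq> 0" by blast
        have "quad (square_form x) x = 0"
          by (simp add: quad_def square_form_def power2_eq_square)
        then have "bil G (\<phi> x) (\<phi> x) = 0" unfolding bil_G \<kappa>_\<phi> discriminant_square_form .
        moreover have "\<phi> x \<noteq> 0" using \<kappa>_\<phi>[of x] square_form_not_zero[OF x(2)] by (auto simp: \<kappa>_def)
        ultimately show "p \<in> conic_points C"
          unfolding conic_points_def C using x(1) g_P[of "square_form x"] unfolding \<phi>_def by blast
      qed
    qed
  qed
  have bil_\<phi>: "bil (gram C) (\<phi> x) w = quad (\<kappa> w) x" for x w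
    unfolding C bil_G \<kappa>_\<phi> discriminant_square_form ..
  have "\<kappa> (axis 1 1) = U" "\<kappa> (axis 2 1) = V" using k12 by (simp_all add: \<kappa>_def axis_def)
  then show thesis using that[OF smooth param] bil_\<phi> C unfolding P_def by simp
qed

lemma edge_curve_exists:
  assumes "independent_pair U V" "independent_pair U' V'"
  obtains C1 C2 \<phi>1 \<phi>2 where "smooth_conic C1" "smooth_conic C2" "plane C1 \<noteq> plane C2"
    "conic_parametrization C1 \<phi>1" "conic_parametrization C2 \<phi>2"
    "edge_curve C1 C2 \<phi>1 \<phi>2 = zeros (edge_form U V U' V')"
proof -
  obtain C1 \<phi>1 where 1: "smooth_conic C1" "conic_parametrization C1 \<phi>1"
    "plane C1 = {v. \<forall>i. i \<noteq> 1 \<and> i \<noteq> 2 \<and> i \<noteq> 3 \<longrightarrow> v $ i = 0}"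
    "\<And>x. bil (gram C1) (\<phi>1 x) (axis 1 1) = quad U x" "\<And>x. bil (gram C1) (\<phi>1 x) (axis 2 1) = quad V x"
    using smooth_conic_with_pencil[OF assms(1), of 3] by blast
  obtain C2 \<phi>2 where 2: "smooth_conic C2" "conic_parametrization C2 \<phi>2"
    "plane C2 = {v. \<forall>i. i \<noteq> 1 \<and> i \<noteq> 2 \<and> i \<noteq> 4 \<longrightarrow> v $ i = 0}"
    "\<And>x. bil (gram C2) (\<phi>2 x) (axis 1 1) = quad U' x" "\<And>x. bil (gram C2) (\<phi>2 x) (axis 2 1) = quad V' x"
    using smooth_conic_with_pencil[OF assms(2), of 4] by blast
  have P1: "v \<in> plane C1 \<longleftrightarrow> v $ 4 = 0" and P2: "v \<in> plane C2 \<longleftrightarrow> v $ 3 = 0" for v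
    unfolding 1(3) 2(3) by (simp_all add: forall_4)
  have "axis 3 1 \<in> plane C1" "axis 3 1 \<notin> plane C2" unfolding P1 P2 by (simp_all add: axis_def)
  then have ne: "plane C1 \<noteq> plane C2" by blast
  have L: "plane C1 \<inter> plane C2 = {s *s axis 1 1 + t *s axis 2 1 | s t. True}"
  proof (intro equalityI subsetI)
    fix v assume "v \<in> plane C1 \<inter> plane C2"
    then have "v = v $ 1 *s axis 1 1 + v $ 2 *s axis 2 1" using P1 P2 by (simp add: vec4_eq_iff axis_def)
    then show "v \<in> {s *s axis 1 1 + t *s axis 2 1 | s t. True}" by blast
  next
    fix v :: "complex^4" assume "v \<in> {s *s axis 1 1 + t *s axis 2 1 | s t. True}"
    then obtain s t where "v = s *s axis 1 1 + t *s axis 2 1" by blast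
    then have "v $ 3 = 0" "v $ 4 = 0" by (simp_all add: axis_def)
    then show "v \<in> plane C1 \<inter> plane C2" using P1 P2 by blast
  qed
  have ind: "independent_pair (axis 1 1) (axis 2 1 :: complex^4)"
    unfolding independent_pair_def by (simp add: vec4_eq_iff axis_def)
  show thesis
    using that[OF 1(1) 2(1) ne 1(2) 2(2) edge_curve_eq_zeros[OF 1(1) 2(1) ne 1(2) 2(2) L ind 1(4,5) 2(4,5)]] .
qed

text \<open>The geometry enters the classification only through this equivalence.\<close>

lemma occurs_as_edge_curve_iff:
  "occurs_as_edge_curve T \<longleftrightarrow> (\<exists>F U V U' V'. independent_pair U V \<and> independent_pair U' V' \<and>
     biform 2 2 F \<and> T F \<and> zeros F = zeros (edge_form U V U' V'))"
proof
  assume "occurs_as_edge_curve T"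
  then obtain C1 C2 \<phi>1 \<phi>2 F where h: "smooth_conic C1" "smooth_conic C2" "plane C1 \<noteq> plane C2"
    "conic_parametrization C1 \<phi>1" "conic_parametrization C2 \<phi>2" "biform 2 2 F" "T F"
    "edge_curve C1 C2 \<phi>1 \<phi>2 = zeros F"
    unfolding occurs_as_edge_curve_def by blast
  obtain U V U' V' where "independent_pair U V" "independent_pair U' V'"
    "edge_curve C1 C2 \<phi>1 \<phi>2 = zeros (edge_form U V U' V')"
    using edge_curve_equation[OF h(1-5)] by blast
  then show "\<exists>F U V U' V'. independent_pair U V \<and> independent_pair U' V' \<and>
     biform 2 2 F \<and> T F \<and> zeros F = zeros (edge_form U V U' V')"
    using h(6-8) by (intro exI[of _ F] exI conjI) auto
next
  assume "\<exists>F U V U' V'. independent_pair U V \<and> independent_pair U' V' \<and>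
     biform 2 2 F \<and> T F \<and> zeros F = zeros (edge_form U V U' V')"
  then obtain F U V U' V' where h: "independent_pair U V" "independent_pair U' V'"
     "biform 2 2 F" "T F" "zeros F = zeros (edge_form U V U' V')" by blast
  obtain C1 C2 \<phi>1 \<phi>2 where "smooth_conic C1" "smooth_conic C2" "plane C1 \<noteq> plane C2"
    "conic_parametrization C1 \<phi>1" "conic_parametrization C2 \<phi>2"
    "edge_curve C1 C2 \<phi>1 \<phi>2 = zeros (edge_form U V U' V')"
    using edge_curve_exists[OF h(1,2)] by blast
  then show "occurs_as_edge_curve T"
    unfolding occurs_as_edge_curve_def using h(3-5) by metis
qed


lemma occurs_as_edge_curveI:
  assumes "independent_pair U V" "independent_pair U' V'" "\<And>x y. F x y = edge_form U V U' V' x y" "T F"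
  shows "occurs_as_edge_curve T"
proof -
  have "F = edge_form U V U' V'" using assms(3) by blast
  then show ?thesis unfolding occurs_as_edge_curve_iff using assms(1,2,4) biform_edge_form by blast
qed

section \<open>Types that do not occur\<close>

lemma irreducible_biform_1_0_zeros:
  assumes "irreducible_biform 1 0 G"
  shows "\<exists>p :: complex^2. p \<noteq> 0 \<and> (\<forall>x y. G x y = 0 \<longleftrightarrow> p $ 1 * x $ 2 = p $ 2 * x $ 1)"
proof -
  obtain c where c: "\<And>x y. G x y = (\<Sum>i\<le>1. \<Sum>j\<le>0. c i j * (x $ 1) ^ i * (x $ 2) ^ (1 - i) * (y $ 1) ^ j * (y $ 2) ^ (0 - j))"
    using assms unfolding irreducible_biform_def biform_def by blast
  then have G: "G x y = c 0 0 * x $ 2 + c 1 0 * x $ 1" for x y by simp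
  define p :: "complex^2" where "p = vector [c 0 0, - c 1 0]"
  have "\<exists>x y. G x y \<noteq> 0" using assms unfolding irreducible_biform_def by blast
  then have "p \<noteq> 0" unfolding G p_def by (auto simp: vec2_eq_iff)
  moreover have "G x y = 0 \<longleftrightarrow> p $ 1 * x $ 2 = p $ 2 * x $ 1" for x y
    unfolding G p_def by (simp add: eq_neg_iff_add_eq_0)
  ultimately show ?thesis by blast
qed

text \<open>Two lines \<open>{x} \<times> P\<^sup>1\<close> on the curve would be two common roots of the independent forms \<open>U\<close>, \<open>V\<close>.\<close>

lemma four_lines_not_edge_curve: "\<not> occurs_as_edge_curve type_10_10_01_01"
proof
  assume "occurs_as_edge_curve type_10_10_01_01"
  then obtain F U V U' V' where ind: "independent_pair U V" "independent_pair U' V'"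
    and F: "biform 2 2 F" "type_10_10_01_01 F" "zeros F = zeros (edge_form U V U' V')"
    unfolding occurs_as_edge_curve_iff by blast
  obtain G1 G2 H1 H2 where G: "irreducible_biform 1 0 G1" "irreducible_biform 1 0 G2"
    "zeros G1 \<noteq> zeros G2" "F = G1 * G2 * H1 * H2"
    using F(2) unfolding type_10_10_01_01_def by blast
  obtain p1 :: "complex^2" where p1: "p1 \<noteq> 0" "\<And>x y. G1 x y = 0 \<longleftrightarrow> p1 $ 1 * x $ 2 = p1 $ 2 * x $ 1"
    using irreducible_biform_1_0_zeros[OF G(1)] by blast
  obtain p2 :: "complex^2" where p2: "p2 \<noteq> 0" "\<And>x y. G2 x y = 0 \<longleftrightarrow> p2 $ 1 * x $ 2 = p2 $ 2 * x $ 1"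
    using irreducible_biform_1_0_zeros[OF G(2)] by blast
  have van: "quad U p = 0 \<and> quad V p = 0" if p: "p \<noteq> 0" "\<And>y. F p y = 0" for p
  proof -
    have "edge_form U V U' V' p y = 0" for y
    proof (cases "y = 0")
      case True then show ?thesis by (simp add: edge_form_def quad_def)
    next
      case False
      then have "(pt p, pt y) \<in> zeros F" using p in_zeros_iff[OF F(1)] by blast
      then show ?thesis using in_zeros_iff[OF biform_edge_form p(1) False] F(3) by blast
    qed
    then show ?thesis using edge_form_vanishes_on_line_iff[OF ind(2)] by blast
  qed
  have "F p1 y = 0" "F p2 y = 0" for y using p1(2)[of p1 y] p2(2)[of p2 y] by (simp_all add: G(4))
  then have eq: "pt p1 = pt p2"
    using van p1(1) p2(1) independent_pair_common_root[OF ind(1)] by blast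
  have line: "zeros G = {(pt p, pt y) | y. y \<noteq> 0}"
    if "p \<noteq> 0" "\<And>x y. G x y = 0 \<longleftrightarrow> p $ 1 * x $ 2 = p $ 2 * x $ 1" for p G
    unfolding zeros_def that(2) using that(1) pt2_eq_iff[OF that(1)] by auto
  have "zeros G1 = {(pt p1, pt y) | y. y \<noteq> 0}" by (rule line[OF p1])
  moreover have "zeros G2 = {(pt p2, pt y) | y. y \<noteq> 0}" by (rule line[OF p2])
  ultimately show False using eq G(3) by simp
qed

lemma local_equation_coefficients:
  assumes F: "\<And>\<alpha> \<beta>. F (x + \<alpha> *s w) (y + \<beta> *s z) = (\<Sum>k\<le>a. \<Sum>l\<le>b. c k l * \<alpha> ^ k * \<beta> ^ l)"
    and f: "local_equation F x w y z f"
  shows "coeff2 f i j = (if i \<le> a \<and> j \<le> b then c i j else 0)"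
proof -
  define g :: "complex poly poly" where "g = (\<Sum>k\<le>a. monom (\<Sum>l\<le>b. monom (c k l) l) k)"
  have "poly (poly f [:\<alpha>:]) \<beta> = poly (poly g [:\<alpha>:]) \<beta>" for \<alpha> \<beta>
  proof -
    have "poly (poly f [:\<alpha>:]) \<beta> = (\<Sum>k\<le>a. \<Sum>l\<le>b. c k l * \<alpha> ^ k * \<beta> ^ l)"
      using f F unfolding local_equation_def by metis
    also have "\<dots> = poly (poly g [:\<alpha>:]) \<beta>"
      by (simp add: g_def poly_sum poly_monom sum_distrib_left mult_ac)
    finally show ?thesis .
  qed
  then have "poly (f - g) [:\<alpha>:] = 0" for \<alpha> by (simp add: poly_eq_poly_eq_iff[symmetric] fun_eq_iff)
  then have "range (\<lambda>\<alpha>. [:\<alpha>:]) \<subseteq> {p. poly (f - g) p = 0}" by blast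
  moreover have "infinite (range (\<lambda>\<alpha>::complex. [:\<alpha>:]))"
    using infinite_UNIV_char_0 finite_imageD[of "\<lambda>\<alpha>::complex. [:\<alpha>:]" UNIV] by (auto simp: inj_on_def)
  ultimately have "f - g = 0" using poly_roots_finite finite_subset by metis
  then have "f = g" by simp
  then show ?thesis by (simp add: g_def coeff_sum if_distrib[of "\<lambda>p. coeff p j"] cong: if_cong)
qed

text \<open>Up to scaling, \<open>t \<mapsto> (X, Y)\<close> parametrizes a curve with a cusp at infinity.  The polynomials of degree at
  most two in each of \<open>X\<close> and \<open>Y\<close> that vanish on it form a space of dimension one: comparing the coefficients of powers of
  \<open>t\<close> from the top downwards determines all \<open>e\<^sub>i\<^sub>j\<close> from \<open>g = e\<^sub>0\<^sub>2\<close>.  The determinant of the matrix is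
  then \<open>2 g\<^sup>3\<close>.\<close>

lemma singular_matrix_vanishing_on_cuspidal_curve:
  fixes p q c :: complex
  assumes pq: "p \<noteq> q" and "finite K"
    and van: "\<And>t X Y. t \<notin> K \<Longrightarrow> X = t\<^sup>2 + p * t + c \<Longrightarrow> Y = t\<^sup>2 + q * t + c \<Longrightarrow>
      e00 * (X\<^sup>2 * Y\<^sup>2) + e01 * (X\<^sup>2 * Y) + e02 * X\<^sup>2 +
      e10 * (X * Y\<^sup>2) + e11 * (X * Y) + e12 * X + e20 * Y\<^sup>2 + e21 * Y + e22 = 0"
    and det: "e00 * (e11 * e22 - e12 * e21) - e01 * (e10 * e22 - e12 * e20) + e02 * (e10 * e21 - e11 * e20) = 0"
  shows "e00 = 0 \<and> e01 = 0 \<and> e02 = 0 \<and> e10 = 0 \<and> e11 = 0 \<and> e12 = 0 \<and> e20 = 0 \<and> e21 = 0 \<and> e22 = 0"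
proof -
  \<comment> \<open>the expansion of the left-hand side in powers of \<open>t\<close>\<close>
  let ?P = "[:e00 * (c * c * c * c) + e01 * (c * c * c) + e02 * (c * c) + e10 * (c * c * c) + e11 * (c * c) + e12 * (c) + e20 * (c * c) + e21 * (c) + e22 * (1),
      e00 * (2 * c * c * c * p + 2 * c * c * c * q) + e01 * (2 * c * c * p + c * c * q) + e02 * (2 * c * p) + e10 * (c * c * p + 2 * c * c * q) + e11 * (c * p + c * q) + e12 * (p) + e20 * (2 * c * q) + e21 * (q),
      e00 * (4 * c * c * c + c * c * p * p + 4 * c * c * p * q + c * c * q * q) + e01 * (3 * c * c + c * p * p + 2 * c * p * q) + e02 * (2 * c + p * p) + e10 * (3 * c * c + 2 * c * p * q + c * q * q) + e11 * (2 * c + p * q) + e12 * (1) + e20 * (2 * c + q * q) + e21 * (1),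
      e00 * (6 * c * c * p + 6 * c * c * q + 2 * c * p * p * q + 2 * c * p * q * q) + e01 * (4 * c * p + 2 * c * q + p * p * q) + e02 * (2 * p) + e10 * (4 * c * q + 2 * c * p + p * q * q) + e11 * (q + p) + e20 * (2 * q),
      e00 * (6 * c * c + 8 * c * p * q + 2 * c * q * q + 2 * c * p * p + p * p * q * q) + e01 * (3 * c + 2 * p * q + p * p) + e02 * (1) + e10 * (3 * c + q * q + 2 * p * q) + e11 * (1) + e20 * (1),
      e00 * (6 * c * q + 6 * c * p + 2 * p * q * q + 2 * p * p * q) + e01 * (q + 2 * p) + e10 * (2 * q + p),
      e00 * (4 * c + q * q + 4 * p * q + p * p) + e01 * (1) + e10 * (1),
      e00 * (2 * q + 2 * p),
      e00 * (1):]"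
  have "?P = 0"
  proof (rule poly_zero_off_finite[OF \<open>finite K\<close>])
    fix t assume t: "t \<notin> K"
    let ?X = "t\<^sup>2 + p * t + c" and ?Y = "t\<^sup>2 + q * t + c"
    have "poly ?P t = e00 * (?X\<^sup>2 * ?Y\<^sup>2) + e01 * (?X\<^sup>2 * ?Y) + e02 * ?X\<^sup>2 +
      e10 * (?X * ?Y\<^sup>2) + e11 * (?X * ?Y) + e12 * ?X + e20 * ?Y\<^sup>2 + e21 * ?Y + e22"
      unfolding poly_pCons poly_0 power2_eq_square by algebra
    then show "poly ?P t = 0" using van[OF t refl refl] by simp
  qed
  note k = this[unfolded pCons_eq_0_iff]
  have e00: "e00 = 0" using k by simp
  from k e00 have "e10 = - e01" "e01 * (q + 2 * p) + e10 * (2 * q + p) = 0"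
    by (simp_all add: eq_neg_iff_add_eq_0 add.commute)
  then have "e01 * (p - q) = 0" by (simp add: algebra_simps)
  then have e01: "e01 = 0" using pq by simp
  then have e10: "e10 = 0" using \<open>e10 = - e01\<close> by simp
  have k4: "e02 + e11 + e20 = 0" and k3: "e02 * (2 * p) + e11 * (q + p) + e20 * (2 * q) = 0"
    and k2: "e02 * (2 * c + p * p) + e11 * (2 * c + p * q) + e12 + e20 * (2 * c + q * q) + e21 = 0"
    and k1: "e02 * (2 * c * p) + e11 * (c * p + c * q) + e12 * p + e20 * (2 * c * q) + e21 * q = 0"
    and k0: "e02 * (c * c) + e11 * (c * c) + e12 * c + e20 * (c * c) + e21 * c + e22 = 0"
    using k e00 e01 e10 by simp_all
  have "e11 = - e02 - e20" using k4 by (simp add: algebra_simps add_eq_0_iff)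
  then have "(e02 - e20) * (p - q) = 0" using k3 by algebra
  then have e20: "e20 = e02" using pq by simp
  with \<open>e11 = - e02 - e20\<close> have e11: "e11 = - 2 * e02" by simp
  have "2 * e02 ^ 3 = 0" using det e00 e01 e10 e11 e20 by (simp add: power3_eq_cube)
  then have e02: "e02 = 0" by simp
  then have e20': "e20 = 0" and e11': "e11 = 0" using e20 e11 by auto
  have "e12 = - e21" using k2 e02 e20' e11' by (simp add: eq_neg_iff_add_eq_0)
  moreover have "e12 * p + e21 * q = 0" using k1 e02 e20' e11' by simp
  ultimately have "e21 * (q - p) = 0" by (simp add: algebra_simps)
  then have e21: "e21 = 0" using pq by simp
  then have e12: "e12 = 0" using \<open>e12 = - e21\<close> by simp
  have "e22 = 0" using k0 e02 e20' e11' e12 e21 by simp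
  then show ?thesis using e00 e01 e02 e10 e11' e12 e20' e21 by blast
qed


text \<open>In the coordinates \<open>A = 1/\<alpha>\<close>, \<open>B = 1/\<beta>\<close> the equation of a curve with a cusp at \<open>\<alpha> = \<beta> = 0\<close> becomes
  \<open>(m A + l B)\<^sup>2 + a A + b B + c = 0\<close>.  This determines \<open>A\<close> and \<open>B\<close> as quadratic polynomials in
  \<open>t = m A + l B\<close>.  The edge form vanishes along this parametrization and has a singular matrix, so it
  would be zero.\<close>

lemma edge_curve_has_no_cusp:
  assumes F: "biform 2 2 F" and ind: "independent_pair U V" "independent_pair U' V'"
    and eq: "zeros F = zeros (edge_form U V U' V')"
  shows "\<not> cusp_at F P"
proof
  assume "cusp_at F P"
  then obtain x w y z f l m where loc: "local_equation F x w y z f"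
    and f: "coeff2 f 0 0 = 0" "coeff2 f 1 0 = 0" "coeff2 f 0 1 = 0"
      "coeff2 f 2 0 = l\<^sup>2" "coeff2 f 1 1 = 2 * l * m" "coeff2 f 0 2 = m\<^sup>2"
    and cubic: "(\<Sum>i\<le>3. coeff2 f i (3 - i) * m ^ i * (- l) ^ (3 - i)) \<noteq> 0"
    unfolding cusp_at_def by blast
  have xw: "x \<noteq> 0" "w \<notin> pt x" "y \<noteq> 0" "z \<notin> pt y" using loc unfolding local_equation_def by auto
  obtain C where C: "\<And>\<alpha> \<beta>. F (x + \<alpha> *s w) (y + \<beta> *s z) = (\<Sum>k\<le>2. \<Sum>l\<le>2. C k l * \<alpha> ^ k * \<beta> ^ l)"
    using biform_on_lines[OF F, of x w y z] by blast
  have coeff: "coeff2 f i j = (if i \<le> 2 \<and> j \<le> 2 then C i j else 0)" for i j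
    by (rule local_equation_coefficients[OF C loc])
  define a b c where "a = C 1 2" and "b = C 2 1" and "c = C 2 2"
  have Fab: "F (x + \<alpha> *s w) (y + \<beta> *s z) = l\<^sup>2 * \<alpha>\<^sup>2 + 2 * l * m * \<alpha> * \<beta> + m\<^sup>2 * \<beta>\<^sup>2 +
      a * \<alpha> * \<beta>\<^sup>2 + b * \<alpha>\<^sup>2 * \<beta> + c * \<alpha>\<^sup>2 * \<beta>\<^sup>2" for \<alpha> \<beta>
    using f unfolding coeff C by (simp add: numeral_2_eq_2 atMost_Suc a_def b_def c_def algebra_simps)
  have "l * m * (a * l - b * m) = (\<Sum>i\<le>3. coeff2 f i (3 - i) * m ^ i * (- l) ^ (3 - i))"
    unfolding coeff by (simp add: numeral_3_eq_3 numeral_2_eq_2 atMost_Suc a_def b_def algebra_simps)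
  \<comment> \<open>the condition on the cubic part forces both coefficients of the tangent to be nonzero\<close>
  with cubic have nz: "l \<noteq> 0" "m \<noteq> 0" "a * l - b * m \<noteq> 0" by auto
  \<comment> \<open>solving the two linear equations for \<open>A\<close> and \<open>B\<close> gives \<open>A = \<mu> (t\<^sup>2 + p t + c)\<close>, \<open>B = \<nu> (t\<^sup>2 + q t + c)\<close>\<close>
  define D where "D = m * b - l * a"
  have D: "D \<noteq> 0" using nz(3) unfolding D_def by (simp add: algebra_simps)
  define p q where "p = b / l" and "q = a / m"
  have "l * m * (p - q) = D" using nz by (simp add: p_def q_def D_def field_simps)
  then have pq: "p \<noteq> q" using D by auto
  define u0 u1 u2 where "u0 = quad U x" and "u1 = polar U x w" and "u2 = quad U w"
  define v0 v1 v2 where "v0 = quad V x" and "v1 = polar V x w" and "v2 = quad V w"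
  define u0' u1' u2' where "u0' = quad U' y" and "u1' = polar U' y z" and "u2' = quad U' z"
  define v0' v1' v2' where "v0' = quad V' y" and "v1' = polar V' y z" and "v2' = quad V' z"
  note uv_defs = u0_def u1_def u2_def v0_def v1_def v2_def u0'_def u1'_def u2'_def v0'_def v1'_def v2'_def
  define \<mu> \<nu> where "\<mu> = l / D" and "\<nu> = - m / D"
  have \<mu>\<nu>: "\<mu> \<noteq> 0" "\<nu> \<noteq> 0" using nz D by (simp_all add: \<mu>_def \<nu>_def)
  have rigid: "(u0 * v0' - v0 * u0') * (\<mu>\<^sup>2 * \<nu>\<^sup>2) = 0 \<and> (u0 * v1' - v0 * u1') * (\<mu>\<^sup>2 * \<nu>) = 0 \<and>
    (u0 * v2' - v0 * u2') * \<mu>\<^sup>2 = 0 \<and> (u1 * v0' - v1 * u0') * (\<mu> * \<nu>\<^sup>2) = 0 \<and>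
    (u1 * v1' - v1 * u1') * (\<mu> * \<nu>) = 0 \<and> (u1 * v2' - v1 * u2') * \<mu> = 0 \<and>
    (u2 * v0' - v2 * u0') * \<nu>\<^sup>2 = 0 \<and> (u2 * v1' - v2 * u1') * \<nu> = 0 \<and> u2 * v2' - v2 * u2' = 0"
  proof (rule singular_matrix_vanishing_on_cuspidal_curve[OF pq, of "{t. poly [:c, p, 1:] t = 0} \<union> {t. poly [:c, q, 1:] t = 0}" c])
    show "finite ({t. poly [:c, p, 1:] t = 0} \<union> {t. poly [:c, q, 1:] t = 0})"
      by (intro finite_UnI poly_roots_finite) simp_all
    show "(u0 * v0' - v0 * u0') * (\<mu>\<^sup>2 * \<nu>\<^sup>2) * (X\<^sup>2 * Y\<^sup>2) + (u0 * v1' - v0 * u1') * (\<mu>\<^sup>2 * \<nu>) * (X\<^sup>2 * Y) +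
      (u0 * v2' - v0 * u2') * \<mu>\<^sup>2 * X\<^sup>2 + (u1 * v0' - v1 * u0') * (\<mu> * \<nu>\<^sup>2) * (X * Y\<^sup>2) +
      (u1 * v1' - v1 * u1') * (\<mu> * \<nu>) * (X * Y) + (u1 * v2' - v1 * u2') * \<mu> * X +
      (u2 * v0' - v2 * u0') * \<nu>\<^sup>2 * Y\<^sup>2 + (u2 * v1' - v2 * u1') * \<nu> * Y + (u2 * v2' - v2 * u2') = 0"
      if t: "t \<notin> {t. poly [:c, p, 1:] t = 0} \<union> {t. poly [:c, q, 1:] t = 0}"
        and X: "X = t\<^sup>2 + p * t + c" and Y: "Y = t\<^sup>2 + q * t + c" for t X Y
    proof -
      have XY: "X \<noteq> 0" "Y \<noteq> 0" using t unfolding X Y by (simp_all add: power2_eq_square algebra_simps)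
      define A B where "A = \<mu> * X" and "B = \<nu> * Y"
      have AB: "A \<noteq> 0" "B \<noteq> 0" using XY \<mu>\<nu> by (simp_all add: A_def B_def)
      have lin: "m * A + l * B = t"
      proof -
        have "m * A + l * B = l * m * (X - Y) / D" using D by (simp add: A_def B_def \<mu>_def \<nu>_def field_simps)
        also have "X - Y = (p - q) * t" unfolding X Y by (simp add: algebra_simps)
        also have "l * m * ((p - q) * t) / D = t"
          using \<open>l * m * (p - q) = D\<close> D by (metis mult.assoc nonzero_mult_div_cancel_left)
        finally show ?thesis .
      qed
      have "a * A + b * B = (a * l * X - b * m * Y) / D"
        using D by (simp add: A_def B_def \<mu>_def \<nu>_def field_simps)
      also have "a * l * X - b * m * Y = - D * (t\<^sup>2 + c)"
        using nz unfolding X Y p_def q_def D_def by (simp add: field_simps)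
      finally have const: "a * A + b * B = - (t\<^sup>2 + c)" using D by simp
      have "l\<^sup>2 * B\<^sup>2 + 2 * l * m * A * B + m\<^sup>2 * A\<^sup>2 + a * A + b * B + c = (m * A + l * B)\<^sup>2 + (a * A + b * B) + c"
        by (simp add: power2_eq_square algebra_simps)
      also have "\<dots> = 0" unfolding lin const by simp
      finally have curve: "l\<^sup>2 * B\<^sup>2 + 2 * l * m * A * B + m\<^sup>2 * A\<^sup>2 + a * A + b * B + c = 0" .
      have "F (x + (1 / A) *s w) (y + (1 / B) *s z) =
        (l\<^sup>2 * B\<^sup>2 + 2 * l * m * A * B + m\<^sup>2 * A\<^sup>2 + a * A + b * B + c) / (A\<^sup>2 * B\<^sup>2)"
        unfolding Fab using AB by (simp add: power2_eq_square field_simps)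
      then have "F (x + (1 / A) *s w) (y + (1 / B) *s z) = 0" using curve by simp
      then have "edge_form U V U' V' (x + (1 / A) *s w) (y + (1 / B) *s z) = 0"
        using in_zeros_iff[OF F add_scaled_not_zero[OF xw(1,2)] add_scaled_not_zero[OF xw(3,4)]]
          in_zeros_iff[OF biform_edge_form add_scaled_not_zero[OF xw(1,2)] add_scaled_not_zero[OF xw(3,4)]]
        unfolding eq by blast
      then have "(u0 + u1 * (1 / A) + u2 * (1 / A)\<^sup>2) * (v0' + v1' * (1 / B) + v2' * (1 / B)\<^sup>2) -
        (v0 + v1 * (1 / A) + v2 * (1 / A)\<^sup>2) * (u0' + u1' * (1 / B) + u2' * (1 / B)\<^sup>2) = 0"
        unfolding edge_form_def quad_on_line uv_defs .
      moreover have "u + u' * (1 / A) + u'' * (1 / A)\<^sup>2 = (u * A\<^sup>2 + u' * A + u'') / A\<^sup>2"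
        "u + u' * (1 / B) + u'' * (1 / B)\<^sup>2 = (u * B\<^sup>2 + u' * B + u'') / B\<^sup>2" for u u' u''
        using AB by (simp_all add: power2_eq_square field_simps)
      ultimately have "(u0 * A\<^sup>2 + u1 * A + u2) * (v0' * B\<^sup>2 + v1' * B + v2') -
        (v0 * A\<^sup>2 + v1 * A + v2) * (u0' * B\<^sup>2 + u1' * B + u2') = 0"
        using AB by (simp only: times_divide_times_eq diff_divide_distrib[symmetric] divide_eq_0_iff) simp
      then show ?thesis unfolding A_def B_def by (simp add: power2_eq_square algebra_simps)
    qed
    show "(u0 * v0' - v0 * u0') * (\<mu>\<^sup>2 * \<nu>\<^sup>2) * ((u1 * v1' - v1 * u1') * (\<mu> * \<nu>) * (u2 * v2' - v2 * u2') -
        (u1 * v2' - v1 * u2') * \<mu> * ((u2 * v1' - v2 * u1') * \<nu>)) -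
      (u0 * v1' - v0 * u1') * (\<mu>\<^sup>2 * \<nu>) * ((u1 * v0' - v1 * u0') * (\<mu> * \<nu>\<^sup>2) * (u2 * v2' - v2 * u2') -
        (u1 * v2' - v1 * u2') * \<mu> * ((u2 * v0' - v2 * u0') * \<nu>\<^sup>2)) +
      (u0 * v2' - v0 * u2') * \<mu>\<^sup>2 * ((u1 * v0' - v1 * u0') * (\<mu> * \<nu>\<^sup>2) * ((u2 * v1' - v2 * u1') * \<nu>) -
        (u1 * v1' - v1 * u1') * (\<mu> * \<nu>) * ((u2 * v0' - v2 * u0') * \<nu>\<^sup>2)) = 0"
      by algebra
  qed
  then have minors: "u0 * v0' - v0 * u0' = 0" "u0 * v1' - v0 * u1' = 0" "u0 * v2' - v0 * u2' = 0" "u1 * v0' - v1 * u0' = 0" "u1 * v1' - v1 * u1' = 0" "u1 * v2' - v1 * u2' = 0" "u2 * v0' - v2 * u0' = 0" "u2 * v1' - v2 * u1' = 0" "u2 * v2' - v2 * u2' = 0"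
    using \<mu>\<nu> by simp_all
  have "edge_form U V U' V' x' y' = 0" for x' y'
  proof -
    obtain s t where st: "x' = s *s x + t *s w" using basis2_decompose[OF xw(1,2)] by blast
    obtain s' t' where st': "y' = s' *s y + t' *s z" using basis2_decompose[OF xw(3,4)] by blast
    have "edge_form U V U' V' x' y' = (s\<^sup>2 * u0 + s * t * u1 + t\<^sup>2 * u2) * (s'\<^sup>2 * v0' + s' * t' * v1' + t'\<^sup>2 * v2')
      - (s\<^sup>2 * v0 + s * t * v1 + t\<^sup>2 * v2) * (s'\<^sup>2 * u0' + s' * t' * u1' + t'\<^sup>2 * u2')"
      unfolding st st' edge_form_def quad_combination uv_defs ..
    also have "\<dots> = (u0 * v0' - v0 * u0') * (s\<^sup>2 * (s'\<^sup>2)) +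
      (u0 * v1' - v0 * u1') * (s\<^sup>2 * (s' * t')) +
      (u0 * v2' - v0 * u2') * (s\<^sup>2 * (t'\<^sup>2)) +
      (u1 * v0' - v1 * u0') * (s * t * (s'\<^sup>2)) +
      (u1 * v1' - v1 * u1') * (s * t * (s' * t')) +
      (u1 * v2' - v1 * u2') * (s * t * (t'\<^sup>2)) +
      (u2 * v0' - v2 * u0') * (t\<^sup>2 * (s'\<^sup>2)) +
      (u2 * v1' - v2 * u1') * (t\<^sup>2 * (s' * t')) +
      (u2 * v2' - v2 * u2') * (t\<^sup>2 * (t'\<^sup>2))"
      by algebra
    also have "\<dots> = 0" unfolding minors by simp
    finally show ?thesis .
  qed
  then show False using edge_form_nonzero[OF ind] by blast
qed

lemma cusp_not_edge_curve: "\<not> occurs_as_edge_curve type_cusp"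
  unfolding occurs_as_edge_curve_iff type_cusp_def using edge_curve_has_no_cusp by blast

section \<open>Irreducible forms\<close>

lemma biform_swap:
  assumes "biform a b F"
  shows "biform b a (\<lambda>x y. F y x)"
proof -
  obtain c where c: "\<And>x y. F x y = (\<Sum>i\<le>a. \<Sum>j\<le>b. c i j * monomial a b i j x y)"
    using assms unfolding biform_iff_monomials by blast
  have m: "monomial a b i j y x = monomial b a j i x y" for i j x y
    by (simp add: monomial_def mult_ac)
  have "F y x = (\<Sum>j\<le>b. \<Sum>i\<le>a. c i j * monomial b a j i x y)" for x y
    unfolding c m by (rule sum.swap)
  then show ?thesis unfolding biform_iff_monomials by (intro exI[of _ "\<lambda>j i. c i j"]) blast
qed

lemma biform_left_root:
  assumes "biform a 0 F" "a > 0"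
  shows "\<exists>x. x \<noteq> 0 \<and> (\<forall>y. F x y = 0)"
proof -
  obtain c where c: "\<And>x y. F x y = (\<Sum>i\<le>a. \<Sum>j\<le>0. c i j * (x $ 1) ^ i * (x $ 2) ^ (a - i) * (y $ 1) ^ j * (y $ 2) ^ (0 - j))"
    using assms unfolding biform_def by blast
  show ?thesis
  proof (cases "c a 0 = 0")
    case True
    then have "F (vector [1, 0]) y = 0" for y unfolding c
      by (intro sum.neutral) (auto simp: power_0_left)
    then show ?thesis by (intro exI[of _ "vector [1, 0]"]) (simp add: vec2_eq_iff)
  next
    case False
    then obtain t where "(\<Sum>i\<le>a. c i 0 * t ^ i) = 0"
      using alg_closed[of a "\<lambda>i. c i 0"] assms(2) by blast
    then have "F (vector [t, 1]) y = 0" for y unfolding c by simp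
    then show ?thesis by (intro exI[of _ "vector [t, 1]"]) (simp add: vec2_eq_iff)
  qed
qed

lemma biform_right_root: "biform 0 b F \<Longrightarrow> b > 0 \<Longrightarrow> \<exists>y. y \<noteq> 0 \<and> (\<forall>x. F x y = 0)"
  using biform_left_root[of b "\<lambda>x y. F y x"] biform_swap[of 0 b F] by blast

lemma biform_degrees_unique:
  assumes "biform a b F" "biform a' b' F" "F x y \<noteq> 0"
  shows "a = a' \<and> b = b'"
proof -
  have pow: "m = n" if "(2::complex) ^ m = 2 ^ n" for m n
  proof -
    have "norm ((2::complex) ^ m) = norm ((2::complex) ^ n)" using that by simp
    then have "(2::real) ^ m = 2 ^ n" by (simp add: norm_power)
    then show ?thesis by simp
  qed
  have "2 ^ a * F x y = 2 ^ a' * F x y"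
    using biform_scale[OF assms(1), of 2 x 1 y] biform_scale[OF assms(2), of 2 x 1 y] by simp
  moreover have "2 ^ b * F x y = 2 ^ b' * F x y"
    using biform_scale[OF assms(1), of 1 x 2 y] biform_scale[OF assms(2), of 1 x 2 y] by simp
  ultimately show ?thesis using assms(3) pow by simp
qed

lemma factor_degrees:
  assumes "biform a b F" "F x y \<noteq> 0" "biform a1 b1 G" "biform a2 b2 H" "F = G * H"
  shows "a1 + a2 = a \<and> b1 + b2 = b"
proof -
  have "F = (\<lambda>x y. G x y * H x y)" unfolding assms(5) by (simp add: fun_eq_iff)
  then have "biform (a1 + a2) (b1 + b2) F" using biform_mult[OF assms(3,4)] by simp
  then show ?thesis using biform_degrees_unique assms(1,2) by blast
qed

lemma irreducible_biform_degree_one: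
  assumes "biform a b F" "F x y \<noteq> 0" "a + b = 1"
  shows "irreducible_biform a b F"
  unfolding irreducible_biform_def
proof (intro conjI allI impI)
  fix a1 b1 a2 b2 G H
  assume "biform a1 b1 G \<and> biform a2 b2 H \<and> F = G * H"
  then have "a1 + a2 = a \<and> b1 + b2 = b" using factor_degrees assms(1,2) by blast
  then show "(a1, b1) = (0, 0) \<or> (a2, b2) = (0, 0)" using assms(3) by auto
qed (use assms in auto)

text \<open>A factor that involves only one set of variables has a root and therefore contributes a line.\<close>

lemma no_line_imp_factor_degrees_positive:
  assumes "\<And>x. x \<noteq> 0 \<Longrightarrow> \<exists>y. F x y \<noteq> 0" "\<And>y. y \<noteq> 0 \<Longrightarrow> \<exists>x. F x y \<noteq> 0"
    and "biform a1 b1 G" "F = G * H" "(a1, b1) \<noteq> (0, 0)"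
  shows "a1 > 0 \<and> b1 > 0"
proof (rule ccontr)
  assume "\<not> (a1 > 0 \<and> b1 > 0)"
  then consider "b1 = 0" "a1 > 0" | "a1 = 0" "b1 > 0" using assms(5) by auto
  then show False
  proof cases
    case 1
    then obtain x where "x \<noteq> 0" "\<forall>y. G x y = 0" using biform_left_root assms(3) by blast
    then show False using assms(1)[of x] unfolding assms(4) by simp
  next
    case 2
    then obtain y where "y \<noteq> 0" "\<forall>x. G x y = 0" using biform_right_root assms(3) by blast
    then show False using assms(2)[of y] unfolding assms(4) by simp
  qed
qed

text \<open>If the degree in one set of variables is one, then one of two factors does not involve these variables.\<close>

lemma irreducible_biform_no_line:
  assumes F: "biform a b F" and deg: "a = 1 \<or> b = 1"
    and lines: "\<And>x. x \<noteq> 0 \<Longrightarrow> \<exists>y. F x y \<noteq> 0" "\<And>y. y \<noteq> 0 \<Longrightarrow> \<exists>x. F x y \<noteq> 0"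
  shows "irreducible_biform a b F"
  unfolding irreducible_biform_def
proof (intro conjI allI impI)
  have "vector [1, 0] \<noteq> (0 :: complex^2)" by (simp add: vec2_eq_iff)
  then show nz: "\<exists>x y. F x y \<noteq> 0" using lines(1) by blast
  fix a1 b1 a2 b2 G H
  assume h: "biform a1 b1 G \<and> biform a2 b2 H \<and> F = G * H"
  then have sum: "a1 + a2 = a \<and> b1 + b2 = b" using factor_degrees F nz by blast
  show "(a1, b1) = (0, 0) \<or> (a2, b2) = (0, 0)"
  proof (rule ccontr)
    assume ne: "\<not> ((a1, b1) = (0, 0) \<or> (a2, b2) = (0, 0))"
    have "F = H * G" using h by (simp add: mult.commute)
    then have "a1 > 0 \<and> b1 > 0" "a2 > 0 \<and> b2 > 0"
      using no_line_imp_factor_degrees_positive[OF lines] h ne by blast+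
    then show False using sum deg by auto
  qed
qed (use F deg in auto)


section \<open>The reducible types\<close>

lemma zeros_Int:
  assumes "biform a b F" "biform a' b' G"
  shows "zeros F \<inter> zeros G = {(pt x, pt y) | x y. x \<noteq> 0 \<and> y \<noteq> 0 \<and> F x y = 0 \<and> G x y = 0}"
proof (intro equalityI subsetI)
  fix P assume P: "P \<in> zeros F \<inter> zeros G"
  then obtain x y where "P = (pt x, pt y)" "x \<noteq> 0" "y \<noteq> 0" "F x y = 0" unfolding zeros_def by blast
  then show "P \<in> {(pt x, pt y) | x y. x \<noteq> 0 \<and> y \<noteq> 0 \<and> F x y = 0 \<and> G x y = 0}"
    using P in_zeros_iff[OF assms(2)] by blast
qed (auto simp: zeros_def)

lemma not_zero_2: "(x :: complex^2) \<noteq> 0 \<longleftrightarrow> x $ 1 \<noteq> 0 \<or> x $ 2 \<noteq> 0"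
  by (simp add: vec2_eq_iff)

lemma pt_eq_origin: "x \<noteq> 0 \<Longrightarrow> pt x = pt (vector [0, 1]) \<longleftrightarrow> x $ 1 = 0" for x :: "complex^2"
  using pt2_eq_iff[of x "vector [0, 1]"] by (simp add: not_zero_2)

lemma pt_eq_infinity: "x \<noteq> 0 \<Longrightarrow> pt x = pt (vector [1, 0]) \<longleftrightarrow> x $ 2 = 0" for x :: "complex^2"
  using pt2_eq_iff[of x "vector [1, 0]"] by (auto simp: not_zero_2)

lemma biform_1_0_coordinate: "biform 1 0 (\<lambda>x y. x $ 1)"
  unfolding biform_def by (rule exI[of _ "\<lambda>i j. if i = 1 then 1 else 0"]) simp

lemma biform_0_1_coordinate: "biform 0 1 (\<lambda>x y. y $ 1)"
  unfolding biform_def by (rule exI[of _ "\<lambda>i j. if j = 1 then 1 else 0"]) simp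

lemma irreducible_left_coordinate: "irreducible_biform 1 0 (\<lambda>x y. x $ 1)"
  by (rule irreducible_biform_degree_one[OF biform_1_0_coordinate, of "vector [1, 0]"]) simp_all

lemma irreducible_right_coordinate: "irreducible_biform 0 1 (\<lambda>x y. y $ 1)"
  by (rule irreducible_biform_degree_one[OF biform_0_1_coordinate, of "vector [1, 0]"]) simp_all

lemma irreducible_biform_1_1:
  fixes F :: "complex^2 \<Rightarrow> complex^2 \<Rightarrow> complex"
  assumes F: "\<And>x y. F x y = a * x $ 1 * y $ 1 + b * x $ 1 * y $ 2 + c * x $ 2 * y $ 1 + d * x $ 2 * y $ 2"
    and det: "a * d - b * c \<noteq> 0"
  shows "irreducible_biform 1 1 F"
proof (rule irreducible_biform_no_line)
  show "biform 1 1 F" unfolding biform_def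
    by (rule exI[of _ "\<lambda>i j. if i = 1 then if j = 1 then a else b else if j = 1 then c else d"])
      (simp add: F algebra_simps)
  fix x :: "complex^2" assume x: "x \<noteq> 0"
  show "\<exists>y. F x y \<noteq> 0"
  proof (rule ccontr)
    assume "\<nexists>y. F x y \<noteq> 0"
    then have "F x (vector [1, 0]) = 0" "F x (vector [0, 1]) = 0" by auto
    then have e: "a * x $ 1 + c * x $ 2 = 0" "b * x $ 1 + d * x $ 2 = 0" unfolding F by simp_all
    have "(a * d - b * c) * x $ 1 = 0" "(a * d - b * c) * x $ 2 = 0" using e by algebra+
    then show False using det x by (simp add: not_zero_2)
  qed
  show "\<exists>y. F y x \<noteq> 0"
  proof (rule ccontr)
    assume "\<nexists>y. F y x \<noteq> 0"
    then have "F (vector [1, 0]) x = 0" "F (vector [0, 1]) x = 0" by auto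
    then have e: "a * x $ 1 + b * x $ 2 = 0" "c * x $ 1 + d * x $ 2 = 0" unfolding F by simp_all
    have "(a * d - b * c) * x $ 1 = 0" "(a * d - b * c) * x $ 2 = 0" using e by algebra+
    then show False using det x by (simp add: not_zero_2)
  qed
qed simp

lemma irreducible_biform_2_1:
  fixes F :: "complex^2 \<Rightarrow> complex^2 \<Rightarrow> complex"
  assumes F: "\<And>x y. F x y = (x $ 1)\<^sup>2 * y $ 2 - (x $ 2)\<^sup>2 * (y $ 1 + k * y $ 2)"
  shows "irreducible_biform 2 1 F"
proof (rule irreducible_biform_no_line)
  show "biform 2 1 F" unfolding biform_def
    by (rule exI[of _ "\<lambda>i j. if i = 2 \<and> j = 0 then 1 else if i = 0 \<and> j = 1 then - 1 else if i = 0 then - k else 0"])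
      (simp add: F numeral_2_eq_2 atMost_Suc algebra_simps)
  fix x :: "complex^2" assume x: "x \<noteq> 0"
  show "\<exists>y. F x y \<noteq> 0"
  proof (rule ccontr)
    assume "\<nexists>y. F x y \<noteq> 0"
    then have "F x (vector [1, 0]) = 0" "F x (vector [0, 1]) = 0" by auto
    then show False using x unfolding F by (simp add: not_zero_2)
  qed
  show "\<exists>y. F y x \<noteq> 0"
  proof (rule ccontr)
    assume "\<nexists>y. F y x \<noteq> 0"
    then have "F (vector [1, 0]) x = 0" "F (vector [0, 1]) x = 0" by auto
    then show False using x unfolding F by (simp add: not_zero_2)
  qed
qed simp

lemma edge_curve_11_11: "occurs_as_edge_curve type_11_11"
proof (rule occurs_as_edge_curveI)
  let ?G = "\<lambda>(x::complex^2) (y::complex^2). x $ 1 * y $ 2 - x $ 2 * y $ 1"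
  let ?H = "\<lambda>(x::complex^2) (y::complex^2). x $ 1 * y $ 2 + x $ 2 * y $ 1"
  show "independent_pair (vector [1, 0, 0]) (vector [0, 0, 1] :: complex^3)"
    "independent_pair (vector [1, 0, 0]) (vector [0, 0, 1] :: complex^3)"
    by (simp_all add: independent_pair_def vec3_eq_iff)
  show "(?G * ?H) x y = edge_form (vector [1, 0, 0]) (vector [0, 0, 1]) (vector [1, 0, 0]) (vector [0, 0, 1]) x y" for x y
    by (simp add: edge_form_def quad_def power2_eq_square algebra_simps)
  have G: "irreducible_biform 1 1 ?G" by (rule irreducible_biform_1_1[of _ 0 1 "- 1" 0]) simp_all
  have H: "irreducible_biform 1 1 ?H" by (rule irreducible_biform_1_1[of _ 0 1 1 0]) simp_all
  have "(pt (vector [1, 1]), pt (vector [1, 1])) \<in> zeros ?G"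
    "(pt (vector [1, 1]), pt (vector [1, 1])) \<notin> zeros ?H"
    using G H unfolding irreducible_biform_def by (simp_all add: in_zeros_iff[of 1 1] not_zero_2)
  then have "zeros ?G \<noteq> zeros ?H" by blast
  then show "type_11_11 (?G * ?H)" unfolding type_11_11_def using G H by blast
qed

lemma edge_curve_21_01_secant: "occurs_as_edge_curve type_21_01_secant"
proof (rule occurs_as_edge_curveI)
  let ?G = "\<lambda>(x::complex^2) (y::complex^2). (x $ 1)\<^sup>2 * y $ 2 - (x $ 2)\<^sup>2 * (y $ 1 + y $ 2)"
  let ?H = "\<lambda>(x::complex^2) (y::complex^2). y $ 1"
  show "independent_pair (vector [1, 0, 0]) (vector [0, 0, 1] :: complex^3)"
    "independent_pair (vector [1, 1, 0]) (vector [0, 1, 0] :: complex^3)"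
    by (simp_all add: independent_pair_def vec3_eq_iff)
  show "(?G * ?H) x y = edge_form (vector [1, 0, 0]) (vector [0, 0, 1]) (vector [1, 1, 0]) (vector [0, 1, 0]) x y" for x y
    by (simp add: edge_form_def quad_def power2_eq_square algebra_simps)
  have G: "irreducible_biform 2 1 ?G" by (rule irreducible_biform_2_1[of _ 1]) simp
  then have bG: "biform 2 1 ?G" unfolding irreducible_biform_def by blast
  let ?P = "\<lambda>t. (pt (vector [t, 1] :: complex^2), pt (vector [0, 1] :: complex^2))"
  have "zeros ?G \<inter> zeros ?H = {?P 1, ?P (- 1)}"
  proof (intro equalityI subsetI)
    fix P assume "P \<in> zeros ?G \<inter> zeros ?H"
    then obtain x y where P: "P = (pt x, pt y)" and xy: "x \<noteq> 0" "y \<noteq> 0" "?G x y = 0" "y $ 1 = 0"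
      unfolding zeros_Int[OF bG biform_0_1_coordinate] by blast
    then have y: "y $ 2 \<noteq> 0" "pt y = pt (vector [0, 1])" by (simp_all add: not_zero_2 pt_eq_origin)
    have "y $ 2 * ((x $ 1 - x $ 2) * (x $ 1 + x $ 2)) = 0"
      using xy(3,4) by (simp add: power2_eq_square algebra_simps)
    then have "x $ 1 = x $ 2 \<or> x $ 1 = - x $ 2" using y(1) by (simp add: eq_neg_iff_add_eq_0)
    then have "pt x = pt (vector [1, 1]) \<or> pt x = pt (vector [- 1, 1])"
      using xy(1) by (subst (1 2) pt2_eq_iff) (auto simp: not_zero_2)
    then show "P \<in> {?P 1, ?P (- 1)}" using P y(2) by auto
  next
    fix P assume "P \<in> {?P 1, ?P (- 1)}"
    then show "P \<in> zeros ?G \<inter> zeros ?H"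
      by (auto simp: in_zeros_iff[OF bG] in_zeros_iff[OF biform_0_1_coordinate] not_zero_2)
  qed
  moreover have "?P 1 \<noteq> ?P (- 1)" by (simp add: pt2_eq_iff not_zero_2)
  ultimately have "card (zeros ?G \<inter> zeros ?H) = 2" by simp
  then show "type_21_01_secant (?G * ?H)"
    unfolding type_21_01_secant_def using G irreducible_right_coordinate by blast
qed

lemma edge_curve_21_01_tangent: "occurs_as_edge_curve type_21_01_tangent"
proof (rule occurs_as_edge_curveI)
  let ?G = "\<lambda>(x::complex^2) (y::complex^2). (x $ 1)\<^sup>2 * y $ 2 - (x $ 2)\<^sup>2 * y $ 1"
  let ?H = "\<lambda>(x::complex^2) (y::complex^2). y $ 1"
  show "independent_pair (vector [1, 0, 0]) (vector [0, 0, 1] :: complex^3)"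
    "independent_pair (vector [1, 0, 0]) (vector [0, 1, 0] :: complex^3)"
    by (simp_all add: independent_pair_def vec3_eq_iff)
  show "(?G * ?H) x y = edge_form (vector [1, 0, 0]) (vector [0, 0, 1]) (vector [1, 0, 0]) (vector [0, 1, 0]) x y" for x y
    by (simp add: edge_form_def quad_def power2_eq_square algebra_simps)
  have G: "irreducible_biform 2 1 ?G" by (rule irreducible_biform_2_1[of _ 0]) simp
  then have bG: "biform 2 1 ?G" unfolding irreducible_biform_def by blast
  let ?o = "vector [0, 1] :: complex^2" and ?v = "vector [1, 0] :: complex^2"
  have "zeros ?G \<inter> zeros ?H = {(pt ?o, pt ?o)}"
  proof (intro equalityI subsetI)
    fix P assume "P \<in> zeros ?G \<inter> zeros ?H"
    then obtain x y where P: "P = (pt x, pt y)" and xy: "x \<noteq> 0" "y \<noteq> 0" "?G x y = 0" "y $ 1 = 0"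
      unfolding zeros_Int[OF bG biform_0_1_coordinate] by blast
    then have "x $ 1 = 0" by (simp add: not_zero_2)
    then show "P \<in> {(pt ?o, pt ?o)}" using P xy by (simp add: pt_eq_origin)
  next
    fix P assume "P \<in> {(pt ?o, pt ?o)}"
    then show "P \<in> zeros ?G \<inter> zeros ?H"
      by (auto simp: in_zeros_iff[OF bG] in_zeros_iff[OF biform_0_1_coordinate] not_zero_2)
  qed
  moreover have "tangent_at ?G ?H (pt ?o, pt ?o)"
  proof -
    let ?g = "[:[:0, - 1:], 0, 1:] :: complex poly poly" and ?h = "[:[:0, 1:]:] :: complex poly poly"
    have "local_equation ?G ?o ?v ?o ?v ?g"
      by (auto simp: local_equation_def vec2_eq_iff mem_pt power2_eq_square)
    moreover have "local_equation ?H ?o ?v ?o ?v ?h"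
      by (auto simp: local_equation_def vec2_eq_iff mem_pt)
    ultimately show ?thesis
      unfolding tangent_at_def
      by (intro exI[of _ ?o] exI[of _ ?v] exI[of _ ?g] exI[of _ ?h] conjI) simp_all
  qed
  ultimately show "type_21_01_tangent (?G * ?H)"
    unfolding type_21_01_tangent_def using G irreducible_right_coordinate by blast
qed

lemma edge_curve_11_01_10_triangle: "occurs_as_edge_curve type_11_01_10_triangle"
proof (rule occurs_as_edge_curveI)
  let ?G = "\<lambda>(x::complex^2) (y::complex^2). x $ 1 * y $ 1 - x $ 2 * y $ 2"
  let ?H = "\<lambda>(x::complex^2) (y::complex^2). y $ 1" and ?K = "\<lambda>(x::complex^2) (y::complex^2). x $ 1"
  show "independent_pair (vector [1, 0, 0]) (vector [0, 1, 0] :: complex^3)"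
    "independent_pair (vector [0, 1, 0]) (vector [1, 0, 0] :: complex^3)"
    by (simp_all add: independent_pair_def vec3_eq_iff)
  show "(?G * ?H * ?K) x y = edge_form (vector [1, 0, 0]) (vector [0, 1, 0]) (vector [0, 1, 0]) (vector [1, 0, 0]) x y" for x y
    by (simp add: edge_form_def quad_def power2_eq_square algebra_simps)
  have G: "irreducible_biform 1 1 ?G" by (rule irreducible_biform_1_1[of _ 1 0 0 "- 1"]) simp_all
  then have bG: "biform 1 1 ?G" unfolding irreducible_biform_def by blast
  let ?o = "vector [0, 1] :: complex^2" and ?i = "vector [1, 0] :: complex^2"
  have nz: "?o \<noteq> 0" "?i \<noteq> 0" by (simp_all add: not_zero_2)
  have single: "zeros F \<inter> zeros F' = {(pt p, pt q)}"
    if "biform a b F" "biform a' b' F'" "p \<noteq> 0" "q \<noteq> 0"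
      "\<And>x y. x \<noteq> 0 \<Longrightarrow> y \<noteq> 0 \<Longrightarrow> F x y = 0 \<and> F' x y = 0 \<longleftrightarrow> pt x = pt p \<and> pt y = pt q" for F F' a b a' b' p q
    unfolding zeros_Int[OF that(1,2)] using that(3-5) by blast
  have 1: "zeros ?G \<inter> zeros ?H = {(pt ?i, pt ?o)}"
    by (rule single[OF bG biform_0_1_coordinate nz(2,1)]) (auto simp: pt_eq_origin pt_eq_infinity not_zero_2)
  have 2: "zeros ?G \<inter> zeros ?K = {(pt ?o, pt ?i)}"
    by (rule single[OF bG biform_1_0_coordinate nz]) (auto simp: pt_eq_origin pt_eq_infinity not_zero_2)
  have 3: "zeros ?H \<inter> zeros ?K = {(pt ?o, pt ?o)}"
    by (rule single[OF biform_0_1_coordinate biform_1_0_coordinate nz(1,1)]) (auto simp: pt_eq_origin)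
  have "pt ?o \<noteq> pt ?i" using nz by (simp add: pt_eq_infinity)
  then have "distinct [(pt ?i, pt ?o), (pt ?o, pt ?i), (pt ?o, pt ?o)]" by auto
  then show "type_11_01_10_triangle (?G * ?H * ?K)"
    unfolding type_11_01_10_triangle_def using G irreducible_right_coordinate irreducible_left_coordinate 1 2 3
    by blast
qed

lemma edge_curve_11_01_10_concurrent: "occurs_as_edge_curve type_11_01_10_concurrent"
proof (rule occurs_as_edge_curveI)
  let ?G = "\<lambda>(x::complex^2) (y::complex^2). x $ 1 * y $ 2 - x $ 2 * y $ 1"
  let ?H = "\<lambda>(x::complex^2) (y::complex^2). y $ 1" and ?K = "\<lambda>(x::complex^2) (y::complex^2). x $ 1"
  show "independent_pair (vector [1, 0, 0]) (vector [0, 1, 0] :: complex^3)"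
    "independent_pair (vector [1, 0, 0]) (vector [0, 1, 0] :: complex^3)"
    by (simp_all add: independent_pair_def vec3_eq_iff)
  show "(?G * ?H * ?K) x y = edge_form (vector [1, 0, 0]) (vector [0, 1, 0]) (vector [1, 0, 0]) (vector [0, 1, 0]) x y" for x y
    by (simp add: edge_form_def quad_def power2_eq_square algebra_simps)
  have G: "irreducible_biform 1 1 ?G" by (rule irreducible_biform_1_1[of _ 0 1 "- 1" 0]) simp_all
  then have bG: "biform 1 1 ?G" unfolding irreducible_biform_def by blast
  let ?o = "vector [0, 1] :: complex^2"
  have "?o \<noteq> 0" by (simp add: not_zero_2)
  then have "(pt ?o, pt ?o) \<in> zeros ?G \<inter> zeros ?H \<inter> zeros ?K"
    by (simp add: in_zeros_iff[OF bG] in_zeros_iff[OF biform_0_1_coordinate] in_zeros_iff[OF biform_1_0_coordinate])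
  then show "type_11_01_10_concurrent (?G * ?H * ?K)"
    unfolding type_11_01_10_concurrent_def using G irreducible_right_coordinate irreducible_left_coordinate
    by blast
qed


section \<open>The nodal curve\<close>

text \<open>In affine coordinates this is the hyperbola \<open>u\<^sup>2 - v\<^sup>2 = 1\<close>.\<close>

definition hyperbola :: "complex^2 \<Rightarrow> complex^2 \<Rightarrow> complex" where
  "hyperbola x y = (x $ 1)\<^sup>2 * (y $ 2)\<^sup>2 - (x $ 2)\<^sup>2 * ((y $ 1)\<^sup>2 + (y $ 2)\<^sup>2)"

lemma hyperbola_edge_form:
  "hyperbola x y = edge_form (vector [1, 0, 0]) (vector [0, 0, 1]) (vector [1, 0, 1]) (vector [0, 0, 1]) x y"
  by (simp add: hyperbola_def edge_form_def quad_def algebra_simps)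

lemma biform_hyperbola: "biform 2 2 hyperbola"
  using biform_edge_form hyperbola_edge_form by presburger

text \<open>No line is contained in the curve, so a factorization would be into two forms of bidegree \<open>(1,1)\<close>.
  Over a root of \<open>v\<^sup>2 = - 1\<close> the equation \<open>u\<^sup>2 = v\<^sup>2 + 1\<close> has the double root \<open>u = 0\<close>, so the first factor
  vanishes there; being linear in \<open>v\<close>, its value at \<open>u = 0\<close> then vanishes identically, but at
  \<open>v = 0\<close> the product is \<open>- 1\<close>.\<close>

lemma irreducible_hyperbola: "irreducible_biform 2 2 hyperbola"
  unfolding irreducible_biform_def
proof (intro conjI allI impI biform_hyperbola)
  have "hyperbola (vector [1, 0]) (vector [0, 1]) \<noteq> 0" by (simp add: hyperbola_def)
  then show nz: "\<exists>x y. hyperbola x y \<noteq> 0" by blast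
  have lines: "\<exists>y. hyperbola x y \<noteq> 0" "\<exists>y. hyperbola y x \<noteq> 0" if "x \<noteq> 0" for x
  proof -
    have "hyperbola x (vector [1, 0]) \<noteq> 0 \<or> hyperbola x (vector [0, 1]) \<noteq> 0"
      using that by (auto simp: hyperbola_def not_zero_2)
    then show "\<exists>y. hyperbola x y \<noteq> 0" by blast
    have "hyperbola (vector [1, 0]) x \<noteq> 0 \<or> hyperbola (vector [0, 1]) x \<noteq> 0"
      using that by (auto simp: hyperbola_def not_zero_2)
    then show "\<exists>y. hyperbola y x \<noteq> 0" by blast
  qed
  fix a1 b1 a2 b2 G H
  assume h: "biform a1 b1 G \<and> biform a2 b2 H \<and> hyperbola = G * H"
  then have sum: "a1 + a2 = 2 \<and> b1 + b2 = 2" using factor_degrees biform_hyperbola nz by blast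
  show "(a1, b1) = (0, 0) \<or> (a2, b2) = (0, 0)"
  proof (rule ccontr)
    assume ne: "\<not> ((a1, b1) = (0, 0) \<or> (a2, b2) = (0, 0))"
    have "hyperbola = H * G" using h by (simp add: mult.commute)
    then have "a1 > 0 \<and> b1 > 0" "a2 > 0 \<and> b2 > 0"
      using no_line_imp_factor_degrees_positive[OF lines] h ne by blast+
    then have "a1 = 1" "b1 = 1" "a2 = 1" "b2 = 1" using sum by auto
    then have bi: "biform 1 1 G" "biform 1 1 H" using h by auto
    obtain c where c: "\<And>x y. G x y = (\<Sum>i\<le>1. \<Sum>j\<le>1. c i j * x $ 1 ^ i * x $ 2 ^ (1 - i) * y $ 1 ^ j * y $ 2 ^ (1 - j))"
      using bi(1) unfolding biform_def by blast
    obtain d where d: "\<And>x y. H x y = (\<Sum>i\<le>1. \<Sum>j\<le>1. d i j * x $ 1 ^ i * x $ 2 ^ (1 - i) * y $ 1 ^ j * y $ 2 ^ (1 - j))"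
      using bi(2) unfolding biform_def by blast
    have prod: "(c 0 0 + c 0 1 * v + c 1 0 * u + c 1 1 * u * v) * (d 0 0 + d 0 1 * v + d 1 0 * u + d 1 1 * u * v)
      = u\<^sup>2 - v\<^sup>2 - 1" for u v
    proof -
      have "hyperbola (vector [u, 1]) (vector [v, 1]) = G (vector [u, 1]) (vector [v, 1]) * H (vector [u, 1]) (vector [v, 1])"
      proof -
        have "hyperbola = G * H" using h by blast
        then have "hyperbola x y = (G * H) x y" for x y by (rule fun_cong[OF fun_cong])
        then show ?thesis unfolding times_fun_apply by blast
      qed
      then show ?thesis unfolding c d hyperbola_def by (simp add: algebra_simps)
    qed
    have sq: "(c 0 0 + c 0 1 * v)\<^sup>2 * (d 1 0 + d 1 1 * v)\<^sup>2 = v\<^sup>2 + 1"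
      and unit: "(c 1 0 + c 1 1 * v) * (d 1 0 + d 1 1 * v) = 1" for v
    proof -
      define A B C D where "A = c 0 0 + c 0 1 * v" and "B = d 0 0 + d 0 1 * v"
        and "C = c 1 0 + c 1 1 * v" and "D = d 1 0 + d 1 1 * v"
      have *: "(A + C * u) * (B + D * u) = u\<^sup>2 - v\<^sup>2 - 1" for u
        using prod[of v u] unfolding A_def B_def C_def D_def by (simp add: algebra_simps)
      have AB: "A * B = - (v\<^sup>2 + 1)" using *[of 0] by simp
      have p: "A * B + C * D + (A * D + B * C) = - v\<^sup>2" "A * B + C * D - (A * D + B * C) = - v\<^sup>2"
        using *[of 1] *[of "- 1"] by (simp_all add: algebra_simps)
      have "2 * (A * D + B * C) = 0" using p by algebra
      then have AD: "A * D + B * C = 0" by (simp only: mult_eq_0_iff) simp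
      then have CD: "C * D = 1" using p(1) AB by (simp add: algebra_simps)
      show "C * D = 1" by (rule CD)
      show "A\<^sup>2 * D\<^sup>2 = v\<^sup>2 + 1" using AB AD CD by algebra
    qed
    have "c 0 0 + c 0 1 * v = 0" if "v\<^sup>2 = - 1" for v
      using sq[of v] unit[of v] that by auto
    from this[of \<i>] this[of "- \<i>"] have "c 0 0 = 0" by (simp add: add_eq_0_iff)
    then show False using sq[of 0] by simp
  qed
qed simp


text \<open>The factorization \<open>(u - v) (u + v) = 1\<close> gives the parameter \<open>t = u + v\<close> with inverse
  \<open>u = (t\<^sup>2 + 1) / 2 t\<close>, \<open>v = (t\<^sup>2 - 1) / 2 t\<close>; the exceptions are \<open>t = 0, \<infinity>\<close> and the node.\<close>

lemma rational_hyperbola: "rational_curve (zeros hyperbola)"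
proof -
  define f g :: "complex^2 \<Rightarrow> complex^2" where
    "f z = vector [(z $ 1)\<^sup>2 + (z $ 2)\<^sup>2, 2 * (z $ 1 * z $ 2)]" and
    "g z = vector [(z $ 1)\<^sup>2 - (z $ 2)\<^sup>2, 2 * (z $ 1 * z $ 2)]" for z
  define r :: "complex^2 \<Rightarrow> complex^2 \<Rightarrow> complex^2" where
    "r x y = vector [x $ 1 * y $ 2 + x $ 2 * y $ 1, x $ 2 * y $ 2]" for x y
  have bf: "binary_form 2 (\<lambda>z. f z $ k)" for k
  proof -
    have "binary_form 2 (\<lambda>z. (z $ 1)\<^sup>2 + (z $ 2)\<^sup>2)" "binary_form 2 (\<lambda>z. 2 * (z $ 1 * z $ 2))"
      unfolding binary_form_def
      by (rule exI[of _ "\<lambda>i. if i = 1 then 0 else 1"], simp add: numeral_2_eq_2 atMost_Suc)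
        (rule exI[of _ "\<lambda>i. if i = 1 then 2 else 0"], simp add: numeral_2_eq_2 atMost_Suc)
    then show ?thesis using exhaust_2[of k] by (auto simp: f_def)
  qed
  have bg: "binary_form 2 (\<lambda>z. g z $ k)" for k
  proof -
    have "binary_form 2 (\<lambda>z. (z $ 1)\<^sup>2 - (z $ 2)\<^sup>2)" "binary_form 2 (\<lambda>z. 2 * (z $ 1 * z $ 2))"
      unfolding binary_form_def
      by (rule exI[of _ "\<lambda>i. if i = 1 then 0 else if i = 0 then - 1 else 1"], simp add: numeral_2_eq_2 atMost_Suc)
        (rule exI[of _ "\<lambda>i. if i = 1 then 2 else 0"], simp add: numeral_2_eq_2 atMost_Suc)
    then show ?thesis using exhaust_2[of k] by (auto simp: g_def)
  qed
  have br: "biform 1 1 (\<lambda>x y. r x y $ k)" for k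
  proof -
    have "biform 1 1 (\<lambda>x y. x $ 1 * y $ 2 + x $ 2 * y $ 1)" "biform 1 1 (\<lambda>x y. x $ 2 * y $ 2)"
      unfolding biform_def
      by (rule exI[of _ "\<lambda>i j. if i = j then 0 else 1"], simp)
        (rule exI[of _ "\<lambda>i j. if i = 0 \<and> j = 0 then 1 else 0"], simp)
    then show ?thesis using exhaust_2[of k] by (auto simp: r_def)
  qed
  let ?o = "vector [0, 1] :: complex^2" and ?i = "vector [1, 0] :: complex^2"
  have "{pt z | z. z \<noteq> 0 \<and> \<not> (f z \<noteq> 0 \<and> g z \<noteq> 0 \<and> (pt (f z), pt (g z)) \<in> zeros hyperbola \<and>
      r (f z) (g z) \<noteq> 0 \<and> pt (r (f z) (g z)) = pt z)} \<subseteq> {pt ?o, pt ?i}"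
  proof (rule subsetI, rule ccontr)
    fix P assume P: "P \<in> {pt z | z. z \<noteq> 0 \<and> \<not> (f z \<noteq> 0 \<and> g z \<noteq> 0 \<and> (pt (f z), pt (g z)) \<in> zeros hyperbola \<and>
      r (f z) (g z) \<noteq> 0 \<and> pt (r (f z) (g z)) = pt z)}" "P \<notin> {pt ?o, pt ?i}"
    then obtain z where z: "z \<noteq> 0" "pt z \<noteq> pt ?o" "pt z \<noteq> pt ?i"
      "\<not> (f z \<noteq> 0 \<and> g z \<noteq> 0 \<and> (pt (f z), pt (g z)) \<in> zeros hyperbola \<and>
      r (f z) (g z) \<noteq> 0 \<and> pt (r (f z) (g z)) = pt z)" by blast
    have z12: "z $ 1 \<noteq> 0" "z $ 2 \<noteq> 0" using z(1-3) by (simp_all add: pt_eq_origin pt_eq_infinity)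
    then have nz: "f z \<noteq> 0" "g z \<noteq> 0" by (simp_all add: not_zero_2 f_def g_def)
    have "hyperbola (f z) (g z) = 0"
      by (simp add: hyperbola_def f_def g_def power2_eq_square algebra_simps)
    then have on: "(pt (f z), pt (g z)) \<in> zeros hyperbola"
      using in_zeros_iff[OF biform_hyperbola nz] by blast
    have "r (f z) (g z) = (4 * (z $ 1)\<^sup>2 * z $ 2) *s z"
      by (simp add: r_def f_def g_def vec2_eq_iff power2_eq_square algebra_simps)
    then have "r (f z) (g z) \<noteq> 0" "pt (r (f z) (g z)) = pt z"
      using z(1) z12 pt_scale[of "4 * (z $ 1)\<^sup>2 * z $ 2" z] by simp_all
    then show False using z(4) nz on by blast
  qed
  then have fin1: "finite {pt z | z. z \<noteq> 0 \<and> \<not> (f z \<noteq> 0 \<and> g z \<noteq> 0 \<and> (pt (f z), pt (g z)) \<in> zeros hyperbola \<and>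
      r (f z) (g z) \<noteq> 0 \<and> pt (r (f z) (g z)) = pt z)}" by (rule finite_subset) simp
  have "{(pt x, pt y) | x y. x \<noteq> 0 \<and> y \<noteq> 0 \<and> (pt x, pt y) \<in> zeros hyperbola \<and>
      \<not> (r x y \<noteq> 0 \<and> f (r x y) \<noteq> 0 \<and> g (r x y) \<noteq> 0 \<and> pt (f (r x y)) = pt x \<and> pt (g (r x y)) = pt y)}
      \<subseteq> {(pt ?i, pt ?i)}"
  proof (rule subsetI, rule ccontr)
    fix P assume P: "P \<in> {(pt x, pt y) | x y. x \<noteq> 0 \<and> y \<noteq> 0 \<and> (pt x, pt y) \<in> zeros hyperbola \<and>
      \<not> (r x y \<noteq> 0 \<and> f (r x y) \<noteq> 0 \<and> g (r x y) \<noteq> 0 \<and> pt (f (r x y)) = pt x \<and> pt (g (r x y)) = pt y)}"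
      "P \<notin> {(pt ?i, pt ?i)}"
    then obtain x y where xy: "x \<noteq> 0" "y \<noteq> 0" "(pt x, pt y) \<in> zeros hyperbola" "(pt x, pt y) \<noteq> (pt ?i, pt ?i)"
      "\<not> (r x y \<noteq> 0 \<and> f (r x y) \<noteq> 0 \<and> g (r x y) \<noteq> 0 \<and> pt (f (r x y)) = pt x \<and> pt (g (r x y)) = pt y)"
      by blast
    have E: "hyperbola x y = 0" using xy(3) in_zeros_iff[OF biform_hyperbola xy(1,2)] by blast
    have x2: "x $ 2 \<noteq> 0" and y2: "y $ 2 \<noteq> 0"
      using xy(1,2,4) E by (auto simp: hyperbola_def pt_eq_infinity not_zero_2)
    define s where "s = x $ 1 * y $ 2 + x $ 2 * y $ 1"
    have fact: "(x $ 1 * y $ 2 - x $ 2 * y $ 1) * s = (x $ 2 * y $ 2)\<^sup>2"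
      using E unfolding s_def hyperbola_def by algebra
    then have s: "s \<noteq> 0" using x2 y2 by auto
    have r: "r x y = vector [s, x $ 2 * y $ 2]" by (simp add: r_def s_def)
    have "f (r x y) = (2 * s * y $ 2) *s x"
    proof -
      have "s\<^sup>2 + (x $ 2 * y $ 2)\<^sup>2 = 2 * s * y $ 2 * x $ 1" using fact s_def by algebra
      then show ?thesis by (simp add: f_def r vec2_eq_iff)
    qed
    moreover have "g (r x y) = (2 * s * x $ 2) *s y"
    proof -
      have "s\<^sup>2 - (x $ 2 * y $ 2)\<^sup>2 = 2 * s * x $ 2 * y $ 1" using fact s_def by algebra
      then show ?thesis by (simp add: g_def r vec2_eq_iff)
    qed
    moreover have "r x y \<noteq> 0" using s by (simp add: r not_zero_2)
    ultimately show False using xy(1,2,5) s x2 y2 by (simp add: pt_scale)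
  qed
  then have fin2: "finite {(pt x, pt y) | x y. x \<noteq> 0 \<and> y \<noteq> 0 \<and> (pt x, pt y) \<in> zeros hyperbola \<and>
      \<not> (r x y \<noteq> 0 \<and> f (r x y) \<noteq> 0 \<and> g (r x y) \<noteq> 0 \<and> pt (f (r x y)) = pt x \<and> pt (g (r x y)) = pt y)}"
    by (rule finite_subset) simp
  show ?thesis unfolding rational_curve_def
    by (intro exI[of _ 2] exI[of _ 1] exI[of _ f] exI[of _ g] exI[of _ r] conjI allI)
      (rule bf bg br fin1 fin2)+
qed

lemma node_hyperbola: "node_at hyperbola (pt (vector [1, 0]), pt (vector [1, 0]))"
proof -
  let ?i = "vector [1, 0] :: complex^2" and ?v = "vector [0, 1] :: complex^2"
  let ?f = "[:[:0, 0, 1:], 0, [:- 1, 0, - 1:]:] :: complex poly poly"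
  have "local_equation hyperbola ?i ?v ?i ?v ?f"
    by (auto simp: local_equation_def hyperbola_def vec2_eq_iff mem_pt power2_eq_square algebra_simps)
  then show ?thesis unfolding node_at_def
    by (intro exI[of _ ?i] exI[of _ ?v] exI[of _ ?f] conjI) (simp_all add: numeral_2_eq_2)
qed

lemma edge_curve_node: "occurs_as_edge_curve type_node"
proof (rule occurs_as_edge_curveI)
  show "independent_pair (vector [1, 0, 0]) (vector [0, 0, 1] :: complex^3)"
    "independent_pair (vector [1, 0, 1]) (vector [0, 0, 1] :: complex^3)"
    by (simp_all add: independent_pair_def vec3_eq_iff)
  show "hyperbola x y = edge_form (vector [1, 0, 0]) (vector [0, 0, 1]) (vector [1, 0, 1]) (vector [0, 0, 1]) x y" for x y
    by (rule hyperbola_edge_form)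
  let ?i = "vector [1, 0] :: complex^2"
  have "(pt ?i, pt ?i) \<in> zeros hyperbola"
    by (simp add: in_zeros_iff[OF biform_hyperbola] not_zero_2 hyperbola_def)
  then show "type_node hyperbola"
    unfolding type_node_def using irreducible_hyperbola rational_hyperbola node_hyperbola by blast
qed

section \<open>The smooth curve\<close>

text \<open>In affine coordinates this is \<open>u\<^sup>2 v = v\<^sup>2 - 1\<close>.\<close>

definition smooth_form :: "complex^2 \<Rightarrow> complex^2 \<Rightarrow> complex" where
  "smooth_form x y = (x $ 1)\<^sup>2 * (y $ 1 * y $ 2) - (x $ 2)\<^sup>2 * ((y $ 1)\<^sup>2 - (y $ 2)\<^sup>2)"

lemma smooth_form_edge_form:
  "smooth_form x y = edge_form (vector [1, 0, 0]) (vector [0, 0, 1]) (vector [1, 0, - 1]) (vector [0, 1, 0]) x y"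
  by (simp add: smooth_form_def edge_form_def quad_def algebra_simps)

lemma biform_smooth_form: "biform 2 2 smooth_form"
  using biform_edge_form smooth_form_edge_form by presburger

lemma point_cases:
  fixes x :: "complex^2"
  assumes "x \<noteq> 0"
  obtains "pt x = pt (vector [1, 0])" | u where "pt x = pt (vector [u, 1])"
proof (cases "x $ 2 = 0")
  case True
  then show thesis using that(1) assms pt_eq_infinity by blast
next
  case False
  then have "pt x = pt (vector [x $ 1 / x $ 2, 1])"
    using assms by (subst pt2_eq_iff) (simp_all add: not_zero_2)
  then show thesis by (rule that(2))
qed

lemma smooth_atI:
  assumes "local_equation F x w y z f" "coeff2 f 0 0 = 0" "coeff2 f 1 0 \<noteq> 0 \<or> coeff2 f 0 1 \<noteq> 0"
  shows "smooth_at F (pt x, pt y)"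
  using assms unfolding smooth_at_def by blast

lemma smooth_form_smooth_at:
  assumes "P \<in> zeros smooth_form"
  shows "smooth_at smooth_form P"
proof -
  obtain x y where P: "P = (pt x, pt y)" and xy: "x \<noteq> 0" "y \<noteq> 0"
    using assms unfolding zeros_def by blast
  let ?i = "vector [1, 0] :: complex^2" and ?o = "vector [0, 1] :: complex^2"
  have nz: "?i \<noteq> 0" "vector [u, 1] \<noteq> (0 :: complex^2)" for u by (simp_all add: not_zero_2)
  have val: "smooth_form x' y' = 0" if "P = (pt x', pt y')" "x' \<noteq> 0" "y' \<noteq> 0" for x' y'
    using assms in_zeros_iff[OF biform_smooth_form that(2,3)] unfolding that(1) by blast
  have far: "?o \<notin> pt ?i" "?i \<notin> pt (vector [u, 1])" for u by (auto simp: mem_pt vec2_eq_iff)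
  show ?thesis
  proof (cases rule: point_cases[OF xy(1)])
    case x: 1
    show ?thesis
    proof (cases rule: point_cases[OF xy(2)])
      case y: 1
      have "local_equation smooth_form ?i ?o ?i ?o [:[:0, 1:], 0, [:- 1, 0, 1:]:]"
        using nz far by (simp add: local_equation_def smooth_form_def power2_eq_square algebra_simps)
      then show ?thesis unfolding P x y by (rule smooth_atI) simp_all
    next
      case y: (2 v)
      have "smooth_form ?i (vector [v, 1]) = 0" using val nz P x y by simp
      then have v: "v = 0" by (simp add: smooth_form_def)
      have "local_equation smooth_form ?i ?o (vector [0, 1]) ?i [:[:0, 1:], 0, [:1, 0, - 1:]:]"
        using nz far by (simp add: local_equation_def smooth_form_def power2_eq_square algebra_simps)
      then show ?thesis unfolding P x y v by (rule smooth_atI) simp_all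
    qed
  next
    case x: (2 u)
    show ?thesis
    proof (cases rule: point_cases[OF xy(2)])
      case y: 1
      have "smooth_form (vector [u, 1]) ?i = 0" using val nz P x y by simp
      then show ?thesis by (simp add: smooth_form_def)
    next
      case y: (2 v)
      have "smooth_form (vector [u, 1]) (vector [v, 1]) = 0" using val nz P x y by simp
      then have eq: "u\<^sup>2 * v - v\<^sup>2 + 1 = 0" by (simp add: smooth_form_def)
      have le: "local_equation smooth_form (vector [u, 1]) ?i (vector [v, 1]) ?i
        [:[:u\<^sup>2 * v - v\<^sup>2 + 1, u\<^sup>2 - 2 * v, - 1:], [:2 * u * v, 2 * u:], [:v, 1:]:]"
        using nz far by (simp add: local_equation_def smooth_form_def power2_eq_square algebra_simps)
      have "2 * u * v \<noteq> 0 \<or> u\<^sup>2 - 2 * v \<noteq> 0"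
        using eq by (cases "v = 0") auto
      then show ?thesis unfolding P x y using eq by (intro smooth_atI[OF le]) simp_all
    qed
  qed
qed

text \<open>Division with respect to the leading monomial \<open>x\<^sub>1\<^sup>2 y\<^sub>1 y\<^sub>2\<close>: at infinity, where \<open>x\<^sub>2 = 0\<close>, the curve
  has the points \<open>y\<^sub>1 y\<^sub>2 = 0\<close>, so the coefficient of the highest power of \<open>x\<^sub>1\<close> in a form that vanishes
  on the curve is divisible by \<open>y\<^sub>1 y\<^sub>2\<close>, and this term can be removed by subtracting a multiple of the
  equation.  What remains is divisible by \<open>x\<^sub>2\<close>, and the quotient again vanishes on the curve because
  the points with \<open>x\<^sub>2 = 0\<close> are not isolated on it.\<close>

lemma vanishing_imp_multiple:
  assumes "biform a (b + 2) G" "\<And>x y. x \<noteq> 0 \<Longrightarrow> y \<noteq> 0 \<Longrightarrow> smooth_form x y = 0 \<Longrightarrow> G x y = 0"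
  shows "\<exists>H. (\<forall>x y. G x y = smooth_form x y * H x y) \<and> (if a < 2 then \<forall>x y. H x y = 0 else biform (a - 2) b H)"
  using assms
proof (induction a arbitrary: G rule: less_induct)
  case (less a)
  obtain c where c: "\<And>x y. G x y = (\<Sum>i\<le>a. \<Sum>j\<le>b + 2. c i j * monomial a (b + 2) i j x y)"
    using less.prems(1) unfolding biform_iff_monomials by blast
  show ?case
  proof (cases "a < 2")
    case True
    have "G x y = 0" for x y
    proof (rule biform_zeroI[OF less.prems(1), of "{0, 1, - 1}"])
      show "finite {0, 1, - 1 :: complex}" by simp
      fix u v :: complex assume v: "v \<notin> {0, 1, - 1}"
      define s where "s = csqrt ((v\<^sup>2 - 1) / v)"
      have "v\<^sup>2 \<noteq> 1" using v by (simp add: power2_eq_1_iff)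
      then have s: "s\<^sup>2 * v = v\<^sup>2 - 1" "s \<noteq> 0" using v unfolding s_def by simp_all
      have "smooth_form (vector [t, 1]) (vector [v, 1]) = 0" if "t = s \<or> t = - s" for t
        using s(1) that by (auto simp: smooth_form_def)
      then have root: "G (vector [t, 1]) (vector [v, 1]) = 0" if "t = s \<or> t = - s" for t
        using less.prems(2) that by (simp add: not_zero_2)
      define A B where "A = (\<Sum>j\<le>b + 2. c 0 j * v ^ j)" and "B = (if a = 0 then 0 else \<Sum>j\<le>b + 2. c 1 j * v ^ j)"
      have aff: "G (vector [t, 1]) (vector [v, 1]) = A + B * t" for t
      proof (cases "a = 0")
        case True then show ?thesis by (simp add: c monomial_def A_def B_def)
      next
        case False
        then have "a = 1" using \<open>a < 2\<close> by simp
        then show ?thesis by (simp add: c monomial_def A_def B_def sum_distrib_left algebra_simps)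
      qed
      have "A + B * s = 0" "A - B * s = 0" using root[of s] root[of "- s"] unfolding aff by simp_all
      then have "A = 0" "B * s = 0" by (simp_all add: add_eq_0_iff)
      then show "G (vector [u, 1]) (vector [v, 1]) = 0" unfolding aff using s(2) by simp
    qed
    then show ?thesis using True by (intro exI[of _ "\<lambda>x y. 0"]) simp
  next
    case False
    then obtain n where a: "a = n + 2" by (metis add.commute le_Suc_ex not_less)
    let ?i = "vector [1, 0] :: complex^2" and ?o = "vector [0, 1] :: complex^2"
    have lead: "G ?i y = (\<Sum>j\<le>b + 2. c a j * (y $ 1 ^ j * y $ 2 ^ (b + 2 - j)))" for y
    proof -
      have "G ?i y = (\<Sum>i\<le>a. if i = a then (\<Sum>j\<le>b + 2. c a j * (y $ 1 ^ j * y $ 2 ^ (b + 2 - j))) else 0)"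
        unfolding c by (intro sum.cong refl) (auto simp: monomial_def power_0_left simp del: sum.atMost_Suc intro!: sum.neutral)
      then show ?thesis by simp
    qed
    have "smooth_form ?i ?i = 0" "smooth_form ?i ?o = 0" by (simp_all add: smooth_form_def)
    then have "G ?i ?i = 0" "G ?i ?o = 0" using less.prems(2) by (simp_all add: not_zero_2)
    moreover have "G ?i ?i = c a (b + 2)"
    proof -
      have "G ?i ?i = (\<Sum>j\<le>b + 2. if j = b + 2 then c a j else 0)"
        unfolding lead by (intro sum.cong refl) auto
      then show ?thesis by simp
    qed
    moreover have "G ?i ?o = c a 0"
    proof -
      have "G ?i ?o = (\<Sum>j\<le>b + 2. if j = 0 then c a j else 0)"
        unfolding lead by (intro sum.cong refl) auto
      then show ?thesis by simp
    qed
    ultimately have c0: "c a 0 = 0" "c a (b + 2) = 0" by simp_all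
    define h where "h y = (\<Sum>j\<le>b. c a (j + 1) * (y $ 1 ^ j * y $ 2 ^ (b - j)))" for y :: "complex^2"
    have lead_h: "(\<Sum>j\<le>b + 2. c a j * (y $ 1 ^ j * y $ 2 ^ (b + 2 - j))) = y $ 1 * y $ 2 * h y" for y :: "complex^2"
    proof -
      have "(\<Sum>j\<le>b + 2. c a j * (y $ 1 ^ j * y $ 2 ^ (b + 2 - j))) =
        (\<Sum>j\<le>Suc b. c a j * (y $ 1 ^ j * y $ 2 ^ (b + 2 - j)))" using c0 by simp
      also have "\<dots> = (\<Sum>j\<le>b. c a (Suc j) * (y $ 1 ^ Suc j * y $ 2 ^ (b + 2 - Suc j)))"
        unfolding sum.atMost_Suc_shift using c0 by simp
      also have "\<dots> = y $ 1 * y $ 2 * h y"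
        unfolding h_def sum_distrib_left by (intro sum.cong refl) (simp add: Suc_diff_le)
      finally show ?thesis .
    qed
    define T where "T x y = x $ 1 ^ n * h y" for x y :: "complex^2"
    have T: "biform n b T"
    proof -
      have "biform n b (\<lambda>x y. \<Sum>j\<le>b. c a (j + 1) * monomial n b n j x y)"
        by (intro biform_sum biform_cmult biform_monomial) auto
      moreover have "T = (\<lambda>x y. \<Sum>j\<le>b. c a (j + 1) * monomial n b n j x y)"
        by (simp add: fun_eq_iff T_def h_def monomial_def sum_distrib_left mult_ac)
      ultimately show ?thesis by simp
    qed
    \<comment> \<open>the quotient by \<open>x\<^sub>2\<close> of \<open>G\<close> minus its leading term\<close>
    define R where "R x y = (\<Sum>i\<le>n + 1. \<Sum>j\<le>b + 2. c i j * monomial (n + 1) (b + 2) i j x y)" for x y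
    have R: "biform (n + 1) (b + 2) R" unfolding R_def by (intro biform_sum biform_cmult biform_monomial) auto
    have G_R: "G x y = x $ 2 * R x y + x $ 1 ^ a * (y $ 1 * y $ 2 * h y)" for x y
    proof -
      have "G x y = (\<Sum>i\<le>n + 1. \<Sum>j\<le>b + 2. c i j * monomial a (b + 2) i j x y) +
        (\<Sum>j\<le>b + 2. c a j * monomial a (b + 2) a j x y)" unfolding c a by simp
      also have "(\<Sum>j\<le>b + 2. c a j * monomial a (b + 2) a j x y) = x $ 1 ^ a * (y $ 1 * y $ 2 * h y)"
        unfolding lead_h[symmetric] sum_distrib_left
        by (intro sum.cong refl) (simp add: monomial_def mult_ac)
      also have "(\<Sum>i\<le>n + 1. \<Sum>j\<le>b + 2. c i j * monomial a (b + 2) i j x y) = x $ 2 * R x y"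
        unfolding R_def sum_distrib_left a
        by (intro sum.cong refl) (auto simp: monomial_def Suc_diff_le mult_ac)
      finally show ?thesis .
    qed
    define G' where "G' x y = R x y + x $ 1 ^ n * x $ 2 * (((y $ 1)\<^sup>2 - (y $ 2)\<^sup>2) * h y)" for x y
    have G_G': "G x y = x $ 2 * G' x y + smooth_form x y * T x y" for x y
      unfolding G_R G'_def T_def smooth_form_def a by (simp add: power2_eq_square algebra_simps)
    have G': "biform (n + 1) (b + 2) G'"
    proof -
      have "biform (1 + 0) (0 + 2) (\<lambda>x y. monomial 1 0 0 0 x y * (monomial 0 2 0 2 x y - monomial 0 2 0 0 x y))"
        by (intro biform_mult biform_diff biform_monomial) auto
      from biform_mult[OF this T]
      have "biform (n + 1) (b + 2) (\<lambda>x y. monomial 1 0 0 0 x y * (monomial 0 2 0 2 x y - monomial 0 2 0 0 x y) * T x y)"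
        by (simp add: add.commute)
      from biform_add[OF R this] show ?thesis
        unfolding G'_def[abs_def] T_def monomial_def by (simp add: mult_ac)
    qed
    have van: "G' x y = 0" if xy: "x \<noteq> 0" "y \<noteq> 0" "smooth_form x y = 0" for x y
    proof (rule zeros_not_isolated[OF continuous_edge_coefficients xy(1,2) _ _ _ G'])
      show "quad (quad (vector [1, 0, 0]) x *s vector [0, 1, 0] + - quad (vector [0, 0, 1]) x *s vector [1, 0, - 1]) y = 0"
        using xy(3) unfolding smooth_form_edge_form edge_form_as_quad .
      show "finite {pt ?i}" "finite {pt ?i, pt ?o}" by simp_all
      fix x' y' assume h: "x' \<noteq> 0" "y' \<noteq> 0"
        "quad (quad (vector [1, 0, 0]) x' *s vector [0, 1, 0] + - quad (vector [0, 0, 1]) x' *s vector [1, 0, - 1]) y' = 0"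
        "pt x' \<notin> {pt ?i} \<or> pt y' \<notin> {pt ?i, pt ?o}"
      have E: "smooth_form x' y' = 0" using h(3) unfolding smooth_form_edge_form edge_form_as_quad .
      have "x' $ 2 \<noteq> 0"
      proof
        assume "x' $ 2 = 0"
        then have "pt x' = pt ?i" "y' $ 1 = 0 \<or> y' $ 2 = 0"
          using h(1) E by (auto simp: pt_eq_infinity smooth_form_def not_zero_2)
        then show False using h(2,4) pt_eq_origin pt_eq_infinity by auto
      qed
      moreover have "x' $ 2 * G' x' y' = 0" using less.prems(2)[OF h(1,2) E] E unfolding G_G' by simp
      ultimately show "G' x' y' = 0" by simp
    qed
    obtain H' where H': "\<And>x y. G' x y = smooth_form x y * H' x y"
      "if n + 1 < 2 then \<forall>x y. H' x y = 0 else biform (n + 1 - 2) b H'"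
    proof -
      have "n + 1 < a" using a by simp
      from less.IH[OF this G' van] show thesis using that by blast
    qed
    define H where "H x y = x $ 2 * H' x y + T x y" for x y
    have "biform n b H"
    proof (cases "n = 0")
      case True
      then have "H = T" using H'(2) by (simp add: H_def fun_eq_iff)
      then show ?thesis using T by simp
    next
      case False
      then have "biform (n - 1) b H'" using H'(2) by (cases n) simp_all
      moreover have "biform 1 0 (\<lambda>x y. monomial 1 0 0 0 x y)" by (rule biform_monomial) simp_all
      ultimately have "biform (1 + (n - 1)) (0 + b) (\<lambda>x y. monomial 1 0 0 0 x y * H' x y)"
        by (intro biform_mult)
      then have "biform n b (\<lambda>x y. x $ 2 * H' x y)" using False by (simp add: monomial_def)
      from biform_add[OF this T] show ?thesis unfolding H_def[abs_def] .
    qed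
    moreover have "G x y = smooth_form x y * H x y" for x y
      unfolding G_G' H'(1) H_def by (simp add: algebra_simps)
    ultimately show ?thesis using a by (intro exI[of _ H]) simp
  qed
qed

text \<open>Multiplication by \<open>F\<close> maps the monomials of bidegree \<open>(n, n)\<close> to a basis.\<close>

lemma biform_dim_multiples:
  assumes cancel: "\<And>H. biform n n H \<Longrightarrow> (\<And>x y. F x y * H x y = 0) \<Longrightarrow> (\<forall>x y. H x y = 0)"
  shows "biform_dim {\<lambda>x y. F x y * H x y | H. biform n n H} = (n + 1)\<^sup>2"
proof -
  interpret forms: vector_space "\<lambda>(c::complex) F (x :: complex^2) (y :: complex^2). c * F x y :: complex"
    by unfold_locales (simp_all add: fun_eq_iff algebra_simps)
  let ?I = "{..n} \<times> {..n}"
  define B where "B = (\<lambda>(i, j) x y. F x y * monomial n n i j x y)"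
  have zero: "c (i, j) = 0" if c: "\<And>x y. F x y * (\<Sum>i\<le>n. \<Sum>j\<le>n. c (i, j) * monomial n n i j x y) = 0"
    and ij: "i \<le> n" "j \<le> n" for c i j
  proof -
    let ?H = "\<lambda>x y. \<Sum>i\<le>n. \<Sum>j\<le>n. c (i, j) * monomial n n i j x y"
    have "biform n n ?H" by (intro biform_sum biform_cmult biform_monomial) auto
    then have H: "?H x y = 0" for x y using cancel[of ?H] c by blast
    show ?thesis
    proof (rule double_sum_coeffs_zero[where K = "{}" and c = "\<lambda>i j. c (i, j)", OF _ _ ij])
      show "(\<Sum>i\<le>n. \<Sum>j\<le>n. c (i, j) * \<alpha> ^ i * \<beta> ^ j) = 0" for \<alpha> \<beta>
        using H[of "vector [\<alpha>, 1]" "vector [\<beta>, 1]"] by (simp add: monomial_def mult_ac)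
    qed simp
  qed
  have sum_B: "(\<Sum>p\<in>?I. (\<lambda>x y. c p * B p x y)) x y = F x y * (\<Sum>i\<le>n. \<Sum>j\<le>n. c (i, j) * monomial n n i j x y)"
    for c x y
  proof -
    have "(\<Sum>p\<in>?I. (\<lambda>x y. c p * B p x y)) x y = (\<Sum>p\<in>?I. c p * B p x y)"
    proof -
      have "(\<Sum>p\<in>I. f p) x y = (\<Sum>p\<in>I. f p x y)"
        for I :: "(nat \<times> nat) set" and f :: "nat \<times> nat \<Rightarrow> complex^2 \<Rightarrow> complex^2 \<Rightarrow> complex"
        by (induction I rule: infinite_finite_induct) simp_all
      then show ?thesis .
    qed
    also have "\<dots> = (\<Sum>i\<le>n. \<Sum>j\<le>n. c (i, j) * B (i, j) x y)" by (simp add: sum.cartesian_product)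
    also have "\<dots> = F x y * (\<Sum>i\<le>n. \<Sum>j\<le>n. c (i, j) * monomial n n i j x y)"
      by (simp add: B_def sum_distrib_left mult_ac)
    finally show ?thesis .
  qed
  have indep: "c p = 0" if "(\<Sum>p\<in>?I. (\<lambda>x y. c p * B p x y)) = 0" "p \<in> ?I" for c p
  proof -
    have "F x y * (\<Sum>i\<le>n. \<Sum>j\<le>n. c (i, j) * monomial n n i j x y) = 0" for x y
      unfolding sum_B[symmetric] that(1) by simp
    then show ?thesis using zero[of c "fst p" "snd p"] that(2) by auto
  qed
  have inj: "inj_on B ?I"
  proof (rule inj_onI, rule ccontr)
    fix p q assume pq: "p \<in> ?I" "q \<in> ?I" "B p = B q" "p \<noteq> q"
    define c :: "nat \<times> nat \<Rightarrow> complex" where "c r = (if r = p then 1 else if r = q then - 1 else 0)" for r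
    have "(\<Sum>r\<in>?I. (\<lambda>x y. c r * B r x y)) = (\<Sum>r\<in>{p, q}. (\<lambda>x y. c r * B r x y))"
      using pq(1,2) by (intro sum.mono_neutral_right) (auto simp: c_def fun_eq_iff)
    also have "\<dots> = 0" using pq(3,4) by (simp add: c_def fun_eq_iff)
    finally have "c p = 0" using indep pq(1) by blast
    then show False by (simp add: c_def)
  qed
  have "forms.dim {\<lambda>x y. F x y * H x y | H. biform n n H} = (n + 1)\<^sup>2"
  proof (rule forms.dim_unique)
    show "B ` ?I \<subseteq> {\<lambda>x y. F x y * H x y | H. biform n n H}"
      unfolding B_def using biform_monomial by fastforce
    show "{\<lambda>x y. F x y * H x y | H. biform n n H} \<subseteq> forms.span (B ` ?I)"
    proof
      fix G assume "G \<in> {\<lambda>x y. F x y * H x y | H. biform n n H}"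
      then obtain H where G: "G = (\<lambda>x y. F x y * H x y)" and "biform n n H" by blast
      then obtain c where c: "\<And>x y. H x y = (\<Sum>i\<le>n. \<Sum>j\<le>n. c i j * monomial n n i j x y)"
        unfolding biform_iff_monomials by blast
      have "G = (\<Sum>p\<in>?I. (\<lambda>x y. (case p of (i, j) \<Rightarrow> c i j) * B p x y))"
        unfolding fun_eq_iff sum_B G c by simp
      also have "\<dots> \<in> forms.span (B ` ?I)"
        by (intro forms.span_sum forms.span_scale forms.span_base imageI)
      finally show "G \<in> forms.span (B ` ?I)" .
    qed
    show "forms.independent (B ` ?I)"
    proof (rule forms.independent_if_scalars_zero)
      show "finite (B ` ?I)" by simp
      fix u b assume u: "(\<Sum>b\<in>B ` ?I. (\<lambda>x y. u b * b x y)) = 0" and b: "b \<in> B ` ?I"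
      have "(\<Sum>p\<in>?I. (\<lambda>x y. (u \<circ> B) p * B p x y)) = 0" using u unfolding sum.reindex[OF inj] by (simp add: o_def)
      then show "u b = 0" using indep[of "u \<circ> B"] b by auto
    qed
    show "card (B ` ?I) = (n + 1)\<^sup>2" using inj by (simp add: card_image power2_eq_square)
  qed
  then show ?thesis unfolding biform_dim_def .
qed

text \<open>The Hilbert polynomial \<open>(m + 1)\<^sup>2 - (m - 1)\<^sup>2 = 4 m\<close> belongs to a curve of degree four and genus one.\<close>

lemma smooth_form_arithmetic_genus: "has_arithmetic_genus (zeros smooth_form) 1"
proof -
  have nz: "smooth_form (vector [1, 0]) (vector [1, 1]) \<noteq> 0" by (simp add: smooth_form_def)
  have "hilbert_function (zeros smooth_form) (n + 2) = 4 * int (n + 2) + 1 - 1" for n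
  proof -
    let ?m = "n + 2"
    have "biform_dim {\<lambda>x y. (1 :: complex) * H x y | H. biform ?m ?m H} = (?m + 1)\<^sup>2"
      by (rule biform_dim_multiples) simp
    then have all: "biform_dim {G. biform ?m ?m G} = (?m + 1)\<^sup>2" by simp
    have "biform_dim {\<lambda>x y. smooth_form x y * H x y | H. biform n n H} = (n + 1)\<^sup>2"
      using biform_mult_eq_0[OF biform_smooth_form _ _ nz] by (intro biform_dim_multiples) blast
    moreover have "{G. biform ?m ?m G \<and> zeros smooth_form \<subseteq> zeros G} = {\<lambda>x y. smooth_form x y * H x y | H. biform n n H}"
    proof (intro equalityI subsetI)
      fix G assume "G \<in> {G. biform ?m ?m G \<and> zeros smooth_form \<subseteq> zeros G}"
      then have G: "biform ?m ?m G" "zeros smooth_form \<subseteq> zeros G" by auto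
      have "\<And>x y. x \<noteq> 0 \<Longrightarrow> y \<noteq> 0 \<Longrightarrow> smooth_form x y = 0 \<Longrightarrow> G x y = 0"
        using G(2) unfolding zeros_subset_iff[OF G(1)] by blast
      from vanishing_imp_multiple[OF G(1) this]
      obtain H where H: "\<And>x y. G x y = smooth_form x y * H x y"
        "if ?m < 2 then \<forall>x y. H x y = 0 else biform (?m - 2) n H" by blast
      from H(2) have "biform n n H" by simp
      have "G = (\<lambda>x y. smooth_form x y * H x y)" using H(1) by blast
      then show "G \<in> {\<lambda>x y. smooth_form x y * H x y | H. biform n n H}"
        using \<open>biform n n H\<close> by blast
    next
      fix G assume "G \<in> {\<lambda>x y. smooth_form x y * H x y | H. biform n n H}"
      then obtain H where G: "G = (\<lambda>x y. smooth_form x y * H x y)" and H: "biform n n H" by blast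
      have "biform ?m ?m G" using biform_mult[OF biform_smooth_form H] unfolding G by (simp add: add.commute)
      then show "G \<in> {G. biform ?m ?m G \<and> zeros smooth_form \<subseteq> zeros G}"
        using zeros_subset_iff[of ?m ?m G smooth_form] G by simp
    qed
    ultimately have van: "biform_dim {G. biform ?m ?m G \<and> zeros smooth_form \<subseteq> zeros G} = (n + 1)\<^sup>2" by simp
    show ?thesis unfolding hilbert_function_def all van by (simp add: power2_eq_square algebra_simps)
  qed
  then have "hilbert_function (zeros smooth_form) m = 4 * int m + 1 - 1" if "m \<ge> 2" for m
    using that by (metis le_add_diff_inverse2)
  then show ?thesis unfolding has_arithmetic_genus_def eventually_sequentially by blast
qed

lemma edge_curve_smooth: "occurs_as_edge_curve type_smooth"
proof (rule occurs_as_edge_curveI)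
  show "independent_pair (vector [1, 0, 0]) (vector [0, 0, 1] :: complex^3)"
    "independent_pair (vector [1, 0, - 1]) (vector [0, 1, 0] :: complex^3)"
    by (simp_all add: independent_pair_def vec3_eq_iff)
  show "smooth_form x y = edge_form (vector [1, 0, 0]) (vector [0, 0, 1]) (vector [1, 0, - 1]) (vector [0, 1, 0]) x y" for x y
    by (rule smooth_form_edge_form)
  show "type_smooth smooth_form"
    unfolding type_smooth_def
    using biform_smooth_form smooth_form_smooth_at smooth_form_arithmetic_genus by blast
qed

theorem theorem3p11:
  shows "occurs_as_edge_curve type_smooth
    \<and> occurs_as_edge_curve type_node
    \<and> \<not> occurs_as_edge_curve type_cusp
    \<and> \<not> occurs_as_edge_curve type_10_10_01_01
    \<and> occurs_as_edge_curve type_11_11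
    \<and> occurs_as_edge_curve type_21_01_secant
    \<and> occurs_as_edge_curve type_21_01_tangent
    \<and> occurs_as_edge_curve type_11_01_10_triangle
    \<and> occurs_as_edge_curve type_11_01_10_concurrent"
  using edge_curve_smooth edge_curve_node cusp_not_edge_curve four_lines_not_edge_curve
    edge_curve_11_11 edge_curve_21_01_secant edge_curve_21_01_tangent
    edge_curve_11_01_10_triangle edge_curve_11_01_10_concurrent
  by blast

end
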